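(* Let $\mathcal K$ be a 2-category and $G=(G,d,e)$ a 2-comonad on $\mathcal K$. If the 2-category $\mathcal K^G$ of strict $G$-coalgebras has lax descent objects for lax coherence data, and so in particular if $\mathcal K^G$ has inserters and equifiers, then the inclusion 2-functor $\mathcal K^G\to\mathrm{Lax}\text{-}G\text{-}\mathrm{Coalg}_\ell$ has a right adjoint.
   Context: A 2-comonad $G=(G,d,e)$ on $\mathcal K$ is a 2-functor $G\colon\mathcal K\to\mathcal K$ with 2-natural comultiplication $d\colon G\to G^2$ and counit $e\colon G\to 1$ satisfying the comonad laws strictly. Whiskering is denoted by $\cdot$ (or juxtaposition) and vertical composition of 2-cells by $\circ$. Adjunctions between 2-functors are 2-adjunctions. **Lax $G$-coalgebra** $(A,a,\alpha,\alpha_0)$: an object $A$, a morphism $a\colon A\to GA$, and 2-cells $\alpha\colon Ga\cdot a\Rightarrow dA\cdot a$, $\alpha_0\colon 1_A\Rightarrow eA\cdot a$, such that: (1) $(GdA\cdot\alpha)\circ(G\alpha\cdot a)=(dGA\cdot\alpha)\circ(G^2a\cdot\alpha)$; (2) $(GeA\cdot\alpha)\circ(G\alpha_0\cdot a)=1_a$; (3) $(eGA\cdot\alpha)\circ(a\cdot\alpha_0)=1_a$. **Lax $G$-morphism** $(f,\overline f)\colon(A,a,\alpha,\alpha_0)\to(B,b,\beta,\beta_0)$: a morphism $f\colon A\to B$ and a 2-cell $\overline f\colon b\cdot f\Rightarrow Gf\cdot a$ such that: (1) $(dB\cdot\overline f)\circ(\beta\cdot f)=(G^2f\cdot\alpha)\circ(G\overline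 f\cdot a)\circ(Gb\cdot\overline f)$; (2) $(eB\cdot\overline f)\circ(\beta_0\cdot f)=f\cdot\alpha_0$. **$G$-transformation** $(f,\overline f)\to(g,\overline g)$ between lax $G$-morphisms: a 2-cell $\rho\colon f\Rightarrow g$ with $(G\rho\cdot a)\circ\overline f=\overline g\circ(b\cdot\rho)$. $\mathrm{Lax}\text{-}G\text{-}\mathrm{Coalg}_\ell$ is the 2-category of lax $G$-coalgebras, lax $G$-morphisms and $G$-transformations. $\mathcal K^G$ is the Eilenberg–Moore 2-category: strict $G$-coalgebras ($\alpha,\alpha_0$ identities), strict morphisms ($\overline f$ an identity) and $G$-transformations; it is included in $\mathrm{Lax}\text{-}G\text{-}\mathrm{Coalg}_\ell$. **Lax coherence data** in a 2-category $\mathcal L$: objects $X_1,X_2,X_3$, morphisms $k,l\colon X_1\to X_2$, $j\colon X_2\to X_1$, $p,q,r\colon X_2\to X_3$, and 2-cells $\gamma\colon 1\Rightarrow jk$, $\delta\colon jl\Rightarrow 1$, $\kappa\colon pl\Rightarrow ql$, $\lambda\colon rk\Rightarrow qk$, $\rho\colon rl\Rightarrow pk$. A **lax descent object** for such data is a universal object $L$ equipped with a morphism $v\colon L\to X_1$ and a 2-cell $\psi\colon kv\Rightarrow lv$ satisfying $$(\kappa v)\circ(p\psi)\circ(\rho v)\circ(r\psi)=(q\psi)\circ(\lambda v),\qquad(\delta v)\circ(j\psi)\circ(\gamma v)=1_v.$$ Universal means: for every $Z$, composition with $(v,\psi)$ gives an isomorphism, 2-natural in $Z$, between $\mathcal L(Z,L)$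 and the category of pairs $(v'\colon Z\to X_1,\ \psi'\colon kv'\Rightarrow lv')$ satisfying these equations, with morphisms $(v',\psi')\to(v'',\psi'')$ the 2-cells $\theta\colon v'\Rightarrow v''$ with $(l\theta)\circ\psi'=\psi''\circ(k\theta)$. The example relevant to a lax $G$-coalgebra $(A,a,\alpha,\alpha_0)$ has, in $\mathcal K^G$ (with cofree coalgebras): $X_1=GA$, $X_2=G^2A$, $X_3=G^3A$, $k=Ga$, $l=dA$, $j=GeA$, $r=G^2a$, $q=GdA$, $p=dGA$, $\gamma=G\alpha_0$, $\lambda=G\alpha$, and $\delta,\kappa,\rho$ identities. *)

theory Defs
  imports Main
begin

section \<open>Strict 2-categories\<close>

text \<open>
  Carriers are sets, so that a 2-category need not exhaust its types; the operations are
  only constrained on (composable elements of) the carriers.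
  Composition is written in applicative order: \<open>g \<cdot> f\<close> is \<open>g\<close> after \<open>f\<close>,
  \<open>\<beta> \<bullet> \<alpha>\<close> is the vertical composite \<open>\<beta>\<close> after \<open>\<alpha>\<close>, and \<open>\<beta> \<star> \<alpha>\<close> is
  the horizontal composite of \<open>\<alpha> : f \<Rightarrow> f'\<close> and \<open>\<beta> : g \<Rightarrow> g'\<close>, a 2-cell from
  \<open>g \<cdot> f\<close> to \<open>g' \<cdot> f'\<close>.
\<close>

record ('o, 'm, 'c) two_cat =
  Obj :: "'o set"
  Mor :: "'m set"
  Cel :: "'c set"
  Dom :: "'m \<Rightarrow> 'o"
  Cod :: "'m \<Rightarrow> 'o"
  Src :: "'c \<Rightarrow> 'm"
  Trg :: "'c \<Rightarrow> 'm"
  Id1 :: "'o \<Rightarrow> 'm" ("\<one>\<index>")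
  comp1 :: "'m \<Rightarrow> 'm \<Rightarrow> 'm" (infixl "\<cdot>\<index>" 75)
  Id2 :: "'m \<Rightarrow> 'c" ("\<iota>\<index>")
  vcomp :: "'c \<Rightarrow> 'c \<Rightarrow> 'c" (infixl "\<bullet>\<index>" 65)
  hcomp :: "'c \<Rightarrow> 'c \<Rightarrow> 'c" (infixl "\<star>\<index>" 75)

definition Hom :: "('o, 'm, 'c) two_cat \<Rightarrow> 'o \<Rightarrow> 'o \<Rightarrow> 'm set" where
  "Hom C A B = {f \<in> Mor C. Dom C f = A \<and> Cod C f = B}"

definition Cells :: "('o, 'm, 'c) two_cat \<Rightarrow> 'm \<Rightarrow> 'm \<Rightarrow> 'c set" where
  "Cells C f g = {\<alpha> \<in> Cel C. Src C \<alpha> = f \<and> Trg C \<alpha> = g}"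

definition whisker_left ::
    "('o, 'm, 'c) two_cat \<Rightarrow> 'm \<Rightarrow> 'c \<Rightarrow> 'c" (infixr "\<rhd>\<index>" 75) where
  "whisker_left C f \<alpha> = hcomp C (Id2 C f) \<alpha>"

definition whisker_right ::
    "('o, 'm, 'c) two_cat \<Rightarrow> 'c \<Rightarrow> 'm \<Rightarrow> 'c" (infixl "\<lhd>\<index>" 75) where
  "whisker_right C \<alpha> f = hcomp C \<alpha> (Id2 C f)"

locale two_category =
  fixes C :: "('o, 'm, 'c) two_cat" (structure)
  assumes Dom_Obj: "f \<in> Mor C \<Longrightarrow> Dom C f \<in> Obj C"
    and Cod_Obj: "f \<in> Mor C \<Longrightarrow> Cod C f \<in> Obj C"
    and Src_Mor: "\<alpha> \<in> Cel C \<Longrightarrow> Src C \<alpha> \<in> Mor C"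
    and Trg_Mor: "\<alpha> \<in> Cel C \<Longrightarrow> Trg C \<alpha> \<in> Mor C"
    and Dom_Src_Trg: "\<alpha> \<in> Cel C \<Longrightarrow> Dom C (Src C \<alpha>) = Dom C (Trg C \<alpha>)"
    and Cod_Src_Trg: "\<alpha> \<in> Cel C \<Longrightarrow> Cod C (Src C \<alpha>) = Cod C (Trg C \<alpha>)"
    \<comment> \<open>underlying category\<close>
    and Id1_Hom: "A \<in> Obj C \<Longrightarrow> \<one> A \<in> Hom C A A"
    and comp1_Hom: "\<lbrakk>f \<in> Hom C A B; g \<in> Hom C B D\<rbrakk> \<Longrightarrow> g \<cdot> f \<in> Hom C A D"
    and comp1_Id1_left: "f \<in> Hom C A B \<Longrightarrow> \<one> B \<cdot> f = f"
    and comp1_Id1_right: "f \<in> Hom C A B \<Longrightarrow> f \<cdot> \<one> A = f"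
    and comp1_assoc:
      "\<lbrakk>f \<in> Hom C A B; g \<in> Hom C B D; h \<in> Hom C D E\<rbrakk> \<Longrightarrow> h \<cdot> g \<cdot> f = h \<cdot> (g \<cdot> f)"
    \<comment> \<open>hom-categories\<close>
    and Id2_Cells: "f \<in> Mor C \<Longrightarrow> \<iota> f \<in> Cells C f f"
    and vcomp_Cells: "\<lbrakk>\<alpha> \<in> Cells C f g; \<beta> \<in> Cells C g h\<rbrakk> \<Longrightarrow> \<beta> \<bullet> \<alpha> \<in> Cells C f h"
    and vcomp_Id2_left: "\<alpha> \<in> Cells C f g \<Longrightarrow> \<iota> g \<bullet> \<alpha> = \<alpha>"
    and vcomp_Id2_right: "\<alpha> \<in> Cells C f g \<Longrightarrow> \<alpha> \<bullet> \<iota> f = \<alpha>"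
    and vcomp_assoc:
      "\<lbrakk>\<alpha> \<in> Cells C f g; \<beta> \<in> Cells C g h; \<gamma> \<in> Cells C h k\<rbrakk>
        \<Longrightarrow> \<gamma> \<bullet> \<beta> \<bullet> \<alpha> = \<gamma> \<bullet> (\<beta> \<bullet> \<alpha>)"
    \<comment> \<open>horizontal composition\<close>
    and hcomp_Cells:
      "\<lbrakk>\<alpha> \<in> Cells C f f'; \<beta> \<in> Cells C g g'; Dom C g = Cod C f\<rbrakk>
        \<Longrightarrow> \<beta> \<star> \<alpha> \<in> Cells C (g \<cdot> f) (g' \<cdot> f')"
    and hcomp_Id1_left: "\<alpha> \<in> Cells C f g \<Longrightarrow> \<iota> (\<one> (Cod C f)) \<star> \<alpha> = \<alpha>"
    and hcomp_Id1_right: "\<alpha> \<in> Cells C f g \<Longrightarrow> \<alpha> \<star> \<iota> (\<one> (Dom C f)) = \<alpha>"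
    and hcomp_assoc:
      "\<lbrakk>\<alpha> \<in> Cells C f f'; \<beta> \<in> Cells C g g'; \<gamma> \<in> Cells C h h';
        Dom C g = Cod C f; Dom C h = Cod C g\<rbrakk>
        \<Longrightarrow> \<gamma> \<star> \<beta> \<star> \<alpha> = \<gamma> \<star> (\<beta> \<star> \<alpha>)"
    and hcomp_Id2:
      "\<lbrakk>f \<in> Mor C; g \<in> Mor C; Dom C g = Cod C f\<rbrakk> \<Longrightarrow> \<iota> g \<star> \<iota> f = \<iota> (g \<cdot> f)"
    and interchange:
      "\<lbrakk>\<alpha> \<in> Cells C f f'; \<alpha>' \<in> Cells C f' f''; \<beta> \<in> Cells C g g'; \<beta>' \<in> Cells C g' g'';
        Dom C g = Cod C f\<rbrakk>
        \<Longrightarrow> (\<beta>' \<bullet> \<beta>) \<star> (\<alpha>' \<bullet> \<alpha>) = (\<beta>' \<star> \<alpha>') \<bullet> (\<beta> \<star> \<alpha>)"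


section \<open>2-functors, 2-natural transformations, 2-adjunctions, 2-comonads\<close>

record ('o, 'm, 'c, 'o1, 'm1, 'c1) two_fun =
  on_Obj :: "'o \<Rightarrow> 'o1" ("_\<langle>_\<rangle>\<^sub>0" [1000, 0] 1000)
  on_Mor :: "'m \<Rightarrow> 'm1" ("_\<langle>_\<rangle>\<^sub>1" [1000, 0] 1000)
  on_Cel :: "'c \<Rightarrow> 'c1" ("_\<langle>_\<rangle>\<^sub>2" [1000, 0] 1000)

definition id_fun :: "('o, 'm, 'c, 'o, 'm, 'c) two_fun" where
  "id_fun = \<lparr>on_Obj = (\<lambda>A. A), on_Mor = (\<lambda>f. f), on_Cel = (\<lambda>\<alpha>. \<alpha>)\<rparr>"

definition comp_fun ::
    "('o1, 'm1, 'c1, 'o2, 'm2, 'c2) two_fun \<Rightarrow> ('o, 'm, 'c, 'o1, 'm1, 'c1) two_fun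
      \<Rightarrow> ('o, 'm, 'c, 'o2, 'm2, 'c2) two_fun" where
  "comp_fun F' F =
    \<lparr>on_Obj = (\<lambda>A. F'\<langle>F\<langle>A\<rangle>\<^sub>0\<rangle>\<^sub>0), on_Mor = (\<lambda>f. F'\<langle>F\<langle>f\<rangle>\<^sub>1\<rangle>\<^sub>1), on_Cel = (\<lambda>\<alpha>. F'\<langle>F\<langle>\<alpha>\<rangle>\<^sub>2\<rangle>\<^sub>2)\<rparr>"

locale two_functor = C: two_category C + D: two_category D
  for C :: "('o, 'm, 'c) two_cat" and D :: "('o1, 'm1, 'c1) two_cat" +
  fixes F :: "('o, 'm, 'c, 'o1, 'm1, 'c1) two_fun"
  assumes fun_Obj: "A \<in> Obj C \<Longrightarrow> F\<langle>A\<rangle>\<^sub>0 \<in> Obj D"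
    and fun_Hom: "f \<in> Hom C A B \<Longrightarrow> F\<langle>f\<rangle>\<^sub>1 \<in> Hom D (F\<langle>A\<rangle>\<^sub>0) (F\<langle>B\<rangle>\<^sub>0)"
    and fun_Cells: "\<alpha> \<in> Cells C f g \<Longrightarrow> F\<langle>\<alpha>\<rangle>\<^sub>2 \<in> Cells D (F\<langle>f\<rangle>\<^sub>1) (F\<langle>g\<rangle>\<^sub>1)"
    and fun_Id1: "A \<in> Obj C \<Longrightarrow> F\<langle>\<one>\<^bsub>C\<^esub> A\<rangle>\<^sub>1 = \<one>\<^bsub>D\<^esub> (F\<langle>A\<rangle>\<^sub>0)"
    and fun_comp1: "\<lbrakk>f \<in> Hom C A B; g \<in> Hom C B E\<rbrakk> \<Longrightarrow> F\<langle>g \<cdot>\<^bsub>C\<^esub> f\<rangle>\<^sub>1 = F\<langle>g\<rangle>\<^sub>1 \<cdot>\<^bsub>D\<^esub> F\<langle>f\<rangle>\<^sub>1"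
    and fun_Id2: "f \<in> Mor C \<Longrightarrow> F\<langle>\<iota>\<^bsub>C\<^esub> f\<rangle>\<^sub>2 = \<iota>\<^bsub>D\<^esub> (F\<langle>f\<rangle>\<^sub>1)"
    and fun_vcomp:
      "\<lbrakk>\<alpha> \<in> Cells C f g; \<beta> \<in> Cells C g h\<rbrakk> \<Longrightarrow> F\<langle>\<beta> \<bullet>\<^bsub>C\<^esub> \<alpha>\<rangle>\<^sub>2 = F\<langle>\<beta>\<rangle>\<^sub>2 \<bullet>\<^bsub>D\<^esub> F\<langle>\<alpha>\<rangle>\<^sub>2"
    and fun_hcomp:
      "\<lbrakk>\<alpha> \<in> Cells C f f'; \<beta> \<in> Cells C g g'; Dom C g = Cod C f\<rbrakk>
        \<Longrightarrow> F\<langle>\<beta> \<star>\<^bsub>C\<^esub> \<alpha>\<rangle>\<^sub>2 = F\<langle>\<beta>\<rangle>\<^sub>2 \<star>\<^bsub>D\<^esub> F\<langle>\<alpha>\<rangle>\<^sub>2"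

locale two_natural = F: two_functor C D F + F': two_functor C D F'
  for C :: "('o, 'm, 'c) two_cat" and D :: "('o1, 'm1, 'c1) two_cat"
    and F F' :: "('o, 'm, 'c, 'o1, 'm1, 'c1) two_fun" +
  fixes t :: "'o \<Rightarrow> 'm1"
  assumes component_Hom: "A \<in> Obj C \<Longrightarrow> t A \<in> Hom D (F\<langle>A\<rangle>\<^sub>0) (F'\<langle>A\<rangle>\<^sub>0)"
    and natural_Mor: "f \<in> Hom C A B \<Longrightarrow> t B \<cdot>\<^bsub>D\<^esub> F\<langle>f\<rangle>\<^sub>1 = F'\<langle>f\<rangle>\<^sub>1 \<cdot>\<^bsub>D\<^esub> t A"
    and natural_Cel:
      "\<lbrakk>f \<in> Hom C A B; g \<in> Hom C A B; \<alpha> \<in> Cells C f g\<rbrakk>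
        \<Longrightarrow> t B \<rhd>\<^bsub>D\<^esub> F\<langle>\<alpha>\<rangle>\<^sub>2 = F'\<langle>\<alpha>\<rangle>\<^sub>2 \<lhd>\<^bsub>D\<^esub> t A"

locale two_adjunction =
  F: two_functor C D F + R: two_functor D C R +
  unit: two_natural C C id_fun "comp_fun R F" \<eta> +
  counit: two_natural D D "comp_fun F R" id_fun \<epsilon>
  for C :: "('o, 'm, 'c) two_cat" and D :: "('o1, 'm1, 'c1) two_cat"
    and F :: "('o, 'm, 'c, 'o1, 'm1, 'c1) two_fun"
    and R :: "('o1, 'm1, 'c1, 'o, 'm, 'c) two_fun"
    and \<eta> :: "'o \<Rightarrow> 'm" and \<epsilon> :: "'o1 \<Rightarrow> 'm1" +
  assumes triangle_left: "A \<in> Obj C \<Longrightarrow> \<epsilon> (F\<langle>A\<rangle>\<^sub>0) \<cdot>\<^bsub>D\<^esub> F\<langle>\<eta> A\<rangle>\<^sub>1 = \<one>\<^bsub>D\<^esub> (F\<langle>A\<rangle>\<^sub>0)"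
    and triangle_right: "B \<in> Obj D \<Longrightarrow> R\<langle>\<epsilon> B\<rangle>\<^sub>1 \<cdot>\<^bsub>C\<^esub> \<eta> (R\<langle>B\<rangle>\<^sub>0) = \<one>\<^bsub>C\<^esub> (R\<langle>B\<rangle>\<^sub>0)"

definition has_right_adjoint ::
    "('o, 'm, 'c) two_cat \<Rightarrow> ('o1, 'm1, 'c1) two_cat
      \<Rightarrow> ('o, 'm, 'c, 'o1, 'm1, 'c1) two_fun \<Rightarrow> bool" where
  "has_right_adjoint C D F \<longleftrightarrow> (\<exists>R \<eta> \<epsilon>. two_adjunction C D F R \<eta> \<epsilon>)"

locale two_comonad =
  G: two_functor K K G +
  comult: two_natural K K G "comp_fun G G" d +
  counit: two_natural K K G id_fun e
  for K :: "('o, 'm, 'c) two_cat" (structure)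
    and G :: "('o, 'm, 'c, 'o, 'm, 'c) two_fun"
    and d e :: "'o \<Rightarrow> 'm" +
  assumes coassoc: "A \<in> Obj K \<Longrightarrow> G\<langle>d A\<rangle>\<^sub>1 \<cdot> d A = d (G\<langle>A\<rangle>\<^sub>0) \<cdot> d A"
    and counit_left: "A \<in> Obj K \<Longrightarrow> e (G\<langle>A\<rangle>\<^sub>0) \<cdot> d A = \<one> (G\<langle>A\<rangle>\<^sub>0)"
    and counit_right: "A \<in> Obj K \<Longrightarrow> G\<langle>e A\<rangle>\<^sub>1 \<cdot> d A = \<one> (G\<langle>A\<rangle>\<^sub>0)"


section \<open>Lax coalgebras\<close>

text \<open>
  Morphisms and 2-cells of the 2-category of lax coalgebras carry their boundary, since
  a morphism (2-cell) of the base may underlie lax morphisms (transformations) with different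
  boundaries.
\<close>

datatype ('o, 'm, 'c) coalg =
  Coalg (carrier: 'o) (act: 'm) (mult_cell: 'c) (unit_cell: 'c)

datatype ('o, 'm, 'c) coalg_mor =
  Coalg_Mor (mor_dom: "('o, 'm, 'c) coalg") (mor_cod: "('o, 'm, 'c) coalg")
    (mor: 'm) (mor_cell: 'c)

datatype ('o, 'm, 'c) coalg_trans =
  Coalg_Trans (trans_src: "('o, 'm, 'c) coalg_mor") (trans_trg: "('o, 'm, 'c) coalg_mor")
    (trans: 'c)

context
  fixes K :: "('o, 'm, 'c) two_cat" (structure)
    and G :: "('o, 'm, 'c, 'o, 'm, 'c) two_fun"
    and d e :: "'o \<Rightarrow> 'm"
begin

fun lax_coalg :: "('o, 'm, 'c) coalg \<Rightarrow> bool" where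
  "lax_coalg (Coalg A a \<alpha> \<alpha>\<^sub>0) \<longleftrightarrow>
    A \<in> Obj K \<and> a \<in> Hom K A (G\<langle>A\<rangle>\<^sub>0) \<and>
    \<alpha> \<in> Cells K (G\<langle>a\<rangle>\<^sub>1 \<cdot> a) (d A \<cdot> a) \<and>
    \<alpha>\<^sub>0 \<in> Cells K (\<one> A) (e A \<cdot> a) \<and>
    (G\<langle>d A\<rangle>\<^sub>1 \<rhd> \<alpha>) \<bullet> (G\<langle>\<alpha>\<rangle>\<^sub>2 \<lhd> a) = (d (G\<langle>A\<rangle>\<^sub>0) \<rhd> \<alpha>) \<bullet> (G\<langle>G\<langle>a\<rangle>\<^sub>1\<rangle>\<^sub>1 \<rhd> \<alpha>) \<and>
    (G\<langle>e A\<rangle>\<^sub>1 \<rhd> \<alpha>) \<bullet> (G\<langle>\<alpha>\<^sub>0\<rangle>\<^sub>2 \<lhd> a) = \<iota> a \<and>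
    (e (G\<langle>A\<rangle>\<^sub>0) \<rhd> \<alpha>) \<bullet> (a \<rhd> \<alpha>\<^sub>0) = \<iota> a"

fun lax_mor_cond ::
    "('o, 'm, 'c) coalg \<Rightarrow> ('o, 'm, 'c) coalg \<Rightarrow> 'm \<Rightarrow> 'c \<Rightarrow> bool" where
  "lax_mor_cond (Coalg A a \<alpha> \<alpha>\<^sub>0) (Coalg B b \<beta> \<beta>\<^sub>0) f \<phi> \<longleftrightarrow>
    f \<in> Hom K A B \<and>
    \<phi> \<in> Cells K (b \<cdot> f) (G\<langle>f\<rangle>\<^sub>1 \<cdot> a) \<and>
    (d B \<rhd> \<phi>) \<bullet> (\<beta> \<lhd> f) = (G\<langle>G\<langle>f\<rangle>\<^sub>1\<rangle>\<^sub>1 \<rhd> \<alpha>) \<bullet> (G\<langle>\<phi>\<rangle>\<^sub>2 \<lhd> a) \<bullet> (G\<langle>b\<rangle>\<^sub>1 \<rhd> \<phi>) \<and>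
    (e B \<rhd> \<phi>) \<bullet> (\<beta>\<^sub>0 \<lhd> f) = f \<rhd> \<alpha>\<^sub>0"

definition lax_mor :: "('o, 'm, 'c) coalg_mor \<Rightarrow> bool" where
  "lax_mor F \<longleftrightarrow>
    lax_coalg (mor_dom F) \<and> lax_coalg (mor_cod F) \<and>
    lax_mor_cond (mor_dom F) (mor_cod F) (mor F) (mor_cell F)"

definition G_trans :: "('o, 'm, 'c) coalg_trans \<Rightarrow> bool" where
  "G_trans T \<longleftrightarrow>
    (let F = trans_src T; F' = trans_trg T; X = mor_dom F; Y = mor_cod F in
      lax_mor F \<and> lax_mor F' \<and> mor_dom F' = X \<and> mor_cod F' = Y \<and>
      trans T \<in> Cells K (mor F) (mor F') \<and>
      (G\<langle>trans T\<rangle>\<^sub>2 \<lhd> act X) \<bullet> mor_cell F = mor_cell F' \<bullet> (act Y \<rhd> trans T))"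

definition lax_id :: "('o, 'm, 'c) coalg \<Rightarrow> ('o, 'm, 'c) coalg_mor" where
  "lax_id X = Coalg_Mor X X (\<one> (carrier X)) (\<iota> (act X))"

text \<open>
  The composite of \<open>\<phi> : b \<cdot> f \<Rightarrow> G f \<cdot> a\<close> and \<open>\<psi> : c \<cdot> g \<Rightarrow> G g \<cdot> b\<close> is
  \<open>c \<cdot> g \<cdot> f \<Rightarrow> G g \<cdot> b \<cdot> f \<Rightarrow> G g \<cdot> G f \<cdot> a\<close>.
\<close>

definition lax_comp ::
    "('o, 'm, 'c) coalg_mor \<Rightarrow> ('o, 'm, 'c) coalg_mor \<Rightarrow> ('o, 'm, 'c) coalg_mor" where
  "lax_comp F' F = Coalg_Mor (mor_dom F) (mor_cod F') (mor F' \<cdot> mor F)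
    ((G\<langle>mor F'\<rangle>\<^sub>1 \<rhd> mor_cell F) \<bullet> (mor_cell F' \<lhd> mor F))"

definition Lax_Coalg ::
    "(('o, 'm, 'c) coalg, ('o, 'm, 'c) coalg_mor, ('o, 'm, 'c) coalg_trans) two_cat" where
  "Lax_Coalg =
    \<lparr>Obj = {X. lax_coalg X},
     Mor = {F. lax_mor F},
     Cel = {T. G_trans T},
     Dom = mor_dom, Cod = mor_cod, Src = trans_src, Trg = trans_trg,
     Id1 = lax_id,
     comp1 = lax_comp,
     Id2 = (\<lambda>F. Coalg_Trans F F (\<iota> (mor F))),
     vcomp = (\<lambda>T' T. Coalg_Trans (trans_src T) (trans_trg T') (trans T' \<bullet> trans T)),
     hcomp = (\<lambda>T' T. Coalg_Trans (lax_comp (trans_src T') (trans_src T))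
       (lax_comp (trans_trg T') (trans_trg T)) (trans T' \<star> trans T))\<rparr>"

text \<open>
  For a lax coalgebra, \<open>\<alpha>\<close> being an identity forces \<open>G a \<cdot> a = d A \<cdot> a\<close> and
  \<open>\<alpha>\<^sub>0\<close> being an identity forces \<open>e A \<cdot> a = \<one> A\<close>, by their typing; likewise for morphisms.
\<close>

definition strict_coalg :: "('o, 'm, 'c) coalg \<Rightarrow> bool" where
  "strict_coalg X \<longleftrightarrow> lax_coalg X \<and>
    mult_cell X = \<iota> (G\<langle>act X\<rangle>\<^sub>1 \<cdot> act X) \<and> unit_cell X = \<iota> (\<one> (carrier X))"

definition strict_mor :: "('o, 'm, 'c) coalg_mor \<Rightarrow> bool" where
  "strict_mor F \<longleftrightarrow> strict_coalg (mor_dom F) \<and> strict_coalg (mor_cod F) \<and>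
    lax_mor F \<and> mor_cell F = \<iota> (act (mor_cod F) \<cdot> mor F)"

text \<open>The Eilenberg--Moore 2-category, a locally full sub-2-category of the lax one.\<close>

definition EM ::
    "(('o, 'm, 'c) coalg, ('o, 'm, 'c) coalg_mor, ('o, 'm, 'c) coalg_trans) two_cat" where
  "EM = Lax_Coalg
    \<lparr>Obj := {X. strict_coalg X},
     Mor := {F. strict_mor F},
     Cel := {T. G_trans T \<and> strict_mor (trans_src T) \<and> strict_mor (trans_trg T)}\<rparr>"

end

definition EM_inclusion ::
    "(('o, 'm, 'c) coalg, ('o, 'm, 'c) coalg_mor, ('o, 'm, 'c) coalg_trans,
      ('o, 'm, 'c) coalg, ('o, 'm, 'c) coalg_mor, ('o, 'm, 'c) coalg_trans) two_fun" where
  "EM_inclusion = id_fun"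


section \<open>Inserters, equifiers and lax descent objects\<close>

text \<open>
  In each of the three universal properties below, composition with the universal cone is a functor
  from the hom-category \<open>L(Z, L)\<close> to the category of cones with vertex \<open>Z\<close>, and is
  2-natural in \<open>Z\<close>, by the axioms of a 2-category alone.  That it is an isomorphism of
  categories is stated as bijectivity on objects and on each hom-set.
\<close>

record ('o, 'm, 'c) lax_coherence =
  X1 :: 'o  X2 :: 'o  X3 :: 'o
  cd_k :: 'm  cd_l :: 'm  cd_j :: 'm  cd_p :: 'm  cd_q :: 'm  cd_r :: 'm
  cd_gamma :: 'c  cd_delta :: 'c  cd_kappa :: 'c  cd_lambda :: 'c  cd_rho :: 'c

context
  fixes C :: "('o, 'm, 'c) two_cat" (structure)
begin

text \<open>Pairs \<open>(v, \<psi>)\<close> with \<open>v : Z \<rightarrow> X\<close> and \<open>\<psi> : k \<cdot> v \<Rightarrow> l \<cdot> v\<close>, and their morphisms.\<close>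

definition inserter_cones :: "'m \<Rightarrow> 'm \<Rightarrow> 'o \<Rightarrow> ('m \<times> 'c) set" where
  "inserter_cones k l Z =
    {(v, \<psi>). v \<in> Hom C Z (Dom C k) \<and> \<psi> \<in> Cells C (k \<cdot> v) (l \<cdot> v)}"

definition inserter_cone_cells :: "'m \<Rightarrow> 'm \<Rightarrow> 'm \<times> 'c \<Rightarrow> 'm \<times> 'c \<Rightarrow> 'c set" where
  "inserter_cone_cells k l = (\<lambda>(v, \<psi>) (v', \<psi>').
    {\<theta> \<in> Cells C v v'. (l \<rhd> \<theta>) \<bullet> \<psi> = \<psi>' \<bullet> (k \<rhd> \<theta>)})"

definition is_inserter :: "'m \<Rightarrow> 'm \<Rightarrow> 'o \<Rightarrow> 'm \<Rightarrow> 'c \<Rightarrow> bool" where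
  "is_inserter k l L v \<psi> \<longleftrightarrow>
    L \<in> Obj C \<and> (v, \<psi>) \<in> inserter_cones k l L \<and>
    (\<forall>Z \<in> Obj C.
      bij_betw (\<lambda>u. (v \<cdot> u, \<psi> \<lhd> u)) (Hom C Z L) (inserter_cones k l Z) \<and>
      (\<forall>u \<in> Hom C Z L. \<forall>u' \<in> Hom C Z L.
        bij_betw (\<lambda>\<tau>. v \<rhd> \<tau>) (Cells C u u')
          (inserter_cone_cells k l (v \<cdot> u, \<psi> \<lhd> u) (v \<cdot> u', \<psi> \<lhd> u'))))"

definition has_inserters :: bool where
  "has_inserters \<longleftrightarrow>
    (\<forall>A B k l. k \<in> Hom C A B \<longrightarrow> l \<in> Hom C A B \<longrightarrow> (\<exists>L v \<psi>. is_inserter k l L v \<psi>))"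

definition equifier_cones :: "'c \<Rightarrow> 'c \<Rightarrow> 'o \<Rightarrow> 'm set" where
  "equifier_cones \<alpha> \<beta> Z = {v \<in> Hom C Z (Dom C (Src C \<alpha>)). \<alpha> \<lhd> v = \<beta> \<lhd> v}"

definition is_equifier :: "'c \<Rightarrow> 'c \<Rightarrow> 'o \<Rightarrow> 'm \<Rightarrow> bool" where
  "is_equifier \<alpha> \<beta> L v \<longleftrightarrow>
    L \<in> Obj C \<and> v \<in> equifier_cones \<alpha> \<beta> L \<and>
    (\<forall>Z \<in> Obj C.
      bij_betw (\<lambda>u. v \<cdot> u) (Hom C Z L) (equifier_cones \<alpha> \<beta> Z) \<and>
      (\<forall>u \<in> Hom C Z L. \<forall>u' \<in> Hom C Z L.
        bij_betw (\<lambda>\<tau>. v \<rhd> \<tau>) (Cells C u u') (Cells C (v \<cdot> u) (v \<cdot> u'))))"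

definition has_equifiers :: bool where
  "has_equifiers \<longleftrightarrow>
    (\<forall>f g \<alpha> \<beta>. \<alpha> \<in> Cells C f g \<longrightarrow> \<beta> \<in> Cells C f g \<longrightarrow> (\<exists>L v. is_equifier \<alpha> \<beta> L v))"

definition lax_coherence_data :: "('o, 'm, 'c) lax_coherence \<Rightarrow> bool" where
  "lax_coherence_data D \<longleftrightarrow>
    X1 D \<in> Obj C \<and> X2 D \<in> Obj C \<and> X3 D \<in> Obj C \<and>
    cd_k D \<in> Hom C (X1 D) (X2 D) \<and> cd_l D \<in> Hom C (X1 D) (X2 D) \<and>
    cd_j D \<in> Hom C (X2 D) (X1 D) \<and>
    cd_p D \<in> Hom C (X2 D) (X3 D) \<and> cd_q D \<in> Hom C (X2 D) (X3 D) \<and>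
    cd_r D \<in> Hom C (X2 D) (X3 D) \<and>
    cd_gamma D \<in> Cells C (\<one> (X1 D)) (cd_j D \<cdot> cd_k D) \<and>
    cd_delta D \<in> Cells C (cd_j D \<cdot> cd_l D) (\<one> (X1 D)) \<and>
    cd_kappa D \<in> Cells C (cd_p D \<cdot> cd_l D) (cd_q D \<cdot> cd_l D) \<and>
    cd_lambda D \<in> Cells C (cd_r D \<cdot> cd_k D) (cd_q D \<cdot> cd_k D) \<and>
    cd_rho D \<in> Cells C (cd_r D \<cdot> cd_l D) (cd_p D \<cdot> cd_k D)"

definition descent_cones :: "('o, 'm, 'c) lax_coherence \<Rightarrow> 'o \<Rightarrow> ('m \<times> 'c) set" where
  "descent_cones D Z =
    {(v, \<psi>). v \<in> Hom C Z (X1 D) \<and> \<psi> \<in> Cells C (cd_k D \<cdot> v) (cd_l D \<cdot> v) \<and>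
      (cd_kappa D \<lhd> v) \<bullet> (cd_p D \<rhd> \<psi>) \<bullet> (cd_rho D \<lhd> v) \<bullet> (cd_r D \<rhd> \<psi>) =
        (cd_q D \<rhd> \<psi>) \<bullet> (cd_lambda D \<lhd> v) \<and>
      (cd_delta D \<lhd> v) \<bullet> (cd_j D \<rhd> \<psi>) \<bullet> (cd_gamma D \<lhd> v) = \<iota> v}"

definition is_lax_descent :: "('o, 'm, 'c) lax_coherence \<Rightarrow> 'o \<Rightarrow> 'm \<Rightarrow> 'c \<Rightarrow> bool" where
  "is_lax_descent D L v \<psi> \<longleftrightarrow>
    L \<in> Obj C \<and> (v, \<psi>) \<in> descent_cones D L \<and>
    (\<forall>Z \<in> Obj C.
      bij_betw (\<lambda>u. (v \<cdot> u, \<psi> \<lhd> u)) (Hom C Z L) (descent_cones D Z) \<and>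
      (\<forall>u \<in> Hom C Z L. \<forall>u' \<in> Hom C Z L.
        bij_betw (\<lambda>\<tau>. v \<rhd> \<tau>) (Cells C u u')
          (inserter_cone_cells (cd_k D) (cd_l D) (v \<cdot> u, \<psi> \<lhd> u) (v \<cdot> u', \<psi> \<lhd> u'))))"

definition has_lax_descent_objects :: bool where
  "has_lax_descent_objects \<longleftrightarrow>
    (\<forall>D. lax_coherence_data D \<longrightarrow> (\<exists>L v \<psi>. is_lax_descent D L v \<psi>))"

end

end

theory Submission
  imports Defs
begin

text \<open>
  The right adjoint sends a lax coalgebra \<open>X = (A, a, \<alpha>, \<alpha>\<^sub>0)\<close> to the lax descent object \<open>L\<close>, formed
  among strict coalgebras, of the diagram of cofree coalgebras on \<open>A\<close>, \<open>GA\<close> and \<open>GGA\<close> with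
  \<open>k = Ga\<close>, \<open>l = dA\<close>, \<open>j = GeA\<close>, \<open>p = dGA\<close>, \<open>q = GdA\<close>, \<open>r = GGa\<close>.  The reason is that a descent
  cone on this diagram is a lax morphism into \<open>X\<close> in disguise.

  Let \<open>(Z, z)\<close> be a strict coalgebra.  The cofree coalgebra on \<open>B\<close> represents \<open>K(Z, B)\<close>, on morphisms
  and on 2-cells: one passes from the coalgebra side to \<open>K\<close> by composing with \<open>e B\<close> and back by
  \<open>x \<mapsto> G x \<cdot> z\<close> (\<open>bij_Hom_cofree\<close>, \<open>bij_Cells_cofree\<close>).  Under this correspondence a strict morphism
  \<open>v : Z \<rightarrow> GA\<close> becomes \<open>f = eA \<cdot> v : Z \<rightarrow> A\<close>, and a 2-cell \<open>\<psi> : Ga \<cdot> v \<Rightarrow> dA \<cdot> v\<close> becomes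
  \<open>\<phi> = eGA \<cdot> \<psi> : a \<cdot> f \<Rightarrow> Gf \<cdot> z\<close>, which is exactly the shape of the structure cell of a lax morphism.
  The two descent equations are equations between 2-cells into the cofree coalgebras on \<open>GGA\<close> and \<open>A\<close>;
  as transposition is injective they hold iff their transposes do, and these are the two axioms for
  \<open>(f, \<phi>)\<close> to be a lax morphism (\<open>descent_cone_iff_lax_mor\<close>).  In the same way a 2-cell
  between cones is the transpose of a \<open>G\<close>-transformation (\<open>bij_cone_cell_transpose\<close>).  So cones with
  vertex \<open>Z\<close> and lax morphisms \<open>Z \<rightarrow> X\<close> form isomorphic categories, naturally in \<open>Z\<close>
  (\<open>cone_transpose_natural\<close>), and the transpose of the universal cone is a lax morphism \<open>L \<rightarrow> X\<close>
  which is couniversal.  A choice of couniversal arrows, with respect to morphisms and 2-cells,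
  is a right 2-adjoint (\<open>couniversal_arrows\<close>).

  Inserters and equifiers yield lax descent objects in any 2-category: insert a 2-cell \<open>k \<Rightarrow> l\<close>
  universally and then force the two descent equations, one equifier for each
  (\<open>is_lax_descent_inserter_equifiers\<close>).
\<close>

section \<open>Whiskering calculus\<close>

text \<open>
  Boundaries are expressed below by equations for \<open>Dom\<close>, \<open>Cod\<close>, \<open>Src\<close> and \<open>Trg\<close> instead of membership in
  hom-sets: their side conditions contain no variables that the simplifier would have to guess, so
  that typing is decided by rewriting.  The simplification rules bring a 2-cell into the form of a
  right-nested vertical composite of cells \<open>f \<rhd> (\<alpha> \<lhd> g)\<close> with \<open>\<alpha>\<close> indecomposable; an equation between
  2-cells then needs explicit steps only where interchange, naturality or an axiom is used.
\<close>

lemma Hom_iff: "f \<in> Hom C A B \<longleftrightarrow> f \<in> Mor C \<and> Dom C f = A \<and> Cod C f = B"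
  by (auto simp: Hom_def)

lemma Cells_iff: "\<alpha> \<in> Cells C f g \<longleftrightarrow> \<alpha> \<in> Cel C \<and> Src C \<alpha> = f \<and> Trg C \<alpha> = g"
  by (auto simp: Cells_def)

context two_category
begin

lemma boundary_simps [simp]:
  "f \<in> Mor C \<Longrightarrow> Dom C f \<in> Obj C"
  "f \<in> Mor C \<Longrightarrow> Cod C f \<in> Obj C"
  "\<alpha> \<in> Cel C \<Longrightarrow> Src C \<alpha> \<in> Mor C"
  "\<alpha> \<in> Cel C \<Longrightarrow> Trg C \<alpha> \<in> Mor C"
  "\<alpha> \<in> Cel C \<Longrightarrow> Dom C (Trg C \<alpha>) = Dom C (Src C \<alpha>)"
  "\<alpha> \<in> Cel C \<Longrightarrow> Cod C (Trg C \<alpha>) = Cod C (Src C \<alpha>)"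
  by (simp_all add: Dom_Obj Cod_Obj Src_Mor Trg_Mor Dom_Src_Trg Cod_Src_Trg)

lemma Id1_simps [simp]:
  assumes "A \<in> Obj C"
  shows "\<one> A \<in> Mor C" "Dom C (\<one> A) = A" "Cod C (\<one> A) = A"
  using Id1_Hom[OF assms] by (auto simp: Hom_iff)

lemma comp1_simps [simp]:
  assumes "f \<in> Mor C" "g \<in> Mor C" "Dom C g = Cod C f"
  shows "g \<cdot> f \<in> Mor C" "Dom C (g \<cdot> f) = Dom C f" "Cod C (g \<cdot> f) = Cod C g"
  using comp1_Hom[of f "Dom C f" "Cod C f" g "Cod C g"] assms by (auto simp: Hom_iff)

lemma comp1_units [simp]:
  "f \<in> Mor C \<Longrightarrow> Cod C f = B \<Longrightarrow> \<one> B \<cdot> f = f"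
  "f \<in> Mor C \<Longrightarrow> Dom C f = A \<Longrightarrow> f \<cdot> \<one> A = f"
  by (auto simp: Hom_iff intro: comp1_Id1_left comp1_Id1_right)

lemma comp1_assoc' [simp]:
  assumes "f \<in> Mor C" "g \<in> Mor C" "h \<in> Mor C" "Dom C g = Cod C f" "Dom C h = Cod C g"
  shows "h \<cdot> g \<cdot> f = h \<cdot> (g \<cdot> f)"
  using assms by (intro comp1_assoc) (auto simp: Hom_iff)

lemma Id2_simps [simp]:
  assumes "f \<in> Mor C"
  shows "\<iota> f \<in> Cel C" "Src C (\<iota> f) = f" "Trg C (\<iota> f) = f"
  using Id2_Cells[OF assms] by (auto simp: Cells_iff)

lemma vcomp_simps [simp]:
  assumes "\<alpha> \<in> Cel C" "\<beta> \<in> Cel C" "Src C \<beta> = Trg C \<alpha>"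
  shows "\<beta> \<bullet> \<alpha> \<in> Cel C" "Src C (\<beta> \<bullet> \<alpha>) = Src C \<alpha>" "Trg C (\<beta> \<bullet> \<alpha>) = Trg C \<beta>"
  using vcomp_Cells[of \<alpha> "Src C \<alpha>" "Trg C \<alpha>" \<beta> "Trg C \<beta>"] assms by (auto simp: Cells_iff)

lemma vcomp_units [simp]:
  "\<alpha> \<in> Cel C \<Longrightarrow> Trg C \<alpha> = g \<Longrightarrow> \<iota> g \<bullet> \<alpha> = \<alpha>"
  "\<alpha> \<in> Cel C \<Longrightarrow> Src C \<alpha> = f \<Longrightarrow> \<alpha> \<bullet> \<iota> f = \<alpha>"
  by (auto simp: Cells_iff intro: vcomp_Id2_left vcomp_Id2_right)

lemma vcomp_assoc' [simp]:
  assumes "\<alpha> \<in> Cel C" "\<beta> \<in> Cel C" "\<gamma> \<in> Cel C" "Src C \<beta> = Trg C \<alpha>" "Src C \<gamma> = Trg C \<beta>"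
  shows "\<gamma> \<bullet> \<beta> \<bullet> \<alpha> = \<gamma> \<bullet> (\<beta> \<bullet> \<alpha>)"
  using assms by (intro vcomp_assoc) (auto simp: Cells_iff)

lemma hcomp_simps [simp]:
  assumes "\<alpha> \<in> Cel C" "\<beta> \<in> Cel C" "Dom C (Src C \<beta>) = Cod C (Src C \<alpha>)"
  shows "\<beta> \<star> \<alpha> \<in> Cel C" "Src C (\<beta> \<star> \<alpha>) = Src C \<beta> \<cdot> Src C \<alpha>"
    "Trg C (\<beta> \<star> \<alpha>) = Trg C \<beta> \<cdot> Trg C \<alpha>"
  using hcomp_Cells[of \<alpha> "Src C \<alpha>" "Trg C \<alpha>" \<beta> "Src C \<beta>" "Trg C \<beta>"] assms
  by (auto simp: Cells_iff)

lemma hcomp_assoc' [simp]: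
  assumes "\<alpha> \<in> Cel C" "\<beta> \<in> Cel C" "\<gamma> \<in> Cel C"
    "Dom C (Src C \<beta>) = Cod C (Src C \<alpha>)" "Dom C (Src C \<gamma>) = Cod C (Src C \<beta>)"
  shows "\<gamma> \<star> \<beta> \<star> \<alpha> = \<gamma> \<star> (\<beta> \<star> \<alpha>)"
  using assms
  by (intro hcomp_assoc[of \<alpha> "Src C \<alpha>" "Trg C \<alpha>" \<beta> "Src C \<beta>" "Trg C \<beta>" \<gamma> "Src C \<gamma>" "Trg C \<gamma>"])
    (auto simp: Cells_iff)

lemma interchange':
  assumes "\<alpha> \<in> Cel C" "\<alpha>' \<in> Cel C" "\<beta> \<in> Cel C" "\<beta>' \<in> Cel C"
    "Src C \<alpha>' = Trg C \<alpha>" "Src C \<beta>' = Trg C \<beta>" "Dom C (Src C \<beta>) = Cod C (Src C \<alpha>)"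
  shows "(\<beta>' \<bullet> \<beta>) \<star> (\<alpha>' \<bullet> \<alpha>) = (\<beta>' \<star> \<alpha>') \<bullet> (\<beta> \<star> \<alpha>)"
  using assms by (intro interchange) (auto simp: Cells_iff)

lemma whisker_left_simps [simp]:
  assumes "f \<in> Mor C" "\<alpha> \<in> Cel C" "Dom C f = Cod C (Src C \<alpha>)"
  shows "f \<rhd> \<alpha> \<in> Cel C" "Src C (f \<rhd> \<alpha>) = f \<cdot> Src C \<alpha>" "Trg C (f \<rhd> \<alpha>) = f \<cdot> Trg C \<alpha>"
  using assms by (simp_all add: whisker_left_def)

lemma whisker_right_simps [simp]:
  assumes "f \<in> Mor C" "\<alpha> \<in> Cel C" "Dom C (Src C \<alpha>) = Cod C f"
  shows "\<alpha> \<lhd> f \<in> Cel C" "Src C (\<alpha> \<lhd> f) = Src C \<alpha> \<cdot> f" "Trg C (\<alpha> \<lhd> f) = Trg C \<alpha> \<cdot> f"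
  using assms by (simp_all add: whisker_right_def)

lemma whisker_units [simp]:
  "\<alpha> \<in> Cel C \<Longrightarrow> Cod C (Src C \<alpha>) = B \<Longrightarrow> \<one> B \<rhd> \<alpha> = \<alpha>"
  "\<alpha> \<in> Cel C \<Longrightarrow> Dom C (Src C \<alpha>) = A \<Longrightarrow> \<alpha> \<lhd> \<one> A = \<alpha>"
  "f \<in> Mor C \<Longrightarrow> g \<in> Mor C \<Longrightarrow> Dom C g = Cod C f \<Longrightarrow> g \<rhd> \<iota> f = \<iota> (g \<cdot> f)"
  "f \<in> Mor C \<Longrightarrow> g \<in> Mor C \<Longrightarrow> Dom C g = Cod C f \<Longrightarrow> \<iota> g \<lhd> f = \<iota> (g \<cdot> f)"
  by (auto simp: whisker_left_def whisker_right_def Cells_iff hcomp_Id2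
      intro: hcomp_Id1_left[of \<alpha> "Src C \<alpha>" "Trg C \<alpha>"] hcomp_Id1_right[of \<alpha> "Src C \<alpha>" "Trg C \<alpha>"])

lemma whisker_comp [simp]:
  "\<lbrakk>f \<in> Mor C; g \<in> Mor C; \<alpha> \<in> Cel C; Dom C g = Cod C f; Dom C f = Cod C (Src C \<alpha>)\<rbrakk>
    \<Longrightarrow> g \<rhd> (f \<rhd> \<alpha>) = (g \<cdot> f) \<rhd> \<alpha>"
  "\<lbrakk>f \<in> Mor C; g \<in> Mor C; \<alpha> \<in> Cel C; Dom C g = Cod C f; Dom C (Src C \<alpha>) = Cod C g\<rbrakk>
    \<Longrightarrow> (\<alpha> \<lhd> g) \<lhd> f = \<alpha> \<lhd> (g \<cdot> f)"
  "\<lbrakk>f \<in> Mor C; g \<in> Mor C; \<alpha> \<in> Cel C; Dom C (Src C \<alpha>) = Cod C f; Dom C g = Cod C (Src C \<alpha>)\<rbrakk>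
    \<Longrightarrow> (g \<rhd> \<alpha>) \<lhd> f = g \<rhd> (\<alpha> \<lhd> f)"
  by (simp_all add: whisker_left_def whisker_right_def hcomp_Id2 del: hcomp_assoc'
      flip: hcomp_assoc') (simp_all add: hcomp_Id2)

lemma whisker_vcomp [simp]:
  "\<lbrakk>f \<in> Mor C; \<alpha> \<in> Cel C; \<beta> \<in> Cel C; Src C \<beta> = Trg C \<alpha>; Dom C f = Cod C (Src C \<alpha>)\<rbrakk>
    \<Longrightarrow> f \<rhd> (\<beta> \<bullet> \<alpha>) = (f \<rhd> \<beta>) \<bullet> (f \<rhd> \<alpha>)"
  "\<lbrakk>f \<in> Mor C; \<alpha> \<in> Cel C; \<beta> \<in> Cel C; Src C \<beta> = Trg C \<alpha>; Dom C (Src C \<alpha>) = Cod C f\<rbrakk>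
    \<Longrightarrow> (\<beta> \<bullet> \<alpha>) \<lhd> f = (\<beta> \<lhd> f) \<bullet> (\<alpha> \<lhd> f)"
  using interchange'[of \<alpha> \<beta> "\<iota> f" "\<iota> f"] interchange'[of "\<iota> f" "\<iota> f" \<alpha> \<beta>]
  by (simp_all add: whisker_left_def whisker_right_def)

text \<open>
  Interchange: a horizontal composite is a composite of two whiskerings, and the two possible orders
  of whiskering agree.
\<close>

lemma hcomp_as_whiskers:
  assumes "\<alpha> \<in> Cel C" "\<beta> \<in> Cel C" "Dom C (Src C \<beta>) = Cod C (Src C \<alpha>)"
  shows "\<beta> \<star> \<alpha> = (Trg C \<beta> \<rhd> \<alpha>) \<bullet> (\<beta> \<lhd> Src C \<alpha>)"
  using interchange'[of "\<iota> (Src C \<alpha>)" \<alpha> \<beta> "\<iota> (Trg C \<beta>)"] assms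
  by (simp add: whisker_left_def whisker_right_def)

lemma whisker_exchange:
  assumes "\<alpha> \<in> Cells C f f'" "\<beta> \<in> Cells C g g'" "Dom C g = Cod C f"
  shows "(g' \<rhd> \<alpha>) \<bullet> (\<beta> \<lhd> f) = (\<beta> \<lhd> f') \<bullet> (g \<rhd> \<alpha>)"
  using interchange'[of "\<iota> f" \<alpha> \<beta> "\<iota> g'"] interchange'[of \<alpha> "\<iota> f'" "\<iota> g" \<beta>] assms
  by (auto simp: whisker_left_def whisker_right_def Cells_iff)

text \<open>
  Vertical composites are kept right-nested, so an equation between binary composites meets a
  further cell \<open>\<theta>\<close> below.
\<close>

lemma vcomp_rewrite_head:
  assumes "\<alpha> \<bullet> \<beta> = \<gamma> \<bullet> \<delta>" "\<theta> \<in> Cel C" "\<alpha> \<in> Cel C" "\<beta> \<in> Cel C" "\<gamma> \<in> Cel C" "\<delta> \<in> Cel C"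
    "Src C \<alpha> = Trg C \<beta>" "Src C \<gamma> = Trg C \<delta>" "Src C \<beta> = Trg C \<theta>" "Src C \<delta> = Trg C \<theta>"
  shows "\<alpha> \<bullet> (\<beta> \<bullet> \<theta>) = \<gamma> \<bullet> (\<delta> \<bullet> \<theta>)"
  using assms by (simp flip: vcomp_assoc')

end

context two_functor
begin

lemma fun_simps [simp]:
  "A \<in> Obj C \<Longrightarrow> F\<langle>A\<rangle>\<^sub>0 \<in> Obj D"
  "f \<in> Mor C \<Longrightarrow> F\<langle>f\<rangle>\<^sub>1 \<in> Mor D"
  "f \<in> Mor C \<Longrightarrow> Dom D (F\<langle>f\<rangle>\<^sub>1) = F\<langle>Dom C f\<rangle>\<^sub>0"
  "f \<in> Mor C \<Longrightarrow> Cod D (F\<langle>f\<rangle>\<^sub>1) = F\<langle>Cod C f\<rangle>\<^sub>0"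
  "\<alpha> \<in> Cel C \<Longrightarrow> F\<langle>\<alpha>\<rangle>\<^sub>2 \<in> Cel D"
  "\<alpha> \<in> Cel C \<Longrightarrow> Src D (F\<langle>\<alpha>\<rangle>\<^sub>2) = F\<langle>Src C \<alpha>\<rangle>\<^sub>1"
  "\<alpha> \<in> Cel C \<Longrightarrow> Trg D (F\<langle>\<alpha>\<rangle>\<^sub>2) = F\<langle>Trg C \<alpha>\<rangle>\<^sub>1"
  using fun_Obj fun_Hom[of f "Dom C f" "Cod C f"] fun_Cells[of \<alpha> "Src C \<alpha>" "Trg C \<alpha>"]
  by (auto simp: Hom_iff Cells_iff)

lemma fun_ops [simp]:
  "A \<in> Obj C \<Longrightarrow> F\<langle>\<one>\<^bsub>C\<^esub> A\<rangle>\<^sub>1 = \<one>\<^bsub>D\<^esub> (F\<langle>A\<rangle>\<^sub>0)"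
  "\<lbrakk>f \<in> Mor C; g \<in> Mor C; Dom C g = Cod C f\<rbrakk> \<Longrightarrow> F\<langle>g \<cdot>\<^bsub>C\<^esub> f\<rangle>\<^sub>1 = F\<langle>g\<rangle>\<^sub>1 \<cdot>\<^bsub>D\<^esub> F\<langle>f\<rangle>\<^sub>1"
  "f \<in> Mor C \<Longrightarrow> F\<langle>\<iota>\<^bsub>C\<^esub> f\<rangle>\<^sub>2 = \<iota>\<^bsub>D\<^esub> (F\<langle>f\<rangle>\<^sub>1)"
  "\<lbrakk>\<alpha> \<in> Cel C; \<beta> \<in> Cel C; Src C \<beta> = Trg C \<alpha>\<rbrakk>
    \<Longrightarrow> F\<langle>\<beta> \<bullet>\<^bsub>C\<^esub> \<alpha>\<rangle>\<^sub>2 = F\<langle>\<beta>\<rangle>\<^sub>2 \<bullet>\<^bsub>D\<^esub> F\<langle>\<alpha>\<rangle>\<^sub>2"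
  "\<lbrakk>\<alpha> \<in> Cel C; \<beta> \<in> Cel C; Dom C (Src C \<beta>) = Cod C (Src C \<alpha>)\<rbrakk>
    \<Longrightarrow> F\<langle>\<beta> \<star>\<^bsub>C\<^esub> \<alpha>\<rangle>\<^sub>2 = F\<langle>\<beta>\<rangle>\<^sub>2 \<star>\<^bsub>D\<^esub> F\<langle>\<alpha>\<rangle>\<^sub>2"
  using fun_Id1 fun_Id2 fun_comp1[of f "Dom C f" "Cod C f" g "Cod C g"]
    fun_vcomp[of \<alpha> "Src C \<alpha>" "Trg C \<alpha>" \<beta> "Trg C \<beta>"]
    fun_hcomp[of \<alpha> "Src C \<alpha>" "Trg C \<alpha>" \<beta> "Src C \<beta>" "Trg C \<beta>"]
  by (auto simp: Hom_iff Cells_iff)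

lemma fun_whisker [simp]:
  "\<lbrakk>f \<in> Mor C; \<alpha> \<in> Cel C; Dom C f = Cod C (Src C \<alpha>)\<rbrakk>
    \<Longrightarrow> F\<langle>f \<rhd>\<^bsub>C\<^esub> \<alpha>\<rangle>\<^sub>2 = F\<langle>f\<rangle>\<^sub>1 \<rhd>\<^bsub>D\<^esub> F\<langle>\<alpha>\<rangle>\<^sub>2"
  "\<lbrakk>f \<in> Mor C; \<alpha> \<in> Cel C; Dom C (Src C \<alpha>) = Cod C f\<rbrakk>
    \<Longrightarrow> F\<langle>\<alpha> \<lhd>\<^bsub>C\<^esub> f\<rangle>\<^sub>2 = F\<langle>\<alpha>\<rangle>\<^sub>2 \<lhd>\<^bsub>D\<^esub> F\<langle>f\<rangle>\<^sub>1"
  by (simp_all add: whisker_left_def whisker_right_def)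

end

lemma two_functor_id: "two_category C \<Longrightarrow> two_functor C C id_fun"
  by (simp add: two_functor_def two_functor_axioms_def id_fun_def)

lemma two_functor_comp:
  assumes "two_functor A B H" "two_functor B E H'"
  shows "two_functor A E (comp_fun H' H)"
proof -
  interpret H: two_functor A B H + H': two_functor B E H'
    using assms by auto
  show ?thesis
    by unfold_locales (auto simp: comp_fun_def Hom_iff Cells_iff)
qed

section \<open>Right adjoints from couniversal arrows\<close>

text \<open>
  For each object \<open>B\<close> the arrow \<open>\<epsilon> B : F (R0 B) \<rightarrow> B\<close> is couniversal: composition with it is an isomorphism of
  categories from \<open>C(Z, R0 B)\<close> to \<open>D(F Z, B)\<close>.  Injectivity on morphisms and on 2-cells yields
  extensionality principles by which all equations for the right adjoint are checked after
  composition with \<open>\<epsilon>\<close>; surjectivity yields its values on morphisms and 2-cells.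
\<close>

locale couniversal_arrows = F: two_functor C D F
  for C :: "('o, 'm, 'c) two_cat" and D :: "('o1, 'm1, 'c1) two_cat"
    and F :: "('o, 'm, 'c, 'o1, 'm1, 'c1) two_fun" +
  fixes R0 :: "'o1 \<Rightarrow> 'o" and \<epsilon> :: "'o1 \<Rightarrow> 'm1"
  assumes R0_Obj [simp]: "B \<in> Obj D \<Longrightarrow> R0 B \<in> Obj C"
    and counit_Hom: "B \<in> Obj D \<Longrightarrow> \<epsilon> B \<in> Hom D (F\<langle>R0 B\<rangle>\<^sub>0) B"
    and bij_Hom: "\<lbrakk>B \<in> Obj D; Z \<in> Obj C\<rbrakk>
      \<Longrightarrow> bij_betw (\<lambda>u. \<epsilon> B \<cdot>\<^bsub>D\<^esub> F\<langle>u\<rangle>\<^sub>1) (Hom C Z (R0 B)) (Hom D (F\<langle>Z\<rangle>\<^sub>0) B)"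
    and bij_Cells: "\<lbrakk>B \<in> Obj D; Z \<in> Obj C; u \<in> Hom C Z (R0 B); u' \<in> Hom C Z (R0 B)\<rbrakk>
      \<Longrightarrow> bij_betw (\<lambda>\<tau>. \<epsilon> B \<rhd>\<^bsub>D\<^esub> F\<langle>\<tau>\<rangle>\<^sub>2) (Cells C u u')
            (Cells D (\<epsilon> B \<cdot>\<^bsub>D\<^esub> F\<langle>u\<rangle>\<^sub>1) (\<epsilon> B \<cdot>\<^bsub>D\<^esub> F\<langle>u'\<rangle>\<^sub>1))"
begin

lemma counit_simps [simp]:
  assumes "B \<in> Obj D"
  shows "\<epsilon> B \<in> Mor D" "Dom D (\<epsilon> B) = F\<langle>R0 B\<rangle>\<^sub>0" "Cod D (\<epsilon> B) = B"
  using counit_Hom[OF assms] by (auto simp: Hom_iff)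

lemma Mor_eqI:
  assumes "B \<in> Obj D" "u \<in> Mor C" "u' \<in> Mor C" "Dom C u = Dom C u'" "Cod C u = R0 B" "Cod C u' = R0 B"
    "\<epsilon> B \<cdot>\<^bsub>D\<^esub> F\<langle>u\<rangle>\<^sub>1 = \<epsilon> B \<cdot>\<^bsub>D\<^esub> F\<langle>u'\<rangle>\<^sub>1"
  shows "u = u'"
  using bij_betw_imp_inj_on[OF bij_Hom[of B "Dom C u"]] assms by (auto simp: Hom_iff inj_on_def)

lemma Cel_eqI:
  assumes "B \<in> Obj D" "\<tau> \<in> Cel C" "\<tau>' \<in> Cel C" "Src C \<tau> = Src C \<tau>'" "Trg C \<tau> = Trg C \<tau>'"
    "Cod C (Src C \<tau>) = R0 B" "\<epsilon> B \<rhd>\<^bsub>D\<^esub> F\<langle>\<tau>\<rangle>\<^sub>2 = \<epsilon> B \<rhd>\<^bsub>D\<^esub> F\<langle>\<tau>'\<rangle>\<^sub>2"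
  shows "\<tau> = \<tau>'"
proof -
  have "inj_on (\<lambda>\<tau>. \<epsilon> B \<rhd>\<^bsub>D\<^esub> F\<langle>\<tau>\<rangle>\<^sub>2) (Cells C (Src C \<tau>) (Trg C \<tau>))"
    using assms bij_Cells[of B "Dom C (Src C \<tau>)" "Src C \<tau>" "Trg C \<tau>"]
    by (auto simp: bij_betw_def Hom_iff)
  then show ?thesis
    using assms by (auto simp: inj_on_def Cells_iff)
qed

definition lift_Mor :: "'o1 \<Rightarrow> 'o \<Rightarrow> 'm1 \<Rightarrow> 'm" where
  "lift_Mor B Z f = inv_into (Hom C Z (R0 B)) (\<lambda>u. \<epsilon> B \<cdot>\<^bsub>D\<^esub> F\<langle>u\<rangle>\<^sub>1) f"

lemma lift_Mor_simps [simp]: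
  assumes "B \<in> Obj D" "Z \<in> Obj C" "f \<in> Mor D" "Dom D f = F\<langle>Z\<rangle>\<^sub>0" "Cod D f = B"
  shows "lift_Mor B Z f \<in> Mor C" "Dom C (lift_Mor B Z f) = Z" "Cod C (lift_Mor B Z f) = R0 B"
    "\<epsilon> B \<cdot>\<^bsub>D\<^esub> F\<langle>lift_Mor B Z f\<rangle>\<^sub>1 = f"
proof -
  have f: "f \<in> (\<lambda>u. \<epsilon> B \<cdot>\<^bsub>D\<^esub> F\<langle>u\<rangle>\<^sub>1) ` Hom C Z (R0 B)"
    using bij_betw_imp_surj_on[OF bij_Hom[of B Z]] assms by (auto simp: Hom_iff)
  show "lift_Mor B Z f \<in> Mor C" "Dom C (lift_Mor B Z f) = Z" "Cod C (lift_Mor B Z f) = R0 B"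
    using inv_into_into[OF f] by (auto simp: lift_Mor_def Hom_iff)
  show "\<epsilon> B \<cdot>\<^bsub>D\<^esub> F\<langle>lift_Mor B Z f\<rangle>\<^sub>1 = f"
    using f_inv_into_f[OF f] by (simp add: lift_Mor_def)
qed

definition R1 :: "'m1 \<Rightarrow> 'm" where
  "R1 f = lift_Mor (Cod D f) (R0 (Dom D f)) (f \<cdot>\<^bsub>D\<^esub> \<epsilon> (Dom D f))"

lemma R1_simps [simp]:
  assumes "f \<in> Mor D"
  shows "R1 f \<in> Mor C" "Dom C (R1 f) = R0 (Dom D f)" "Cod C (R1 f) = R0 (Cod D f)"
    "Cod D f = B \<Longrightarrow> \<epsilon> B \<cdot>\<^bsub>D\<^esub> F\<langle>R1 f\<rangle>\<^sub>1 = f \<cdot>\<^bsub>D\<^esub> \<epsilon> (Dom D f)"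
  using assms by (auto simp: R1_def)

text \<open>The naturality square of \<open>\<epsilon>\<close>, available inside right-nested composites.\<close>

lemma R1_comp [simp]:
  assumes "f \<in> Mor D" "Cod D f = B" "h \<in> Mor D" "Cod D h = F\<langle>R0 (Dom D f)\<rangle>\<^sub>0"
  shows "\<epsilon> B \<cdot>\<^bsub>D\<^esub> (F\<langle>R1 f\<rangle>\<^sub>1 \<cdot>\<^bsub>D\<^esub> h) = f \<cdot>\<^bsub>D\<^esub> (\<epsilon> (Dom D f) \<cdot>\<^bsub>D\<^esub> h)"
proof -
  have "(\<epsilon> B \<cdot>\<^bsub>D\<^esub> F\<langle>R1 f\<rangle>\<^sub>1) \<cdot>\<^bsub>D\<^esub> h = (f \<cdot>\<^bsub>D\<^esub> \<epsilon> (Dom D f)) \<cdot>\<^bsub>D\<^esub> h"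
    using assms by (simp del: F.D.comp1_assoc')
  then show ?thesis
    using assms by (auto simp del: R1_simps(4))
qed

definition R2 :: "'c1 \<Rightarrow> 'c" where
  "R2 \<theta> = (let f = Src D \<theta>; f' = Trg D \<theta> in
    inv_into (Cells C (R1 f) (R1 f')) (\<lambda>\<tau>. \<epsilon> (Cod D f) \<rhd>\<^bsub>D\<^esub> F\<langle>\<tau>\<rangle>\<^sub>2) (\<theta> \<lhd>\<^bsub>D\<^esub> \<epsilon> (Dom D f)))"

lemma R2_simps [simp]:
  assumes "\<theta> \<in> Cel D"
  shows "R2 \<theta> \<in> Cel C" "Src C (R2 \<theta>) = R1 (Src D \<theta>)" "Trg C (R2 \<theta>) = R1 (Trg D \<theta>)"
    "Cod D (Src D \<theta>) = B \<Longrightarrow> \<epsilon> B \<rhd>\<^bsub>D\<^esub> F\<langle>R2 \<theta>\<rangle>\<^sub>2 = \<theta> \<lhd>\<^bsub>D\<^esub> \<epsilon> (Dom D (Src D \<theta>))"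
proof -
  let ?f = "Src D \<theta>" and ?f' = "Trg D \<theta>"
  have \<theta>: "\<theta> \<lhd>\<^bsub>D\<^esub> \<epsilon> (Dom D ?f) \<in> (\<lambda>\<tau>. \<epsilon> (Cod D ?f) \<rhd>\<^bsub>D\<^esub> F\<langle>\<tau>\<rangle>\<^sub>2) ` Cells C (R1 ?f) (R1 ?f')"
    using bij_betw_imp_surj_on[OF bij_Cells[of "Cod D ?f" "R0 (Dom D ?f)" "R1 ?f" "R1 ?f'"]] assms
    by (auto simp: Hom_iff Cells_iff)
  show "R2 \<theta> \<in> Cel C" "Src C (R2 \<theta>) = R1 (Src D \<theta>)" "Trg C (R2 \<theta>) = R1 (Trg D \<theta>)"
    using inv_into_into[OF \<theta>] by (auto simp: R2_def Cells_iff Let_def)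
  show "Cod D ?f = B \<Longrightarrow> \<epsilon> B \<rhd>\<^bsub>D\<^esub> F\<langle>R2 \<theta>\<rangle>\<^sub>2 = \<theta> \<lhd>\<^bsub>D\<^esub> \<epsilon> (Dom D ?f)"
    using f_inv_into_f[OF \<theta>] by (auto simp: R2_def Let_def)
qed

definition R :: "('o1, 'm1, 'c1, 'o, 'm, 'c) two_fun" where
  "R = \<lparr>on_Obj = R0, on_Mor = R1, on_Cel = R2\<rparr>"

lemma R_sel [simp]: "R\<langle>B\<rangle>\<^sub>0 = R0 B" "R\<langle>f\<rangle>\<^sub>1 = R1 f" "R\<langle>\<theta>\<rangle>\<^sub>2 = R2 \<theta>"
  by (simp_all add: R_def)

text \<open>
  The arrow \<open>\<epsilon>\<close> is moved past \<open>R2 \<beta>\<close> and then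
  past \<open>R2 \<alpha>\<close> by associativity of the horizontal composition.
\<close>

lemma R2_hcomp:
  assumes "\<alpha> \<in> Cel D" "\<beta> \<in> Cel D" "Dom D (Src D \<beta>) = Cod D (Src D \<alpha>)"
  shows "\<epsilon> (Cod D (Src D \<beta>)) \<rhd>\<^bsub>D\<^esub> F\<langle>R2 \<beta> \<star>\<^bsub>C\<^esub> R2 \<alpha>\<rangle>\<^sub>2 = (\<beta> \<star>\<^bsub>D\<^esub> \<alpha>) \<lhd>\<^bsub>D\<^esub> \<epsilon> (Dom D (Src D \<alpha>))"
proof -
  have "\<epsilon> (Cod D (Src D \<beta>)) \<rhd>\<^bsub>D\<^esub> F\<langle>R2 \<beta> \<star>\<^bsub>C\<^esub> R2 \<alpha>\<rangle>\<^sub>2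
      = (\<epsilon> (Cod D (Src D \<beta>)) \<rhd>\<^bsub>D\<^esub> F\<langle>R2 \<beta>\<rangle>\<^sub>2) \<star>\<^bsub>D\<^esub> F\<langle>R2 \<alpha>\<rangle>\<^sub>2"
    using assms by (simp add: whisker_left_def del: R2_simps(4))
  also have "\<dots> = \<beta> \<star>\<^bsub>D\<^esub> (\<epsilon> (Cod D (Src D \<alpha>)) \<rhd>\<^bsub>D\<^esub> F\<langle>R2 \<alpha>\<rangle>\<^sub>2)"
    using assms by (simp del: R2_simps(4) add: R2_simps(4)[of \<beta>])
      (simp add: whisker_left_def whisker_right_def)
  also have "\<dots> = (\<beta> \<star>\<^bsub>D\<^esub> \<alpha>) \<lhd>\<^bsub>D\<^esub> \<epsilon> (Dom D (Src D \<alpha>))"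
    using assms by simp (simp add: whisker_right_def)
  finally show ?thesis .
qed

lemma two_functor_R: "two_functor D C R"
proof
  fix A assume "A \<in> Obj D"
  then show "R\<langle>\<one>\<^bsub>D\<^esub> A\<rangle>\<^sub>1 = \<one>\<^bsub>C\<^esub> (R\<langle>A\<rangle>\<^sub>0)"
    by (auto intro!: Mor_eqI[of A])
next
  fix f A B g E assume "f \<in> Hom D A B" "g \<in> Hom D B E"
  then show "R\<langle>g \<cdot>\<^bsub>D\<^esub> f\<rangle>\<^sub>1 = R\<langle>g\<rangle>\<^sub>1 \<cdot>\<^bsub>C\<^esub> R\<langle>f\<rangle>\<^sub>1"
    by (auto simp: Hom_iff intro!: Mor_eqI[of E])
next
  fix f assume "f \<in> Mor D"
  then show "R\<langle>\<iota>\<^bsub>D\<^esub> f\<rangle>\<^sub>2 = \<iota>\<^bsub>C\<^esub> (R\<langle>f\<rangle>\<^sub>1)"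
    by (auto intro!: Cel_eqI[of "Cod D f"])
next
  fix \<alpha> f g \<beta> h assume "\<alpha> \<in> Cells D f g" "\<beta> \<in> Cells D g h"
  then show "R\<langle>\<beta> \<bullet>\<^bsub>D\<^esub> \<alpha>\<rangle>\<^sub>2 = R\<langle>\<beta>\<rangle>\<^sub>2 \<bullet>\<^bsub>C\<^esub> R\<langle>\<alpha>\<rangle>\<^sub>2"
    by (auto simp: Cells_iff intro!: Cel_eqI[of "Cod D f"])
next
  fix \<alpha> f f' \<beta> g g' assume "\<alpha> \<in> Cells D f f'" "\<beta> \<in> Cells D g g'" "Dom D g = Cod D f"
  moreover have "R1 (Src D \<beta> \<cdot>\<^bsub>D\<^esub> Src D \<alpha>) = R1 (Src D \<beta>) \<cdot>\<^bsub>C\<^esub> R1 (Src D \<alpha>)"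
    "R1 (Trg D \<beta> \<cdot>\<^bsub>D\<^esub> Trg D \<alpha>) = R1 (Trg D \<beta>) \<cdot>\<^bsub>C\<^esub> R1 (Trg D \<alpha>)"
    using calculation by (auto simp: Cells_iff intro!: Mor_eqI[of "Cod D g"])
  ultimately show "R\<langle>\<beta> \<star>\<^bsub>D\<^esub> \<alpha>\<rangle>\<^sub>2 = R\<langle>\<beta>\<rangle>\<^sub>2 \<star>\<^bsub>C\<^esub> R\<langle>\<alpha>\<rangle>\<^sub>2"
    by (auto simp: Cells_iff R2_hcomp simp del: F.fun_ops intro!: Cel_eqI[of "Cod D g"])
qed (auto simp: Hom_iff Cells_iff)

definition \<eta> :: "'o \<Rightarrow> 'm" where
  "\<eta> A = lift_Mor (F\<langle>A\<rangle>\<^sub>0) A (\<one>\<^bsub>D\<^esub> (F\<langle>A\<rangle>\<^sub>0))"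

lemma unit_simps [simp]:
  assumes "A \<in> Obj C"
  shows "\<eta> A \<in> Mor C" "Dom C (\<eta> A) = A" "Cod C (\<eta> A) = R0 (F\<langle>A\<rangle>\<^sub>0)"
    "\<epsilon> (F\<langle>A\<rangle>\<^sub>0) \<cdot>\<^bsub>D\<^esub> F\<langle>\<eta> A\<rangle>\<^sub>1 = \<one>\<^bsub>D\<^esub> (F\<langle>A\<rangle>\<^sub>0)"
  using assms by (auto simp: \<eta>_def)

lemma unit_comp [simp]:
  assumes "A \<in> Obj C" "f \<in> Mor D" "Cod D f = F\<langle>A\<rangle>\<^sub>0"
  shows "\<epsilon> (F\<langle>A\<rangle>\<^sub>0) \<cdot>\<^bsub>D\<^esub> (F\<langle>\<eta> A\<rangle>\<^sub>1 \<cdot>\<^bsub>D\<^esub> f) = f"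
proof -
  have "(\<epsilon> (F\<langle>A\<rangle>\<^sub>0) \<cdot>\<^bsub>D\<^esub> F\<langle>\<eta> A\<rangle>\<^sub>1) \<cdot>\<^bsub>D\<^esub> f = f"
    using assms by (simp del: F.D.comp1_assoc')
  then show ?thesis
    using assms by (simp del: unit_simps(4))
qed

lemma unit_natural_Cel:
  assumes "\<alpha> \<in> Cel C"
  shows "\<eta> (Cod C (Src C \<alpha>)) \<rhd>\<^bsub>C\<^esub> \<alpha> = R2 (F\<langle>\<alpha>\<rangle>\<^sub>2) \<lhd>\<^bsub>C\<^esub> \<eta> (Dom C (Src C \<alpha>))"
proof (rule Cel_eqI[of "F\<langle>Cod C (Src C \<alpha>)\<rangle>\<^sub>0"])
  let ?A = "Dom C (Src C \<alpha>)" and ?B = "Cod C (Src C \<alpha>)"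
  have "\<epsilon> (F\<langle>?B\<rangle>\<^sub>0) \<rhd>\<^bsub>D\<^esub> F\<langle>R2 (F\<langle>\<alpha>\<rangle>\<^sub>2) \<lhd>\<^bsub>C\<^esub> \<eta> ?A\<rangle>\<^sub>2
      = (\<epsilon> (F\<langle>?B\<rangle>\<^sub>0) \<rhd>\<^bsub>D\<^esub> F\<langle>R2 (F\<langle>\<alpha>\<rangle>\<^sub>2)\<rangle>\<^sub>2) \<lhd>\<^bsub>D\<^esub> F\<langle>\<eta> ?A\<rangle>\<^sub>1"
    using assms by (simp del: R2_simps(4))
  also have "\<dots> = F\<langle>\<alpha>\<rangle>\<^sub>2"
    using assms by simp
  finally show "\<epsilon> (F\<langle>?B\<rangle>\<^sub>0) \<rhd>\<^bsub>D\<^esub> F\<langle>\<eta> ?B \<rhd>\<^bsub>C\<^esub> \<alpha>\<rangle>\<^sub>2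
      = \<epsilon> (F\<langle>?B\<rangle>\<^sub>0) \<rhd>\<^bsub>D\<^esub> F\<langle>R2 (F\<langle>\<alpha>\<rangle>\<^sub>2) \<lhd>\<^bsub>C\<^esub> \<eta> ?A\<rangle>\<^sub>2"
    using assms by simp
qed (use assms in \<open>auto intro!: Mor_eqI[of "F\<langle>Cod C (Src C \<alpha>)\<rangle>\<^sub>0"]\<close>)

lemma has_right_adjoint: "has_right_adjoint C D F"
proof -
  interpret R: two_functor D C R
    by (rule two_functor_R)
  interpret FR: two_functor D D "comp_fun F R"
    using R.two_functor_axioms F.two_functor_axioms by (rule two_functor_comp)
  interpret RF: two_functor C C "comp_fun R F"
    using F.two_functor_axioms R.two_functor_axioms by (rule two_functor_comp)
  interpret IC: two_functor C C id_fun
    by (rule two_functor_id) unfold_locales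
  interpret ID: two_functor D D id_fun
    by (rule two_functor_id) unfold_locales
  have "two_adjunction C D F R \<eta> \<epsilon>"
  proof
    fix A assume "A \<in> Obj C"
    then show "\<eta> A \<in> Hom C (id_fun\<langle>A\<rangle>\<^sub>0) ((comp_fun R F)\<langle>A\<rangle>\<^sub>0)"
      by (simp add: Hom_iff id_fun_def comp_fun_def)
  next
    fix f A B assume "f \<in> Hom C A B"
    then show "\<eta> B \<cdot>\<^bsub>C\<^esub> id_fun\<langle>f\<rangle>\<^sub>1 = (comp_fun R F)\<langle>f\<rangle>\<^sub>1 \<cdot>\<^bsub>C\<^esub> \<eta> A"
      by (auto simp: Hom_iff id_fun_def comp_fun_def intro!: Mor_eqI[of "F\<langle>B\<rangle>\<^sub>0"])
  next
    fix \<alpha> f g A B assume "\<alpha> \<in> Cells C f g" "f \<in> Hom C A B" "g \<in> Hom C A B"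
    then show "\<eta> B \<rhd>\<^bsub>C\<^esub> id_fun\<langle>\<alpha>\<rangle>\<^sub>2 = (comp_fun R F)\<langle>\<alpha>\<rangle>\<^sub>2 \<lhd>\<^bsub>C\<^esub> \<eta> A"
      using unit_natural_Cel[of \<alpha>] by (auto simp: Cells_iff Hom_iff id_fun_def comp_fun_def)
  next
    fix B assume "B \<in> Obj D"
    then show "\<epsilon> B \<in> Hom D ((comp_fun F R)\<langle>B\<rangle>\<^sub>0) (id_fun\<langle>B\<rangle>\<^sub>0)"
      by (simp add: Hom_iff id_fun_def comp_fun_def)
  next
    fix f A B assume "f \<in> Hom D A B"
    then show "\<epsilon> B \<cdot>\<^bsub>D\<^esub> (comp_fun F R)\<langle>f\<rangle>\<^sub>1 = id_fun\<langle>f\<rangle>\<^sub>1 \<cdot>\<^bsub>D\<^esub> \<epsilon> A"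
      by (auto simp: Hom_iff id_fun_def comp_fun_def)
  next
    fix \<alpha> f g A B assume "\<alpha> \<in> Cells D f g" "f \<in> Hom D A B" "g \<in> Hom D A B"
    then show "\<epsilon> B \<rhd>\<^bsub>D\<^esub> (comp_fun F R)\<langle>\<alpha>\<rangle>\<^sub>2 = id_fun\<langle>\<alpha>\<rangle>\<^sub>2 \<lhd>\<^bsub>D\<^esub> \<epsilon> A"
      by (auto simp: Cells_iff Hom_iff id_fun_def comp_fun_def)
  next
    fix A assume "A \<in> Obj C"
    then show "\<epsilon> (F\<langle>A\<rangle>\<^sub>0) \<cdot>\<^bsub>D\<^esub> F\<langle>\<eta> A\<rangle>\<^sub>1 = \<one>\<^bsub>D\<^esub> (F\<langle>A\<rangle>\<^sub>0)"
      by simp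
  next
    fix B assume "B \<in> Obj D"
    then show "R\<langle>\<epsilon> B\<rangle>\<^sub>1 \<cdot>\<^bsub>C\<^esub> \<eta> (R\<langle>B\<rangle>\<^sub>0) = \<one>\<^bsub>C\<^esub> (R\<langle>B\<rangle>\<^sub>0)"
      by (auto intro!: Mor_eqI[of B])
  qed
  then show ?thesis
    unfolding has_right_adjoint_def by blast
qed

end

section \<open>Lax descent objects from inserters and equifiers\<close>

lemma bij_betw_restrict:
  assumes "bij_betw f A B" "\<And>a. a \<in> A \<Longrightarrow> P a \<longleftrightarrow> Q (f a)"
  shows "bij_betw f {a \<in> A. P a} {b \<in> B. Q b}"
  using assms by (auto simp: bij_betw_def inj_on_def)

text \<open>
  A cone \<open>(v, \<psi>)\<close> satisfying no equations factors uniquely through the inserter as \<open>v = i \<cdot> w\<close>,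
  \<open>\<psi> = \<chi> \<lhd> w\<close>, and each descent equation for it says that \<open>w\<close> equifies a fixed pair of 2-cells.  The first
  equifier \<open>m\<close> selects the \<open>w\<close> satisfying the first equation; the second pair is therefore restricted along \<open>m\<close>
  before it is equified.  On 2-cells the equifiers are fully faithful.
\<close>

lemma (in two_category) is_lax_descent_inserter_equifiers:
  fixes D :: "('o, 'm, 'c) lax_coherence"
  assumes D: "lax_coherence_data C D"
    and ins: "is_inserter C (cd_k D) (cd_l D) I i \<chi>"
    and eq1: "is_equifier C
      ((cd_kappa D \<lhd> i) \<bullet> (cd_p D \<rhd> \<chi>) \<bullet> (cd_rho D \<lhd> i) \<bullet> (cd_r D \<rhd> \<chi>))
      ((cd_q D \<rhd> \<chi>) \<bullet> (cd_lambda D \<lhd> i)) M m"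
    and eq2: "is_equifier C
      (((cd_delta D \<lhd> i) \<bullet> (cd_j D \<rhd> \<chi>) \<bullet> (cd_gamma D \<lhd> i)) \<lhd> m) (\<iota> i \<lhd> m) L n"
  shows "is_lax_descent C D L (i \<cdot> m \<cdot> n) (\<chi> \<lhd> m \<lhd> n)"
proof -
  let ?k = "cd_k D" and ?l = "cd_l D"
  let ?S1 = "(cd_kappa D \<lhd> i) \<bullet> (cd_p D \<rhd> \<chi>) \<bullet> (cd_rho D \<lhd> i) \<bullet> (cd_r D \<rhd> \<chi>)"
    and ?T1 = "(cd_q D \<rhd> \<chi>) \<bullet> (cd_lambda D \<lhd> i)"
    and ?S2 = "(cd_delta D \<lhd> i) \<bullet> (cd_j D \<rhd> \<chi>) \<bullet> (cd_gamma D \<lhd> i)"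
  note data = D[unfolded lax_coherence_data_def Hom_iff Cells_iff]
  have I: "I \<in> Obj C" "i \<in> Mor C" "Dom C i = I" "Cod C i = X1 D"
    "\<chi> \<in> Cel C" "Src C \<chi> = ?k \<cdot> i" "Trg C \<chi> = ?l \<cdot> i"
    using ins data by (auto simp: is_inserter_def inserter_cones_def Hom_iff Cells_iff)
  have M: "M \<in> Obj C" "m \<in> Mor C" "Dom C m = M" "Cod C m = I"
    using eq1 data I by (auto simp: is_equifier_def equifier_cones_def Hom_iff)
  have L: "L \<in> Obj C" "n \<in> Mor C" "Dom C n = L" "Cod C n = M"
    using eq2 data I M by (auto simp: is_equifier_def equifier_cones_def Hom_iff)
  have cones: "(i \<cdot> w, \<chi> \<lhd> w) \<in> descent_cones C D Z \<longleftrightarrow> ?S1 \<lhd> w = ?T1 \<lhd> w \<and> ?S2 \<lhd> w = \<iota> i \<lhd> w"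
    if "w \<in> Hom C Z I" for w Z
    using that data I by (auto simp: descent_cones_def Hom_iff Cells_iff)
  have bij_I: "bij_betw (\<lambda>w. (i \<cdot> w, \<chi> \<lhd> w)) (Hom C Z I) (inserter_cones C ?k ?l Z)"
    if "Z \<in> Obj C" for Z
    using ins that by (auto simp: is_inserter_def)
  have bij_M: "bij_betw (\<lambda>w. m \<cdot> w) (Hom C Z M) {w \<in> Hom C Z I. ?S1 \<lhd> w = ?T1 \<lhd> w}"
    if "Z \<in> Obj C" for Z
    using eq1 that data I by (auto simp: is_equifier_def equifier_cones_def)
  have bij_L: "bij_betw (\<lambda>w. n \<cdot> w) (Hom C Z L) {w \<in> Hom C Z M. ?S2 \<lhd> (m \<cdot> w) = \<iota> i \<lhd> (m \<cdot> w)}"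
    if "Z \<in> Obj C" for Z
  proof -
    have "{w \<in> Hom C Z M. ?S2 \<lhd> (m \<cdot> w) = \<iota> i \<lhd> (m \<cdot> w)} = equifier_cones C (?S2 \<lhd> m) (\<iota> i \<lhd> m) Z"
      using data I M by (auto simp: equifier_cones_def Hom_iff)
    then show ?thesis
      using eq2 that by (simp add: is_equifier_def)
  qed
  have bij: "bij_betw (\<lambda>w. (i \<cdot> m \<cdot> n \<cdot> w, \<chi> \<lhd> m \<lhd> n \<lhd> w)) (Hom C Z L) (descent_cones C D Z)"
    if Z: "Z \<in> Obj C" for Z
  proof -
    have "bij_betw (\<lambda>w. (i \<cdot> w, \<chi> \<lhd> w)) {w \<in> Hom C Z I. ?S1 \<lhd> w = ?T1 \<lhd> w \<and> ?S2 \<lhd> w = \<iota> i \<lhd> w}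
        {c \<in> inserter_cones C ?k ?l Z. c \<in> descent_cones C D Z}"
      by (rule bij_betw_restrict[OF bij_I[OF Z]]) (simp add: cones)
    moreover have "{c \<in> inserter_cones C ?k ?l Z. c \<in> descent_cones C D Z} = descent_cones C D Z"
      using data by (auto simp: inserter_cones_def descent_cones_def)
    moreover have "bij_betw (\<lambda>w. m \<cdot> w) {w \<in> Hom C Z M. ?S2 \<lhd> (m \<cdot> w) = \<iota> i \<lhd> (m \<cdot> w)}
        {w \<in> {w \<in> Hom C Z I. ?S1 \<lhd> w = ?T1 \<lhd> w}. ?S2 \<lhd> w = \<iota> i \<lhd> w}"
      by (rule bij_betw_restrict[OF bij_M[OF Z]]) simp
    ultimately have "bij_betw ((\<lambda>w. (i \<cdot> w, \<chi> \<lhd> w)) \<circ> ((\<lambda>w. m \<cdot> w) \<circ> (\<lambda>w. n \<cdot> w)))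
        (Hom C Z L) (descent_cones C D Z)"
      using bij_L[OF Z] by (auto intro!: bij_betw_trans)
    then show ?thesis
      by (rule bij_betw_cong[THEN iffD1, rotated]) (use data I M L in \<open>auto simp: Hom_iff\<close>)
  qed
  have bij2: "bij_betw (\<lambda>\<tau>. (i \<cdot> m \<cdot> n) \<rhd> \<tau>) (Cells C u u')
      (inserter_cone_cells C ?k ?l (i \<cdot> m \<cdot> n \<cdot> u, \<chi> \<lhd> m \<lhd> n \<lhd> u) (i \<cdot> m \<cdot> n \<cdot> u', \<chi> \<lhd> m \<lhd> n \<lhd> u'))"
    if Z: "Z \<in> Obj C" and u: "u \<in> Hom C Z L" "u' \<in> Hom C Z L" for Z u u'
  proof -
    have "bij_betw (\<lambda>\<tau>. n \<rhd> \<tau>) (Cells C u u') (Cells C (n \<cdot> u) (n \<cdot> u'))"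
      using eq2 Z u by (auto simp: is_equifier_def)
    moreover have "bij_betw (\<lambda>\<tau>. m \<rhd> \<tau>) (Cells C (n \<cdot> u) (n \<cdot> u')) (Cells C (m \<cdot> (n \<cdot> u)) (m \<cdot> (n \<cdot> u')))"
      using eq1 Z u L by (auto simp: is_equifier_def Hom_iff)
    moreover have "bij_betw (\<lambda>\<tau>. i \<rhd> \<tau>) (Cells C (m \<cdot> (n \<cdot> u)) (m \<cdot> (n \<cdot> u')))
       (inserter_cone_cells C ?k ?l (i \<cdot> (m \<cdot> (n \<cdot> u)), \<chi> \<lhd> (m \<cdot> (n \<cdot> u)))
          (i \<cdot> (m \<cdot> (n \<cdot> u')), \<chi> \<lhd> (m \<cdot> (n \<cdot> u'))))"
      using ins Z u L M by (auto simp: is_inserter_def Hom_iff)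
    ultimately have "bij_betw ((\<lambda>\<tau>. i \<rhd> \<tau>) \<circ> ((\<lambda>\<tau>. m \<rhd> \<tau>) \<circ> (\<lambda>\<tau>. n \<rhd> \<tau>))) (Cells C u u')
       (inserter_cone_cells C ?k ?l (i \<cdot> (m \<cdot> (n \<cdot> u)), \<chi> \<lhd> (m \<cdot> (n \<cdot> u)))
          (i \<cdot> (m \<cdot> (n \<cdot> u')), \<chi> \<lhd> (m \<cdot> (n \<cdot> u'))))"
      by (blast intro: bij_betw_trans)
    moreover have "inserter_cone_cells C ?k ?l (i \<cdot> (m \<cdot> (n \<cdot> u)), \<chi> \<lhd> (m \<cdot> (n \<cdot> u)))
          (i \<cdot> (m \<cdot> (n \<cdot> u')), \<chi> \<lhd> (m \<cdot> (n \<cdot> u')))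
        = inserter_cone_cells C ?k ?l (i \<cdot> m \<cdot> n \<cdot> u, \<chi> \<lhd> m \<lhd> n \<lhd> u) (i \<cdot> m \<cdot> n \<cdot> u', \<chi> \<lhd> m \<lhd> n \<lhd> u')"
      using data I M L u by (simp add: Hom_iff)
    ultimately have "bij_betw ((\<lambda>\<tau>. i \<rhd> \<tau>) \<circ> ((\<lambda>\<tau>. m \<rhd> \<tau>) \<circ> (\<lambda>\<tau>. n \<rhd> \<tau>))) (Cells C u u')
       (inserter_cone_cells C ?k ?l (i \<cdot> m \<cdot> n \<cdot> u, \<chi> \<lhd> m \<lhd> n \<lhd> u) (i \<cdot> m \<cdot> n \<cdot> u', \<chi> \<lhd> m \<lhd> n \<lhd> u'))"
      by (simp only:)
    then show ?thesis
      by (rule bij_betw_cong[THEN iffD1, rotated]) (use data I M L u in \<open>auto simp: Hom_iff Cells_iff\<close>)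
  qed
  have "(i \<cdot> m \<cdot> n, \<chi> \<lhd> m \<lhd> n) \<in> descent_cones C D L"
    using bij_betw_apply[OF bij[OF L(1)], of "\<one> L"] L I M data by (auto simp: Hom_iff)
  then show ?thesis
    unfolding is_lax_descent_def using bij bij2 L(1) by blast
qed

proposition (in two_category) has_lax_descent_objects_if_inserters_equifiers:
  assumes "has_inserters C" "has_equifiers C"
  shows "has_lax_descent_objects C"
  unfolding has_lax_descent_objects_def
proof (intro allI impI)
  fix D :: "('o, 'm, 'c) lax_coherence" assume D: "lax_coherence_data C D"
  note data = D[unfolded lax_coherence_data_def]
  obtain I i \<chi> where ins: "is_inserter C (cd_k D) (cd_l D) I i \<chi>"
    using assms(1) data unfolding has_inserters_def by meson
  have I: "i \<in> Hom C I (X1 D)" "\<chi> \<in> Cells C (cd_k D \<cdot> i) (cd_l D \<cdot> i)"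
    using ins data by (auto simp: is_inserter_def inserter_cones_def Hom_iff)
  let ?S1 = "(cd_kappa D \<lhd> i) \<bullet> (cd_p D \<rhd> \<chi>) \<bullet> (cd_rho D \<lhd> i) \<bullet> (cd_r D \<rhd> \<chi>)"
    and ?T1 = "(cd_q D \<rhd> \<chi>) \<bullet> (cd_lambda D \<lhd> i)"
    and ?S2 = "(cd_delta D \<lhd> i) \<bullet> (cd_j D \<rhd> \<chi>) \<bullet> (cd_gamma D \<lhd> i)"
  have "?S1 \<in> Cells C (cd_r D \<cdot> cd_k D \<cdot> i) (cd_q D \<cdot> cd_l D \<cdot> i)"
    "?T1 \<in> Cells C (cd_r D \<cdot> cd_k D \<cdot> i) (cd_q D \<cdot> cd_l D \<cdot> i)"
    using data I by (auto simp: Hom_iff Cells_iff)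
  then obtain M m where eq1: "is_equifier C ?S1 ?T1 M m"
    using assms(2) unfolding has_equifiers_def by meson
  have "m \<in> Hom C M I"
    using eq1 data I by (auto simp: is_equifier_def equifier_cones_def Hom_iff Cells_iff)
  then have "?S2 \<lhd> m \<in> Cells C (i \<cdot> m) (i \<cdot> m)" "\<iota> i \<lhd> m \<in> Cells C (i \<cdot> m) (i \<cdot> m)"
    using data I by (auto simp: Hom_iff Cells_iff)
  then obtain L n where "is_equifier C (?S2 \<lhd> m) (\<iota> i \<lhd> m) L n"
    using assms(2) unfolding has_equifiers_def by meson
  then show "\<exists>L v \<psi>. is_lax_descent C D L v \<psi>"
    using is_lax_descent_inserter_equifiers[OF D ins eq1] by blast
qed

section \<open>Lax coalgebras form a 2-category\<close>

context two_comonad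
begin

lemma comult_simps [simp]:
  assumes "A \<in> Obj K"
  shows "d A \<in> Mor K" "Dom K (d A) = G\<langle>A\<rangle>\<^sub>0" "Cod K (d A) = G\<langle>G\<langle>A\<rangle>\<^sub>0\<rangle>\<^sub>0"
  using comult.component_Hom[OF assms] by (auto simp: Hom_iff comp_fun_def)

lemma counit_simps [simp]:
  assumes "A \<in> Obj K"
  shows "e A \<in> Mor K" "Dom K (e A) = G\<langle>A\<rangle>\<^sub>0" "Cod K (e A) = A"
  using counit.component_Hom[OF assms] by (auto simp: Hom_iff id_fun_def)

lemma comult_natural [simp]:
  assumes "f \<in> Mor K" "Cod K f = B"
  shows "d B \<cdot> G\<langle>f\<rangle>\<^sub>1 = G\<langle>G\<langle>f\<rangle>\<^sub>1\<rangle>\<^sub>1 \<cdot> d (Dom K f)"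
  using assms comult.natural_Mor[of f "Dom K f" B] by (auto simp: Hom_iff comp_fun_def)

lemma counit_natural [simp]:
  assumes "f \<in> Mor K" "Cod K f = B"
  shows "e B \<cdot> G\<langle>f\<rangle>\<^sub>1 = f \<cdot> e (Dom K f)"
  using assms counit.natural_Mor[of f "Dom K f" B] by (auto simp: Hom_iff id_fun_def)

lemma counit_natural_Cel:
  assumes "\<alpha> \<in> Cel K"
  shows "e (Cod K (Src K \<alpha>)) \<rhd> G\<langle>\<alpha>\<rangle>\<^sub>2 = \<alpha> \<lhd> e (Dom K (Src K \<alpha>))"
  using assms counit.natural_Cel[of "Src K \<alpha>" _ _ "Trg K \<alpha>" \<alpha>]
  by (auto simp: Hom_iff Cells_iff id_fun_def)

lemma comult_natural_Cel:
  assumes "\<alpha> \<in> Cel K"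
  shows "d (Cod K (Src K \<alpha>)) \<rhd> G\<langle>\<alpha>\<rangle>\<^sub>2 = G\<langle>G\<langle>\<alpha>\<rangle>\<^sub>2\<rangle>\<^sub>2 \<lhd> d (Dom K (Src K \<alpha>))"
  using assms comult.natural_Cel[of "Src K \<alpha>" _ _ "Trg K \<alpha>" \<alpha>]
  by (auto simp: Hom_iff Cells_iff comp_fun_def)

lemma counit_natural_whiskered:
  assumes "\<alpha> \<in> Cel K" "Cod K (Src K \<alpha>) = B" "u \<in> Mor K" "Cod K u = G\<langle>Dom K (Src K \<alpha>)\<rangle>\<^sub>0"
  shows "e B \<rhd> (G\<langle>\<alpha>\<rangle>\<^sub>2 \<lhd> u) = \<alpha> \<lhd> (e (Dom K (Src K \<alpha>)) \<cdot> u)"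
  using assms arg_cong[OF counit_natural_Cel, of \<alpha> "\<lambda>x. x \<lhd> u"] by auto

lemma comult_natural_whiskered:
  assumes "\<alpha> \<in> Cel K" "Cod K (Src K \<alpha>) = B" "u \<in> Mor K" "Cod K u = G\<langle>Dom K (Src K \<alpha>)\<rangle>\<^sub>0"
  shows "d B \<rhd> (G\<langle>\<alpha>\<rangle>\<^sub>2 \<lhd> u) = G\<langle>G\<langle>\<alpha>\<rangle>\<^sub>2\<rangle>\<^sub>2 \<lhd> (d (Dom K (Src K \<alpha>)) \<cdot> u)"
  using assms arg_cong[OF comult_natural_Cel, of \<alpha> "\<lambda>x. x \<lhd> u"] by auto

declare counit_left [simp] counit_right [simp]

text \<open>Equations between 1-cells are also needed inside right-nested composites.\<close>

lemma comp1_eq_under: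
  assumes "g \<cdot> f = h" "f \<in> Mor K" "g \<in> Mor K" "Dom K g = Cod K f" "u \<in> Mor K" "Cod K u = Dom K f"
  shows "g \<cdot> (f \<cdot> u) = h \<cdot> u"
  using assms by (simp flip: G.C.comp1_assoc')

lemma comonad_simps_under [simp]:
  assumes "u \<in> Mor K"
  shows "\<lbrakk>f \<in> Mor K; Cod K f = B; Cod K u = G\<langle>Dom K f\<rangle>\<^sub>0\<rbrakk>
      \<Longrightarrow> d B \<cdot> (G\<langle>f\<rangle>\<^sub>1 \<cdot> u) = G\<langle>G\<langle>f\<rangle>\<^sub>1\<rangle>\<^sub>1 \<cdot> (d (Dom K f) \<cdot> u)"
    "\<lbrakk>f \<in> Mor K; Cod K f = B; Cod K u = G\<langle>Dom K f\<rangle>\<^sub>0\<rbrakk>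
      \<Longrightarrow> e B \<cdot> (G\<langle>f\<rangle>\<^sub>1 \<cdot> u) = f \<cdot> (e (Dom K f) \<cdot> u)"
    "\<lbrakk>A \<in> Obj K; Cod K u = G\<langle>A\<rangle>\<^sub>0\<rbrakk> \<Longrightarrow> e (G\<langle>A\<rangle>\<^sub>0) \<cdot> (d A \<cdot> u) = u"
    "\<lbrakk>A \<in> Obj K; Cod K u = G\<langle>A\<rangle>\<^sub>0\<rbrakk> \<Longrightarrow> G\<langle>e A\<rangle>\<^sub>1 \<cdot> (d A \<cdot> u) = u"
  using assms by (auto simp: comp1_eq_under[OF comult_natural] comp1_eq_under[OF counit_natural]
      comp1_eq_under[OF counit_left] comp1_eq_under[OF counit_right])

text \<open>
  The axioms of lax coalgebras, lax morphisms and transformations are restated with selectors, so that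
  their typing parts can serve as simplification rules.
\<close>

abbreviation Lax where "Lax \<equiv> Lax_Coalg K G d e"

abbreviation is_coalg where "is_coalg \<equiv> lax_coalg K G d e"
abbreviation is_mor where "is_mor \<equiv> lax_mor K G d e"
abbreviation is_trans where "is_trans \<equiv> G_trans K G d e"

lemma Lax_simps [simp]:
  "X \<in> Obj Lax \<longleftrightarrow> is_coalg X" "F \<in> Mor Lax \<longleftrightarrow> is_mor F" "T \<in> Cel Lax \<longleftrightarrow> is_trans T"
  "Dom Lax = mor_dom" "Cod Lax = mor_cod" "Src Lax = trans_src" "Trg Lax = trans_trg"
  "Id1 Lax = lax_id K" "comp1 Lax = lax_comp K G" "Id2 Lax F = Coalg_Trans F F (\<iota> (mor F))"
  "vcomp Lax T' T = Coalg_Trans (trans_src T) (trans_trg T') (trans T' \<bullet> trans T)"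
  "hcomp Lax T' T = Coalg_Trans (lax_comp K G (trans_src T') (trans_src T))
       (lax_comp K G (trans_trg T') (trans_trg T)) (trans T' \<star> trans T)"
  by (auto simp: Lax_Coalg_def)

lemma lax_comp_sel [simp]:
  "mor_dom (lax_comp K G F' F) = mor_dom F"
  "mor_cod (lax_comp K G F' F) = mor_cod F'"
  "mor (lax_comp K G F' F) = mor F' \<cdot> mor F"
  "mor_cell (lax_comp K G F' F) = (G\<langle>mor F'\<rangle>\<^sub>1 \<rhd> mor_cell F) \<bullet> (mor_cell F' \<lhd> mor F)"
  by (simp_all add: lax_comp_def)

lemma lax_id_sel [simp]:
  "mor_dom (lax_id K X) = X" "mor_cod (lax_id K X) = X" "mor (lax_id K X) = \<one> (carrier X)"
  "mor_cell (lax_id K X) = \<iota> (act X)"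
  by (simp_all add: lax_id_def)

lemma lax_coalg_simps [simp]:
  assumes "is_coalg X"
  shows "carrier X \<in> Obj K" "act X \<in> Mor K" "Dom K (act X) = carrier X"
    "Cod K (act X) = G\<langle>carrier X\<rangle>\<^sub>0"
    "mult_cell X \<in> Cel K" "Src K (mult_cell X) = G\<langle>act X\<rangle>\<^sub>1 \<cdot> act X"
    "Trg K (mult_cell X) = d (carrier X) \<cdot> act X"
    "unit_cell X \<in> Cel K" "Src K (unit_cell X) = \<one> (carrier X)"
    "Trg K (unit_cell X) = e (carrier X) \<cdot> act X"
  using assms by (cases X; auto simp: Hom_iff Cells_iff)+

lemma lax_mor_iff:
  "is_mor F \<longleftrightarrow> is_coalg (mor_dom F) \<and> is_coalg (mor_cod F) \<and>
    mor F \<in> Mor K \<and> Dom K (mor F) = carrier (mor_dom F) \<and> Cod K (mor F) = carrier (mor_cod F) \<and>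
    mor_cell F \<in> Cel K \<and> Src K (mor_cell F) = act (mor_cod F) \<cdot> mor F \<and>
    Trg K (mor_cell F) = G\<langle>mor F\<rangle>\<^sub>1 \<cdot> act (mor_dom F) \<and>
    (d (carrier (mor_cod F)) \<rhd> mor_cell F) \<bullet> (mult_cell (mor_cod F) \<lhd> mor F)
      = (G\<langle>G\<langle>mor F\<rangle>\<^sub>1\<rangle>\<^sub>1 \<rhd> mult_cell (mor_dom F)) \<bullet> (G\<langle>mor_cell F\<rangle>\<^sub>2 \<lhd> act (mor_dom F))
        \<bullet> (G\<langle>act (mor_cod F)\<rangle>\<^sub>1 \<rhd> mor_cell F) \<and>
    (e (carrier (mor_cod F)) \<rhd> mor_cell F) \<bullet> (unit_cell (mor_cod F) \<lhd> mor F)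
      = mor F \<rhd> unit_cell (mor_dom F)"
  unfolding lax_mor_def
  by (cases "mor_dom F"; cases "mor_cod F") (auto simp: Hom_iff Cells_iff)

lemma lax_mor_simps [simp]:
  assumes "is_mor F"
  shows "is_coalg (mor_dom F)" "is_coalg (mor_cod F)" "mor F \<in> Mor K"
    "Dom K (mor F) = carrier (mor_dom F)" "Cod K (mor F) = carrier (mor_cod F)"
    "mor_cell F \<in> Cel K" "Src K (mor_cell F) = act (mor_cod F) \<cdot> mor F"
    "Trg K (mor_cell F) = G\<langle>mor F\<rangle>\<^sub>1 \<cdot> act (mor_dom F)"
  using assms unfolding lax_mor_iff by auto

lemma G_trans_iff:
  "is_trans T \<longleftrightarrow> is_mor (trans_src T) \<and> is_mor (trans_trg T) \<and>
    mor_dom (trans_trg T) = mor_dom (trans_src T) \<and> mor_cod (trans_trg T) = mor_cod (trans_src T) \<and>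
    trans T \<in> Cel K \<and> Src K (trans T) = mor (trans_src T) \<and> Trg K (trans T) = mor (trans_trg T) \<and>
    (G\<langle>trans T\<rangle>\<^sub>2 \<lhd> act (mor_dom (trans_src T))) \<bullet> mor_cell (trans_src T)
      = mor_cell (trans_trg T) \<bullet> (act (mor_cod (trans_src T)) \<rhd> trans T)"
  unfolding G_trans_def by (auto simp: Let_def Cells_iff)

lemma G_trans_simps [simp]:
  assumes "is_trans T"
  shows "is_mor (trans_src T)" "is_mor (trans_trg T)"
    "mor_dom (trans_trg T) = mor_dom (trans_src T)" "mor_cod (trans_trg T) = mor_cod (trans_src T)"
    "trans T \<in> Cel K" "Src K (trans T) = mor (trans_src T)" "Trg K (trans T) = mor (trans_trg T)"
  using assms unfolding G_trans_iff by auto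

lemma lax_mor_lax_id:
  assumes "is_coalg X"
  shows "is_mor (lax_id K X)"
  unfolding lax_mor_iff using assms by auto

text \<open>
  The multiplication axiom for a composite is obtained by pasting: the axiom for the outer morphism
  is whiskered with \<open>f\<close>, the axiom for the inner one with \<open>GGg\<close>, and one interchange moves the cell
  \<open>G\<chi>\<close> past \<open>\<phi>\<close> between them.
\<close>

lemma lax_mor_lax_comp:
  assumes F: "is_mor F" and F': "is_mor F'" and comp: "mor_dom F' = mor_cod F"
  shows "is_mor (lax_comp K G F' F)"
proof -
  define X Y Z where "X = mor_dom F" and "Y = mor_cod F" and "Z = mor_cod F'"
  define f g \<phi> \<chi> where "f = mor F" and "g = mor F'" and "\<phi> = mor_cell F" and "\<chi> = mor_cell F'"
  define a b c where "a = act X" and "b = act Y" and "c = act Z"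
  define \<alpha> \<beta> \<gamma> where "\<alpha> = mult_cell X" and "\<beta> = mult_cell Y" and "\<gamma> = mult_cell Z"
  define \<alpha>\<^sub>0 \<beta>\<^sub>0 \<gamma>\<^sub>0 where "\<alpha>\<^sub>0 = unit_cell X" and "\<beta>\<^sub>0 = unit_cell Y" and "\<gamma>\<^sub>0 = unit_cell Z"
  define A B E where "A = carrier X" and "B = carrier Y" and "E = carrier Z"
  note defs = X_def Y_def Z_def f_def g_def \<phi>_def \<chi>_def a_def b_def c_def
    \<alpha>_def \<beta>_def \<gamma>_def \<alpha>\<^sub>0_def \<beta>\<^sub>0_def \<gamma>\<^sub>0_def A_def B_def E_def
  have t [simp]:
    "A \<in> Obj K" "B \<in> Obj K" "E \<in> Obj K"
    "f \<in> Mor K" "Dom K f = A" "Cod K f = B" "g \<in> Mor K" "Dom K g = B" "Cod K g = E"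
    "a \<in> Mor K" "Dom K a = A" "Cod K a = G\<langle>A\<rangle>\<^sub>0" "b \<in> Mor K" "Dom K b = B" "Cod K b = G\<langle>B\<rangle>\<^sub>0"
    "c \<in> Mor K" "Dom K c = E" "Cod K c = G\<langle>E\<rangle>\<^sub>0"
    "\<phi> \<in> Cel K" "Src K \<phi> = b \<cdot> f" "Trg K \<phi> = G\<langle>f\<rangle>\<^sub>1 \<cdot> a"
    "\<chi> \<in> Cel K" "Src K \<chi> = c \<cdot> g" "Trg K \<chi> = G\<langle>g\<rangle>\<^sub>1 \<cdot> b"
    "\<alpha> \<in> Cel K" "Src K \<alpha> = G\<langle>a\<rangle>\<^sub>1 \<cdot> a" "Trg K \<alpha> = d A \<cdot> a"
    "\<beta> \<in> Cel K" "Src K \<beta> = G\<langle>b\<rangle>\<^sub>1 \<cdot> b" "Trg K \<beta> = d B \<cdot> b"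
    "\<gamma> \<in> Cel K" "Src K \<gamma> = G\<langle>c\<rangle>\<^sub>1 \<cdot> c" "Trg K \<gamma> = d E \<cdot> c"
    "\<alpha>\<^sub>0 \<in> Cel K" "Src K \<alpha>\<^sub>0 = \<one> A" "Trg K \<alpha>\<^sub>0 = e A \<cdot> a"
    "\<beta>\<^sub>0 \<in> Cel K" "Src K \<beta>\<^sub>0 = \<one> B" "Trg K \<beta>\<^sub>0 = e B \<cdot> b"
    "\<gamma>\<^sub>0 \<in> Cel K" "Src K \<gamma>\<^sub>0 = \<one> E" "Trg K \<gamma>\<^sub>0 = e E \<cdot> c"
    using F F' by (simp_all add: defs comp)
  have mult: "(d B \<rhd> \<phi>) \<bullet> (\<beta> \<lhd> f) = (G\<langle>G\<langle>f\<rangle>\<^sub>1\<rangle>\<^sub>1 \<rhd> \<alpha>) \<bullet> (G\<langle>\<phi>\<rangle>\<^sub>2 \<lhd> a) \<bullet> (G\<langle>b\<rangle>\<^sub>1 \<rhd> \<phi>)"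
    "(d E \<rhd> \<chi>) \<bullet> (\<gamma> \<lhd> g) = (G\<langle>G\<langle>g\<rangle>\<^sub>1\<rangle>\<^sub>1 \<rhd> \<beta>) \<bullet> (G\<langle>\<chi>\<rangle>\<^sub>2 \<lhd> b) \<bullet> (G\<langle>c\<rangle>\<^sub>1 \<rhd> \<chi>)"
    and unit: "(e B \<rhd> \<phi>) \<bullet> (\<beta>\<^sub>0 \<lhd> f) = f \<rhd> \<alpha>\<^sub>0" "(e E \<rhd> \<chi>) \<bullet> (\<gamma>\<^sub>0 \<lhd> g) = g \<rhd> \<beta>\<^sub>0"
    using F F' comp by (simp_all only: lax_mor_iff defs)
  \<comment> \<open>The axiom of the outer morphism, whiskered with \<open>f\<close>, that of the inner one, whiskered with \<open>GGg\<close>, and an interchange.\<close>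
  have m1: "(d E \<rhd> (\<chi> \<lhd> f)) \<bullet> (\<gamma> \<lhd> (g \<cdot> f))
      = (G\<langle>G\<langle>g\<rangle>\<^sub>1\<rangle>\<^sub>1 \<rhd> (\<beta> \<lhd> f)) \<bullet> ((G\<langle>\<chi>\<rangle>\<^sub>2 \<lhd> (b \<cdot> f)) \<bullet> (G\<langle>c\<rangle>\<^sub>1 \<rhd> (\<chi> \<lhd> f)))"
    using arg_cong[OF mult(2), of "\<lambda>x. x \<lhd> f"] by simp
  have m2: "((G\<langle>G\<langle>g\<rangle>\<^sub>1\<rangle>\<^sub>1 \<cdot> d B) \<rhd> \<phi>) \<bullet> (G\<langle>G\<langle>g\<rangle>\<^sub>1\<rangle>\<^sub>1 \<rhd> (\<beta> \<lhd> f))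
      = ((G\<langle>G\<langle>g\<rangle>\<^sub>1\<rangle>\<^sub>1 \<cdot> G\<langle>G\<langle>f\<rangle>\<^sub>1\<rangle>\<^sub>1) \<rhd> \<alpha>) \<bullet> ((G\<langle>G\<langle>g\<rangle>\<^sub>1\<rangle>\<^sub>1 \<rhd> (G\<langle>\<phi>\<rangle>\<^sub>2 \<lhd> a)) \<bullet> ((G\<langle>G\<langle>g\<rangle>\<^sub>1\<rangle>\<^sub>1 \<cdot> G\<langle>b\<rangle>\<^sub>1) \<rhd> \<phi>))"
    using arg_cong[OF mult(1), of "\<lambda>x. G\<langle>G\<langle>g\<rangle>\<^sub>1\<rangle>\<^sub>1 \<rhd> x"] by simp
  have m3: "((G\<langle>G\<langle>g\<rangle>\<^sub>1\<rangle>\<^sub>1 \<cdot> G\<langle>b\<rangle>\<^sub>1) \<rhd> \<phi>) \<bullet> (G\<langle>\<chi>\<rangle>\<^sub>2 \<lhd> (b \<cdot> f))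
      = (G\<langle>\<chi>\<rangle>\<^sub>2 \<lhd> (G\<langle>f\<rangle>\<^sub>1 \<cdot> a)) \<bullet> ((G\<langle>c\<rangle>\<^sub>1 \<cdot> G\<langle>g\<rangle>\<^sub>1) \<rhd> \<phi>)"
    by (rule G.C.whisker_exchange) (auto simp: Cells_iff)
  have u1: "(e E \<rhd> (\<chi> \<lhd> f)) \<bullet> (\<gamma>\<^sub>0 \<lhd> (g \<cdot> f)) = g \<rhd> (\<beta>\<^sub>0 \<lhd> f)"
    using arg_cong[OF unit(2), of "\<lambda>x. x \<lhd> f"] by simp
  have u2: "((g \<cdot> e B) \<rhd> \<phi>) \<bullet> (g \<rhd> (\<beta>\<^sub>0 \<lhd> f)) = (g \<cdot> f) \<rhd> \<alpha>\<^sub>0"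
    using arg_cong[OF unit(1), of "\<lambda>x. g \<rhd> x"] by simp
  have "(d E \<rhd> ((G\<langle>g\<rangle>\<^sub>1 \<rhd> \<phi>) \<bullet> (\<chi> \<lhd> f))) \<bullet> (\<gamma> \<lhd> (g \<cdot> f))
     = (G\<langle>G\<langle>g \<cdot> f\<rangle>\<^sub>1\<rangle>\<^sub>1 \<rhd> \<alpha>) \<bullet> (G\<langle>(G\<langle>g\<rangle>\<^sub>1 \<rhd> \<phi>) \<bullet> (\<chi> \<lhd> f)\<rangle>\<^sub>2 \<lhd> a) \<bullet> (G\<langle>c\<rangle>\<^sub>1 \<rhd> ((G\<langle>g\<rangle>\<^sub>1 \<rhd> \<phi>) \<bullet> (\<chi> \<lhd> f)))"
    by (simp add: m1 G.C.vcomp_rewrite_head[OF m2] G.C.vcomp_rewrite_head[OF m3])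
  moreover have "(e E \<rhd> ((G\<langle>g\<rangle>\<^sub>1 \<rhd> \<phi>) \<bullet> (\<chi> \<lhd> f))) \<bullet> (\<gamma>\<^sub>0 \<lhd> (g \<cdot> f)) = (g \<cdot> f) \<rhd> \<alpha>\<^sub>0"
    by (simp add: u1 u2)
  moreover have "is_coalg X" "is_coalg Z"
    using F F' by (simp_all add: X_def Z_def)
  ultimately show ?thesis
    unfolding lax_mor_iff lax_comp_sel using t unfolding defs by (auto simp: comp)
qed

lemma G_trans_Id2:
  assumes "is_mor F"
  shows "is_trans (Coalg_Trans F F (\<iota> (mor F)))"
  unfolding G_trans_iff using assms by simp

lemma G_trans_vcomp:
  assumes T: "is_trans T" and T': "is_trans T'" and comp: "trans_src T' = trans_trg T"
  shows "is_trans (Coalg_Trans (trans_src T) (trans_trg T') (trans T' \<bullet> trans T))"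
proof -
  define a b where "a = act (mor_dom (trans_src T))" and "b = act (mor_cod (trans_src T))"
  have *: "(G\<langle>trans T\<rangle>\<^sub>2 \<lhd> a) \<bullet> mor_cell (trans_src T) = mor_cell (trans_trg T) \<bullet> (b \<rhd> trans T)"
    "(G\<langle>trans T'\<rangle>\<^sub>2 \<lhd> a) \<bullet> mor_cell (trans_trg T) = mor_cell (trans_trg T') \<bullet> (b \<rhd> trans T')"
    using T T' comp unfolding G_trans_iff a_def b_def by auto
  have cb: "Cod K (mor (trans_src T)) = Dom K b" "b \<in> Mor K" "a \<in> Mor K"
    "Dom K (mor (trans_src T)) = Dom K a" "Dom K b = carrier (mor_cod (trans_src T))"
    "Cod K b = G\<langle>Dom K b\<rangle>\<^sub>0" "Cod K a = G\<langle>Dom K a\<rangle>\<^sub>0" "Dom K a = carrier (mor_dom (trans_src T))"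
    using T by (simp_all add: a_def b_def)
  have "(G\<langle>trans T' \<bullet> trans T\<rangle>\<^sub>2 \<lhd> a) \<bullet> mor_cell (trans_src T)
      = mor_cell (trans_trg T') \<bullet> (b \<rhd> (trans T' \<bullet> trans T))"
    using T T' comp cb
    by (simp add: *(1) G.C.vcomp_rewrite_head[OF *(2)] a_def[symmetric] b_def[symmetric])
  then show ?thesis
    unfolding G_trans_iff using T T' comp by (simp add: a_def b_def)
qed

text \<open>
  Here \<open>\<sigma> \<star> \<tau>\<close> is written as \<open>\<tau>\<close> after \<open>\<sigma>\<close>; the squares of \<open>\<tau>\<close> and \<open>\<sigma>\<close> are pasted in this order, with an
  interchange before and after to bring each transformation next to the matching structure cell.
\<close>

lemma G_trans_hcomp:
  assumes T: "is_trans T" and T': "is_trans T'" and comp: "mor_dom (trans_src T') = mor_cod (trans_src T)"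
  shows "is_trans (Coalg_Trans (lax_comp K G (trans_src T') (trans_src T))
       (lax_comp K G (trans_trg T') (trans_trg T)) (trans T' \<star> trans T))"
proof -
  define X Y Z where "X = mor_dom (trans_src T)" and "Y = mor_cod (trans_src T)"
    and "Z = mor_cod (trans_src T')"
  define f \<phi> f' \<phi>' where "f = mor (trans_src T)" and "\<phi> = mor_cell (trans_src T)"
    and "f' = mor (trans_trg T)" and "\<phi>' = mor_cell (trans_trg T)"
  define g \<chi> g' \<chi>' where "g = mor (trans_src T')" and "\<chi> = mor_cell (trans_src T')"
    and "g' = mor (trans_trg T')" and "\<chi>' = mor_cell (trans_trg T')"
  define \<tau> \<sigma> where "\<tau> = trans T" and "\<sigma> = trans T'"
  define a b c where "a = act X" and "b = act Y" and "c = act Z"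
  define A B E where "A = carrier X" and "B = carrier Y" and "E = carrier Z"
  note defs = X_def Y_def Z_def f_def f'_def g_def g'_def \<phi>_def \<phi>'_def \<chi>_def \<chi>'_def a_def b_def c_def
    \<tau>_def \<sigma>_def A_def B_def E_def
  have t [simp]:
    "A \<in> Obj K" "B \<in> Obj K" "E \<in> Obj K"
    "f \<in> Mor K" "Dom K f = A" "Cod K f = B" "g \<in> Mor K" "Dom K g = B" "Cod K g = E"
    "f' \<in> Mor K" "Dom K f' = A" "Cod K f' = B" "g' \<in> Mor K" "Dom K g' = B" "Cod K g' = E"
    "a \<in> Mor K" "Dom K a = A" "Cod K a = G\<langle>A\<rangle>\<^sub>0" "b \<in> Mor K" "Dom K b = B" "Cod K b = G\<langle>B\<rangle>\<^sub>0"
    "c \<in> Mor K" "Dom K c = E" "Cod K c = G\<langle>E\<rangle>\<^sub>0"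
    "\<phi> \<in> Cel K" "Src K \<phi> = b \<cdot> f" "Trg K \<phi> = G\<langle>f\<rangle>\<^sub>1 \<cdot> a"
    "\<phi>' \<in> Cel K" "Src K \<phi>' = b \<cdot> f'" "Trg K \<phi>' = G\<langle>f'\<rangle>\<^sub>1 \<cdot> a"
    "\<chi> \<in> Cel K" "Src K \<chi> = c \<cdot> g" "Trg K \<chi> = G\<langle>g\<rangle>\<^sub>1 \<cdot> b"
    "\<chi>' \<in> Cel K" "Src K \<chi>' = c \<cdot> g'" "Trg K \<chi>' = G\<langle>g'\<rangle>\<^sub>1 \<cdot> b"
    "\<tau> \<in> Cel K" "Src K \<tau> = f" "Trg K \<tau> = f'"
    "\<sigma> \<in> Cel K" "Src K \<sigma> = g" "Trg K \<sigma> = g'"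
    using T T' by (simp_all add: defs comp)
  have \<tau>: "(G\<langle>\<tau>\<rangle>\<^sub>2 \<lhd> a) \<bullet> \<phi> = \<phi>' \<bullet> (b \<rhd> \<tau>)" and \<sigma>: "(G\<langle>\<sigma>\<rangle>\<^sub>2 \<lhd> b) \<bullet> \<chi> = \<chi>' \<bullet> (c \<rhd> \<sigma>)"
    using T T' comp by (simp_all only: G_trans_iff defs)
  have 1: "(G\<langle>g'\<rangle>\<^sub>1 \<rhd> (G\<langle>\<tau>\<rangle>\<^sub>2 \<lhd> a)) \<bullet> (G\<langle>g'\<rangle>\<^sub>1 \<rhd> \<phi>) = (G\<langle>g'\<rangle>\<^sub>1 \<rhd> \<phi>') \<bullet> ((G\<langle>g'\<rangle>\<^sub>1 \<cdot> b) \<rhd> \<tau>)"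
    using arg_cong[OF \<tau>, of "\<lambda>x. G\<langle>g'\<rangle>\<^sub>1 \<rhd> x"] by simp
  have 2: "(G\<langle>\<sigma>\<rangle>\<^sub>2 \<lhd> (b \<cdot> f)) \<bullet> (\<chi> \<lhd> f) = (\<chi>' \<lhd> f) \<bullet> (c \<rhd> (\<sigma> \<lhd> f))"
    using arg_cong[OF \<sigma>, of "\<lambda>x. x \<lhd> f"] by simp
  have 3: "(G\<langle>\<sigma>\<rangle>\<^sub>2 \<lhd> (G\<langle>f\<rangle>\<^sub>1 \<cdot> a)) \<bullet> (G\<langle>g\<rangle>\<^sub>1 \<rhd> \<phi>) = (G\<langle>g'\<rangle>\<^sub>1 \<rhd> \<phi>) \<bullet> (G\<langle>\<sigma>\<rangle>\<^sub>2 \<lhd> (b \<cdot> f))"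
    by (rule G.C.whisker_exchange[symmetric]) (auto simp: Cells_iff)
  have 4: "((G\<langle>g'\<rangle>\<^sub>1 \<cdot> b) \<rhd> \<tau>) \<bullet> (\<chi>' \<lhd> f) = (\<chi>' \<lhd> f') \<bullet> ((c \<cdot> g') \<rhd> \<tau>)"
    by (rule G.C.whisker_exchange) (auto simp: Cells_iff)
  have "(G\<langle>\<sigma> \<star> \<tau>\<rangle>\<^sub>2 \<lhd> a) \<bullet> ((G\<langle>g\<rangle>\<^sub>1 \<rhd> \<phi>) \<bullet> (\<chi> \<lhd> f))
     = (G\<langle>g'\<rangle>\<^sub>1 \<rhd> \<phi>') \<bullet> (\<chi>' \<lhd> f') \<bullet> (c \<rhd> (\<sigma> \<star> \<tau>))"
    by (simp add: G.C.hcomp_as_whiskers G.C.vcomp_rewrite_head[OF 1] 2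
        G.C.vcomp_rewrite_head[OF 3] G.C.vcomp_rewrite_head[OF 4])
  then show ?thesis
    unfolding G_trans_iff using T T' t comp unfolding defs by (simp add: lax_mor_lax_comp)
qed

theorem two_category_Lax: "two_category Lax"
proof
  fix A assume "A \<in> Obj Lax"
  then show "\<one>\<^bsub>Lax\<^esub> A \<in> Hom Lax A A"
    by (simp add: Hom_iff lax_mor_lax_id)
next
  fix f A B g D assume "f \<in> Hom Lax A B" "g \<in> Hom Lax B D"
  then show "g \<cdot>\<^bsub>Lax\<^esub> f \<in> Hom Lax A D"
    by (auto simp: Hom_iff lax_mor_lax_comp)
next
  fix f A B assume "f \<in> Hom Lax A B"
  then show "\<one>\<^bsub>Lax\<^esub> B \<cdot>\<^bsub>Lax\<^esub> f = f" "f \<cdot>\<^bsub>Lax\<^esub> \<one>\<^bsub>Lax\<^esub> A = f"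
    by (auto simp: Hom_iff intro!: coalg_mor.expand)
next
  fix f A B g D h E assume "f \<in> Hom Lax A B" "g \<in> Hom Lax B D" "h \<in> Hom Lax D E"
  then show "h \<cdot>\<^bsub>Lax\<^esub> g \<cdot>\<^bsub>Lax\<^esub> f = h \<cdot>\<^bsub>Lax\<^esub> (g \<cdot>\<^bsub>Lax\<^esub> f)"
    by (auto simp: Hom_iff intro!: coalg_mor.expand)
next
  fix f assume "f \<in> Mor Lax"
  then show "\<iota>\<^bsub>Lax\<^esub> f \<in> Cells Lax f f"
    by (simp add: Cells_iff G_trans_Id2)
next
  fix \<alpha> f g \<beta> h assume "\<alpha> \<in> Cells Lax f g" "\<beta> \<in> Cells Lax g h"
  then show "\<beta> \<bullet>\<^bsub>Lax\<^esub> \<alpha> \<in> Cells Lax f h"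
    by (auto simp: Cells_iff intro!: G_trans_vcomp)
next
  fix \<alpha> f f' \<beta> g g' assume "\<alpha> \<in> Cells Lax f f'" "\<beta> \<in> Cells Lax g g'" "Dom Lax g = Cod Lax f"
  then show "\<beta> \<star>\<^bsub>Lax\<^esub> \<alpha> \<in> Cells Lax (g \<cdot>\<^bsub>Lax\<^esub> f) (g' \<cdot>\<^bsub>Lax\<^esub> f')"
    by (auto simp: Cells_iff intro!: G_trans_hcomp)
next
  fix \<alpha> f g assume "\<alpha> \<in> Cells Lax f g"
  then show "\<iota>\<^bsub>Lax\<^esub> (\<one>\<^bsub>Lax\<^esub> (Cod Lax f)) \<star>\<^bsub>Lax\<^esub> \<alpha> = \<alpha>" "\<alpha> \<star>\<^bsub>Lax\<^esub> \<iota>\<^bsub>Lax\<^esub> (\<one>\<^bsub>Lax\<^esub> (Dom Lax f)) = \<alpha>"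
    using G.C.hcomp_Id1_left[of "trans \<alpha>" "mor f" "mor g"] G.C.hcomp_Id1_right[of "trans \<alpha>" "mor f" "mor g"]
    by (auto simp: Cells_iff intro!: coalg_trans.expand coalg_mor.expand)
next
  fix \<alpha> f f' \<beta> g g' \<gamma> h h'
  assume "\<alpha> \<in> Cells Lax f f'" "\<beta> \<in> Cells Lax g g'" "\<gamma> \<in> Cells Lax h h'"
    "Dom Lax g = Cod Lax f" "Dom Lax h = Cod Lax g"
  then show "\<gamma> \<star>\<^bsub>Lax\<^esub> \<beta> \<star>\<^bsub>Lax\<^esub> \<alpha> = \<gamma> \<star>\<^bsub>Lax\<^esub> (\<beta> \<star>\<^bsub>Lax\<^esub> \<alpha>)"
    by (auto simp: Cells_iff intro!: coalg_trans.expand coalg_mor.expand)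
next
  fix f g assume "f \<in> Mor Lax" "g \<in> Mor Lax" "Dom Lax g = Cod Lax f"
  then show "\<iota>\<^bsub>Lax\<^esub> g \<star>\<^bsub>Lax\<^esub> \<iota>\<^bsub>Lax\<^esub> f = \<iota>\<^bsub>Lax\<^esub> (g \<cdot>\<^bsub>Lax\<^esub> f)"
    by (simp add: G.C.hcomp_Id2)
next
  fix \<alpha> f f' \<alpha>' f'' \<beta> g g' \<beta>' g''
  assume "\<alpha> \<in> Cells Lax f f'" "\<alpha>' \<in> Cells Lax f' f''" "\<beta> \<in> Cells Lax g g'" "\<beta>' \<in> Cells Lax g' g''"
    "Dom Lax g = Cod Lax f"
  then show "(\<beta>' \<bullet>\<^bsub>Lax\<^esub> \<beta>) \<star>\<^bsub>Lax\<^esub> (\<alpha>' \<bullet>\<^bsub>Lax\<^esub> \<alpha>) = (\<beta>' \<star>\<^bsub>Lax\<^esub> \<alpha>') \<bullet>\<^bsub>Lax\<^esub> (\<beta> \<star>\<^bsub>Lax\<^esub> \<alpha>)"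
    by (auto simp: Cells_iff G.C.interchange')
qed (auto simp: Cells_iff Hom_iff intro!: coalg_trans.expand)

end

section \<open>The Eilenberg--Moore 2-category\<close>

text \<open>
  The sub-2-category keeps all 2-cells between the chosen morphisms, so closure has to be checked for
  objects and morphisms alone.
\<close>

lemma (in two_category) locally_full_sub:
  fixes O' :: "'o set" and M' :: "'m set"
  defines "S \<equiv> C\<lparr>Obj := O', Mor := M', Cel := {T \<in> Cel C. Src C T \<in> M' \<and> Trg C T \<in> M'}\<rparr>"
  assumes sub: "O' \<subseteq> Obj C" "M' \<subseteq> Mor C"
    and bdry: "\<And>f. f \<in> M' \<Longrightarrow> Dom C f \<in> O' \<and> Cod C f \<in> O'"
    and Id1: "\<And>A. A \<in> O' \<Longrightarrow> \<one> A \<in> M'"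
    and comp: "\<And>f g. \<lbrakk>f \<in> M'; g \<in> M'; Dom C g = Cod C f\<rbrakk> \<Longrightarrow> g \<cdot> f \<in> M'"
  shows "two_category S" "two_functor S C id_fun"
proof -
  have Mor: "f \<in> Mor C" if "f \<in> M'" for f
    using that sub by auto
  have Obj: "A \<in> Obj C" if "A \<in> O'" for A
    using that sub by auto
  show S: "two_category S"
    using Mor Obj bdry Id1 comp
    by unfold_locales
      (auto simp: S_def Hom_iff Cells_iff hcomp_Id1_left hcomp_Id1_right hcomp_Id2 interchange'
         whisker_left_def[symmetric] whisker_right_def[symmetric])
  interpret S: two_category S
    by (rule S)
  show "two_functor S C id_fun"
    using Mor Obj by unfold_locales (auto simp: id_fun_def S_def Hom_iff Cells_iff)
qed

context two_comonad
begin

abbreviation EMC where "EMC \<equiv> EM K G d e"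
abbreviation is_strict where "is_strict \<equiv> strict_coalg K G d e"
abbreviation is_strict_mor where "is_strict_mor \<equiv> strict_mor K G d e"

lemma EM_sel:
  "X \<in> Obj EMC \<longleftrightarrow> is_strict X" "F \<in> Mor EMC \<longleftrightarrow> is_strict_mor F"
  "T \<in> Cel EMC \<longleftrightarrow> is_trans T \<and> is_strict_mor (trans_src T) \<and> is_strict_mor (trans_trg T)"
  "Dom EMC = mor_dom" "Cod EMC = mor_cod" "Src EMC = trans_src" "Trg EMC = trans_trg"
  "Id1 EMC = lax_id K" "comp1 EMC = lax_comp K G" "Id2 EMC = Id2 Lax"
  "vcomp EMC = vcomp Lax" "hcomp EMC = hcomp Lax"
  by (auto simp: EM_def Lax_Coalg_def)

lemma trans_EM_ops [simp]:
  "trans (Id2 EMC F) = \<iota> (mor F)"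
  "trans (vcomp EMC T' T) = trans T' \<bullet> trans T"
  "trans (whisker_left EMC F T) = mor F \<rhd> trans T"
  "trans (whisker_right EMC T F) = trans T \<lhd> mor F"
  by (simp_all add: EM_sel whisker_left_def whisker_right_def)

lemma mor_EM_ops [simp]:
  "mor (comp1 EMC F' F) = mor F' \<cdot> mor F" "mor (Id1 EMC X) = \<one> (carrier X)"
  by (simp_all add: EM_sel)

text \<open>
  When the structure cells are identities, the coherence axioms of a lax coalgebra follow from the strict coalgebra
  equations: all cells involved are identities, and it remains to see that they have equal boundary.
\<close>

lemma strict_coalg_iff:
  "is_strict X \<longleftrightarrow> carrier X \<in> Obj K \<and> act X \<in> Mor K \<and> Dom K (act X) = carrier X \<and>
    Cod K (act X) = G\<langle>carrier X\<rangle>\<^sub>0 \<and>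
    d (carrier X) \<cdot> act X = G\<langle>act X\<rangle>\<^sub>1 \<cdot> act X \<and> e (carrier X) \<cdot> act X = \<one> (carrier X) \<and>
    mult_cell X = \<iota> (G\<langle>act X\<rangle>\<^sub>1 \<cdot> act X) \<and> unit_cell X = \<iota> (\<one> (carrier X))"
  (is "_ \<longleftrightarrow> ?R")
proof
  assume X: "is_strict X"
  then have "is_coalg X" "mult_cell X = \<iota> (G\<langle>act X\<rangle>\<^sub>1 \<cdot> act X)" "unit_cell X = \<iota> (\<one> (carrier X))"
    by (simp_all add: strict_coalg_def)
  then show ?R
    using lax_coalg_simps[of X] by auto
next
  assume R: ?R
  obtain A a \<alpha> \<alpha>\<^sub>0 where X: "X = Coalg A a \<alpha> \<alpha>\<^sub>0"
    by (cases X)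
  have [simp]: "A \<in> Obj K" "a \<in> Mor K" "Dom K a = A" "Cod K a = G\<langle>A\<rangle>\<^sub>0"
    and eqs: "d A \<cdot> a = G\<langle>a\<rangle>\<^sub>1 \<cdot> a" "e A \<cdot> a = \<one> A"
    using R X by simp_all
  have "G\<langle>d A\<rangle>\<^sub>1 \<cdot> G\<langle>a\<rangle>\<^sub>1 = G\<langle>G\<langle>a\<rangle>\<^sub>1 \<cdot> a\<rangle>\<^sub>1" "G\<langle>e A\<rangle>\<^sub>1 \<cdot> G\<langle>a\<rangle>\<^sub>1 = G\<langle>\<one> A\<rangle>\<^sub>1"
    by (simp_all flip: eqs)
  from this[THEN comp1_eq_under, of a]
  have "G\<langle>d A\<rangle>\<^sub>1 \<cdot> (G\<langle>a\<rangle>\<^sub>1 \<cdot> a) = G\<langle>G\<langle>a\<rangle>\<^sub>1\<rangle>\<^sub>1 \<cdot> (G\<langle>a\<rangle>\<^sub>1 \<cdot> a)"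
    "G\<langle>e A\<rangle>\<^sub>1 \<cdot> (G\<langle>a\<rangle>\<^sub>1 \<cdot> a) = a"
    by simp_all
  moreover have "d (G\<langle>A\<rangle>\<^sub>0) \<cdot> (G\<langle>a\<rangle>\<^sub>1 \<cdot> a) = G\<langle>G\<langle>a\<rangle>\<^sub>1\<rangle>\<^sub>1 \<cdot> (G\<langle>a\<rangle>\<^sub>1 \<cdot> a)"
    using R X by simp
  moreover have "e (G\<langle>A\<rangle>\<^sub>0) \<cdot> (G\<langle>a\<rangle>\<^sub>1 \<cdot> a) = a"
    using R X by simp
  ultimately have "is_coalg X"
    using R X by (simp add: Hom_iff Cells_iff)
  then show "is_strict X"
    using R by (simp add: strict_coalg_def)
qed

lemma strict_coalg_is_coalg: "is_strict X \<Longrightarrow> is_coalg X"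
  by (simp add: strict_coalg_def)

lemma strict_coalg_simps [simp]:
  assumes "is_strict X"
  shows "carrier X \<in> Obj K" "act X \<in> Mor K" "Dom K (act X) = carrier X"
    "Cod K (act X) = G\<langle>carrier X\<rangle>\<^sub>0"
    "d (carrier X) \<cdot> act X = G\<langle>act X\<rangle>\<^sub>1 \<cdot> act X" "e (carrier X) \<cdot> act X = \<one> (carrier X)"
    "mult_cell X = \<iota> (G\<langle>act X\<rangle>\<^sub>1 \<cdot> act X)" "unit_cell X = \<iota> (\<one> (carrier X))"
  using assms by (simp_all add: strict_coalg_iff)

text \<open>Likewise the axioms of a lax morphism follow from the strict square.\<close>

lemma strict_mor_iff:
  "is_strict_mor F \<longleftrightarrow> is_strict (mor_dom F) \<and> is_strict (mor_cod F) \<and> mor F \<in> Mor K \<and>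
    Dom K (mor F) = carrier (mor_dom F) \<and> Cod K (mor F) = carrier (mor_cod F) \<and>
    act (mor_cod F) \<cdot> mor F = G\<langle>mor F\<rangle>\<^sub>1 \<cdot> act (mor_dom F) \<and>
    mor_cell F = \<iota> (act (mor_cod F) \<cdot> mor F)"
  (is "_ \<longleftrightarrow> ?R")
proof
  assume F: "is_strict_mor F"
  then have "is_mor F" "mor_cell F = \<iota> (act (mor_cod F) \<cdot> mor F)" "is_strict (mor_dom F)"
    "is_strict (mor_cod F)"
    by (auto simp: strict_mor_def)
  then show ?R
    using lax_mor_simps[of F] by auto
next
  assume R: ?R
  define X Y f where "X = mor_dom F" and "Y = mor_cod F" and "f = mor F"
  have [simp]: "is_strict X" "is_strict Y" "f \<in> Mor K" "Dom K f = carrier X" "Cod K f = carrier Y"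
    using R by (auto simp: X_def Y_def f_def)
  have eq: "act Y \<cdot> f = G\<langle>f\<rangle>\<^sub>1 \<cdot> act X"
    using R by (simp add: X_def Y_def f_def)
  have 1: "G\<langle>act Y\<rangle>\<^sub>1 \<cdot> (G\<langle>f\<rangle>\<^sub>1 \<cdot> act X) = G\<langle>G\<langle>f\<rangle>\<^sub>1\<rangle>\<^sub>1 \<cdot> (G\<langle>act X\<rangle>\<^sub>1 \<cdot> act X)"
    using arg_cong[OF eq, of "\<lambda>x. G\<langle>x\<rangle>\<^sub>1 \<cdot> act X"] by simp
  have "is_mor F"
    unfolding lax_mor_iff X_def[symmetric] Y_def[symmetric] f_def[symmetric]
    using R by (simp add: strict_coalg_is_coalg X_def[symmetric] Y_def[symmetric] f_def[symmetric] eq 1)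
  then show "is_strict_mor F"
    using R by (simp add: strict_mor_def)
qed

lemma strict_mor_is_mor: "is_strict_mor F \<Longrightarrow> is_mor F"
  by (simp add: strict_mor_def)

lemma strict_mor_simps [simp]:
  assumes "is_strict_mor F"
  shows "is_strict (mor_dom F)" "is_strict (mor_cod F)" "mor F \<in> Mor K"
    "Dom K (mor F) = carrier (mor_dom F)" "Cod K (mor F) = carrier (mor_cod F)"
    "mor_cell F = \<iota> (act (mor_cod F) \<cdot> mor F)"
  using assms unfolding strict_mor_iff by auto

lemma strict_mor_square:
  "is_strict_mor F \<Longrightarrow> act (mor_cod F) \<cdot> mor F = G\<langle>mor F\<rangle>\<^sub>1 \<cdot> act (mor_dom F)"
  unfolding strict_mor_iff by auto

lemma strict_mor_lax_id: "is_strict X \<Longrightarrow> is_strict_mor (lax_id K X)"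
  unfolding strict_mor_iff by simp

lemma strict_mor_lax_comp:
  assumes "is_strict_mor F" "is_strict_mor F'" "mor_dom F' = mor_cod F"
  shows "is_strict_mor (lax_comp K G F' F)"
proof -
  have sq: "act (mor_cod F') \<cdot> mor F' = G\<langle>mor F'\<rangle>\<^sub>1 \<cdot> act (mor_cod F)"
    "act (mor_cod F) \<cdot> mor F = G\<langle>mor F\<rangle>\<^sub>1 \<cdot> act (mor_dom F)"
    using strict_mor_square[OF assms(1)] strict_mor_square[OF assms(2)] assms(3) by auto
  have "act (mor_cod F') \<cdot> (mor F' \<cdot> mor F) = G\<langle>mor F'\<rangle>\<^sub>1 \<cdot> (G\<langle>mor F\<rangle>\<^sub>1 \<cdot> act (mor_dom F))"
    using assms by (simp add: comp1_eq_under[OF sq(1)] flip: sq(2))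
  then show ?thesis
    unfolding strict_mor_iff using assms by (simp add: sq)
qed

lemma EM_as_sub:
  "EMC = Lax\<lparr>Obj := {X. is_strict X}, Mor := {F. is_strict_mor F},
    Cel := {T \<in> Cel Lax. Src Lax T \<in> {F. is_strict_mor F} \<and> Trg Lax T \<in> {F. is_strict_mor F}}\<rparr>"
  by (simp add: EM_def)

lemma two_category_EM: "two_category EMC"
  unfolding EM_as_sub
  by (rule two_category.locally_full_sub[OF two_category_Lax])
    (auto simp: strict_mor_lax_id strict_mor_lax_comp strict_coalg_is_coalg strict_mor_is_mor)

lemma two_functor_EM_inclusion: "two_functor EMC Lax EM_inclusion"
  unfolding EM_as_sub EM_inclusion_def
  by (rule two_category.locally_full_sub[OF two_category_Lax])
    (auto simp: strict_mor_lax_id strict_mor_lax_comp strict_coalg_is_coalg strict_mor_is_mor)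

end

sublocale two_comonad \<subseteq> EM: two_category "EM K G d e"
  by (rule two_category_EM)

section \<open>Cofree coalgebras\<close>

context two_comonad
begin

lemma EM_trans_iff:
  "T \<in> Cel EMC \<longleftrightarrow> is_strict_mor (trans_src T) \<and> is_strict_mor (trans_trg T) \<and>
    mor_dom (trans_trg T) = mor_dom (trans_src T) \<and> mor_cod (trans_trg T) = mor_cod (trans_src T) \<and>
    trans T \<in> Cel K \<and> Src K (trans T) = mor (trans_src T) \<and> Trg K (trans T) = mor (trans_trg T) \<and>
    G\<langle>trans T\<rangle>\<^sub>2 \<lhd> act (mor_dom (trans_src T)) = act (mor_cod (trans_src T)) \<rhd> trans T"
  unfolding EM_sel G_trans_iff
  using strict_mor_square[of "trans_src T"] strict_mor_square[of "trans_trg T"]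
  by (auto simp: strict_mor_is_mor)

lemma EM_Cells_iff:
  "T \<in> Cells EMC F F' \<longleftrightarrow> trans_src T = F \<and> trans_trg T = F' \<and> is_strict_mor F \<and> is_strict_mor F' \<and>
    mor_dom F' = mor_dom F \<and> mor_cod F' = mor_cod F \<and>
    trans T \<in> Cells K (mor F) (mor F') \<and>
    G\<langle>trans T\<rangle>\<^sub>2 \<lhd> act (mor_dom F) = act (mor_cod F) \<rhd> trans T"
  unfolding Cells_iff EM_trans_iff by (auto simp: EM_sel)

lemma EM_Hom_iff: "F \<in> Hom EMC X Y \<longleftrightarrow> is_strict_mor F \<and> mor_dom F = X \<and> mor_cod F = Y"
  by (simp add: Hom_iff EM_sel)

definition strict_Mor :: "('o, 'm, 'c) coalg \<Rightarrow> ('o, 'm, 'c) coalg \<Rightarrow> 'm \<Rightarrow> ('o, 'm, 'c) coalg_mor" where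
  "strict_Mor X Y f = Coalg_Mor X Y f (\<iota> (act Y \<cdot> f))"

lemma strict_Mor_sel [simp]:
  "mor_dom (strict_Mor X Y f) = X" "mor_cod (strict_Mor X Y f) = Y" "mor (strict_Mor X Y f) = f"
  by (simp_all add: strict_Mor_def)

lemma strict_Mor_strict:
  assumes "is_strict X" "is_strict Y" "f \<in> Mor K" "Dom K f = carrier X" "Cod K f = carrier Y"
    "act Y \<cdot> f = G\<langle>f\<rangle>\<^sub>1 \<cdot> act X"
  shows "is_strict_mor (strict_Mor X Y f)"
  using assms by (simp add: strict_mor_iff strict_Mor_def)

text \<open>The structure cell of a strict morphism is determined by the rest.\<close>

lemma strict_mor_eqI:
  assumes "is_strict_mor F" "is_strict_mor F'" "mor_dom F = mor_dom F'" "mor_cod F = mor_cod F'"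
    "mor F = mor F'"
  shows "F = F'"
  using assms by (intro coalg_mor.expand) simp

definition cofree :: "'o \<Rightarrow> ('o, 'm, 'c) coalg" where
  "cofree A = Coalg (G\<langle>A\<rangle>\<^sub>0) (d A) (\<iota> (G\<langle>d A\<rangle>\<^sub>1 \<cdot> d A)) (\<iota> (\<one> (G\<langle>A\<rangle>\<^sub>0)))"

lemma cofree_sel [simp]: "carrier (cofree A) = G\<langle>A\<rangle>\<^sub>0" "act (cofree A) = d A"
  by (simp_all add: cofree_def)

lemma strict_cofree [simp]: "A \<in> Obj K \<Longrightarrow> is_strict (cofree A)"
  unfolding strict_coalg_iff by (simp add: cofree_def coassoc)

text \<open>
  One half of the universal property of cofree coalgebras: a strict morphism into \<open>cofree B\<close> is
  recovered from its composite with \<open>e B\<close>, since \<open>G (e B) \<cdot> G v \<cdot> z = G (e B) \<cdot> d B \<cdot> v = v\<close>; the same computation works for 2-cells.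
\<close>

lemma mor_into_cofree:
  assumes "B \<in> Obj K" "F \<in> Hom EMC Z (cofree B)"
  shows "G\<langle>e B \<cdot> mor F\<rangle>\<^sub>1 \<cdot> act Z = mor F"
proof -
  have F: "is_strict_mor F" "mor_dom F = Z" "mor_cod F = cofree B"
    using assms(2) by (simp_all add: EM_Hom_iff)
  have "G\<langle>e B \<cdot> mor F\<rangle>\<^sub>1 \<cdot> act Z = G\<langle>e B\<rangle>\<^sub>1 \<cdot> (d B \<cdot> mor F)"
    using assms(1) F strict_mor_simps[OF F(1)] strict_mor_square[OF F(1)] by simp
  also have "\<dots> = mor F"
    using assms(1) F strict_mor_simps[OF F(1)] by simp
  finally show ?thesis .
qed

lemma trans_into_cofree:
  assumes "B \<in> Obj K" "T \<in> Cells EMC F F'" "F \<in> Hom EMC Z (cofree B)"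
  shows "G\<langle>e B \<rhd> trans T\<rangle>\<^sub>2 \<lhd> act Z = trans T"
proof -
  have F: "is_strict_mor F" "mor_dom F = Z" "mor_cod F = cofree B"
    using assms(3) by (simp_all add: EM_Hom_iff)
  have T: "trans T \<in> Cel K" "Src K (trans T) = mor F" "G\<langle>trans T\<rangle>\<^sub>2 \<lhd> act Z = d B \<rhd> trans T"
    using assms(2) F by (auto simp: EM_Cells_iff Cells_iff[of _ K])
  have "G\<langle>e B \<rhd> trans T\<rangle>\<^sub>2 \<lhd> act Z = G\<langle>e B\<rangle>\<^sub>1 \<rhd> (d B \<rhd> trans T)"
    using assms(1) F T strict_mor_simps[OF F(1)] by (simp flip: T(3))
  also have "\<dots> = trans T"
    using assms(1) F T strict_mor_simps[OF F(1)] by simp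
  finally show ?thesis .
qed

lemma bij_Hom_cofree:
  assumes B: "B \<in> Obj K" and Z: "is_strict Z"
  shows "bij_betw (\<lambda>F. e B \<cdot> mor F) (Hom EMC Z (cofree B)) (Hom K (carrier Z) B)"
proof (rule bij_betw_byWitness[where f' = "\<lambda>f. strict_Mor Z (cofree B) (G\<langle>f\<rangle>\<^sub>1 \<cdot> act Z)"])
  have strict: "is_strict_mor (strict_Mor Z (cofree B) (G\<langle>f\<rangle>\<^sub>1 \<cdot> act Z))" if "f \<in> Hom K (carrier Z) B" for f
    using that B Z by (intro strict_Mor_strict) (auto simp: Hom_iff)
  then show "(\<lambda>f. strict_Mor Z (cofree B) (G\<langle>f\<rangle>\<^sub>1 \<cdot> act Z)) ` Hom K (carrier Z) B \<subseteq> Hom EMC Z (cofree B)"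
    by (auto simp: EM_Hom_iff)
  show *: "(\<lambda>F. e B \<cdot> mor F) ` Hom EMC Z (cofree B) \<subseteq> Hom K (carrier Z) B"
    using B by (auto simp: EM_Hom_iff Hom_iff[of _ K])
  show "\<forall>F \<in> Hom EMC Z (cofree B). strict_Mor Z (cofree B) (G\<langle>e B \<cdot> mor F\<rangle>\<^sub>1 \<cdot> act Z) = F"
  proof
    fix F assume F: "F \<in> Hom EMC Z (cofree B)"
    then have f: "e B \<cdot> mor F \<in> Hom K (carrier Z) B"
      using * by blast
    from F show "strict_Mor Z (cofree B) (G\<langle>e B \<cdot> mor F\<rangle>\<^sub>1 \<cdot> act Z) = F"
      using strict[OF f] mor_into_cofree[OF B F]
      by (intro strict_mor_eqI) (auto simp: EM_Hom_iff)
  qed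
  show "\<forall>f \<in> Hom K (carrier Z) B. e B \<cdot> mor (strict_Mor Z (cofree B) (G\<langle>f\<rangle>\<^sub>1 \<cdot> act Z)) = f"
    using B Z by (auto simp: Hom_iff)
qed

lemma bij_Cells_cofree:
  assumes B: "B \<in> Obj K" and F: "F \<in> Hom EMC Z (cofree B)" "F' \<in> Hom EMC Z (cofree B)"
  shows "bij_betw (\<lambda>T. e B \<rhd> trans T) (Cells EMC F F') (Cells K (e B \<cdot> mor F) (e B \<cdot> mor F'))"
proof (rule bij_betw_byWitness[where f' = "\<lambda>\<theta>. Coalg_Trans F F' (G\<langle>\<theta>\<rangle>\<^sub>2 \<lhd> act Z)"])
  have S: "is_strict_mor F" "is_strict_mor F'" "mor_dom F = Z" "mor_dom F' = Z"
    "mor_cod F = cofree B" "mor_cod F' = cofree B"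
    using F by (simp_all add: EM_Hom_iff)
  have Z: "is_strict Z"
    using S strict_mor_simps(1) by blast
  note FF' = mor_into_cofree[OF B F(1)] mor_into_cofree[OF B F(2)]
  show "\<forall>T \<in> Cells EMC F F'. Coalg_Trans F F' (G\<langle>e B \<rhd> trans T\<rangle>\<^sub>2 \<lhd> act Z) = T"
    using trans_into_cofree[OF B _ F(1)] by (auto simp: EM_Cells_iff intro!: coalg_trans.expand)
  show "\<forall>\<theta> \<in> Cells K (e B \<cdot> mor F) (e B \<cdot> mor F').
      e B \<rhd> trans (Coalg_Trans F F' (G\<langle>\<theta>\<rangle>\<^sub>2 \<lhd> act Z)) = \<theta>"
  proof
    fix \<theta> assume \<theta>: "\<theta> \<in> Cells K (e B \<cdot> mor F) (e B \<cdot> mor F')"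
    then have t: "\<theta> \<in> Cel K" "Dom K (Src K \<theta>) = carrier Z" "Cod K (Src K \<theta>) = B"
      using B S strict_mor_simps[OF S(1)] by (auto simp: Cells_iff)
    then show "e B \<rhd> trans (Coalg_Trans F F' (G\<langle>\<theta>\<rangle>\<^sub>2 \<lhd> act Z)) = \<theta>"
      using Z by (simp add: counit_natural_whiskered)
  qed
  show "(\<lambda>T. e B \<rhd> trans T) ` Cells EMC F F' \<subseteq> Cells K (e B \<cdot> mor F) (e B \<cdot> mor F')"
    using B S strict_mor_simps[OF S(1)] by (auto simp: EM_Cells_iff Cells_iff[of _ K])
  show "(\<lambda>\<theta>. Coalg_Trans F F' (G\<langle>\<theta>\<rangle>\<^sub>2 \<lhd> act Z)) ` Cells K (e B \<cdot> mor F) (e B \<cdot> mor F') \<subseteq> Cells EMC F F'"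
  proof clarify
    fix \<theta> assume \<theta>: "\<theta> \<in> Cells K (e B \<cdot> mor F) (e B \<cdot> mor F')"
    then have t: "\<theta> \<in> Cel K" "Src K \<theta> = e B \<cdot> mor F" "Trg K \<theta> = e B \<cdot> mor F'"
      "Dom K (Src K \<theta>) = carrier Z" "Cod K (Src K \<theta>) = B"
      using B S strict_mor_simps[OF S(1)] by (auto simp: Cells_iff)
    have "d B \<rhd> (G\<langle>\<theta>\<rangle>\<^sub>2 \<lhd> act Z) = G\<langle>G\<langle>\<theta>\<rangle>\<^sub>2 \<lhd> act Z\<rangle>\<^sub>2 \<lhd> act Z"
      using Z t(1,4,5) by (simp add: comult_natural_whiskered)
    moreover have "G\<langle>\<theta>\<rangle>\<^sub>2 \<lhd> act Z \<in> Cells K (mor F) (mor F')"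
      using FF' B Z t(1,4,5) unfolding t(2,3)[symmetric] by (simp add: Cells_iff)
    ultimately show "Coalg_Trans F F' (G\<langle>\<theta>\<rangle>\<^sub>2 \<lhd> act Z) \<in> Cells EMC F F'"
      using S by (simp add: EM_Cells_iff)
  qed
qed

text \<open>This is how equations between 2-cells of coalgebras are transposed to \<open>K\<close>.\<close>

lemma cell_into_cofree_eq_iff:
  assumes "B \<in> Obj K" "F \<in> Hom EMC Z (cofree B)" "F' \<in> Hom EMC Z (cofree B)"
    "S \<in> Cells EMC F F'" "T \<in> Cells EMC F F'"
  shows "S = T \<longleftrightarrow> e B \<rhd> trans S = e B \<rhd> trans T"
  using bij_betw_imp_inj_on[OF bij_Cells_cofree[OF assms(1-3)]] assms(4,5) by (auto dest: inj_onD)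

end

section \<open>Lax coalgebras and lax coherence data\<close>

context two_comonad
begin

lemma coassoc_simps [simp]:
  assumes "A \<in> Obj K"
  shows "d (G\<langle>A\<rangle>\<^sub>0) \<cdot> d A = G\<langle>d A\<rangle>\<^sub>1 \<cdot> d A"
    "\<lbrakk>u \<in> Mor K; Cod K u = G\<langle>A\<rangle>\<^sub>0\<rbrakk> \<Longrightarrow> d (G\<langle>A\<rangle>\<^sub>0) \<cdot> (d A \<cdot> u) = G\<langle>d A\<rangle>\<^sub>1 \<cdot> (d A \<cdot> u)"
  using assms by (simp_all add: coassoc comp1_eq_under[OF coassoc])

text \<open>
  The cells \<open>\<delta>\<close>, \<open>\<kappa>\<close> and \<open>\<rho>\<close> are identities because of the counit law, coassociativity and naturality of \<open>d\<close>
  respectively; they are recorded with both of their boundaries, whose equality is a consequence of these laws.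
\<close>

definition descent_data ::
  "('o, 'm, 'c) coalg \<Rightarrow>
    (('o, 'm, 'c) coalg, ('o, 'm, 'c) coalg_mor, ('o, 'm, 'c) coalg_trans) lax_coherence" where
  "descent_data X = (let A = carrier X; a = act X; GA = G\<langle>A\<rangle>\<^sub>0; GGA = G\<langle>GA\<rangle>\<^sub>0;
      k = strict_Mor (cofree A) (cofree GA) (G\<langle>a\<rangle>\<^sub>1);
      l = strict_Mor (cofree A) (cofree GA) (d A);
      j = strict_Mor (cofree GA) (cofree A) (G\<langle>e A\<rangle>\<^sub>1);
      p = strict_Mor (cofree GA) (cofree GGA) (d GA);
      q = strict_Mor (cofree GA) (cofree GGA) (G\<langle>d A\<rangle>\<^sub>1);
      r = strict_Mor (cofree GA) (cofree GGA) (G\<langle>G\<langle>a\<rangle>\<^sub>1\<rangle>\<^sub>1);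
      cell = (\<lambda>F F'. Coalg_Trans F F' (\<iota> (mor F))) in
    \<lparr>X1 = cofree A, X2 = cofree GA, X3 = cofree GGA,
     cd_k = k, cd_l = l, cd_j = j, cd_p = p, cd_q = q, cd_r = r,
     cd_gamma = Coalg_Trans (\<one>\<^bsub>EMC\<^esub> (cofree A)) (j \<cdot>\<^bsub>EMC\<^esub> k) (G\<langle>unit_cell X\<rangle>\<^sub>2),
     cd_delta = cell (j \<cdot>\<^bsub>EMC\<^esub> l) (\<one>\<^bsub>EMC\<^esub> (cofree A)),
     cd_kappa = cell (p \<cdot>\<^bsub>EMC\<^esub> l) (q \<cdot>\<^bsub>EMC\<^esub> l),
     cd_lambda = Coalg_Trans (r \<cdot>\<^bsub>EMC\<^esub> k) (q \<cdot>\<^bsub>EMC\<^esub> k) (G\<langle>mult_cell X\<rangle>\<^sub>2),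
     cd_rho = cell (r \<cdot>\<^bsub>EMC\<^esub> l) (p \<cdot>\<^bsub>EMC\<^esub> k)\<rparr>)"

lemma strict_Mor_Hom:
  assumes "is_strict X" "is_strict Y" "f \<in> Mor K" "Dom K f = carrier X" "Cod K f = carrier Y"
    "act Y \<cdot> f = G\<langle>f\<rangle>\<^sub>1 \<cdot> act X"
  shows "strict_Mor X Y f \<in> Hom EMC X Y"
  using strict_Mor_strict[OF assms] by (simp add: EM_Hom_iff)

lemma EM_CellsI:
  assumes "F \<in> Hom EMC X Y" "F' \<in> Hom EMC X Y" "\<theta> \<in> Cells K (mor F) (mor F')"
    "G\<langle>\<theta>\<rangle>\<^sub>2 \<lhd> act X = act Y \<rhd> \<theta>"
  shows "Coalg_Trans F F' \<theta> \<in> Cells EMC F F'"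
  using assms by (simp add: EM_Cells_iff EM_Hom_iff)

lemma EM_comp_Hom: "F \<in> Hom EMC X Y \<Longrightarrow> F' \<in> Hom EMC Y Z \<Longrightarrow> F' \<cdot>\<^bsub>EMC\<^esub> F \<in> Hom EMC X Z"
  by (rule EM.comp1_Hom)

lemma lax_coherence_data_descent_data:
  assumes X: "is_coalg X"
  shows "lax_coherence_data EMC (descent_data X)"
proof -
  define A a where "A = carrier X" and "a = act X"
  let ?GA = "G\<langle>A\<rangle>\<^sub>0" and ?GGA = "G\<langle>G\<langle>A\<rangle>\<^sub>0\<rangle>\<^sub>0"
  have t [simp]: "A \<in> Obj K" "a \<in> Mor K" "Dom K a = A" "Cod K a = ?GA"
    using X by (simp_all add: A_def a_def)
  have homs:
    "strict_Mor (cofree A) (cofree ?GA) (G\<langle>a\<rangle>\<^sub>1) \<in> Hom EMC (cofree A) (cofree ?GA)"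
    "strict_Mor (cofree A) (cofree ?GA) (d A) \<in> Hom EMC (cofree A) (cofree ?GA)"
    "strict_Mor (cofree ?GA) (cofree A) (G\<langle>e A\<rangle>\<^sub>1) \<in> Hom EMC (cofree ?GA) (cofree A)"
    "strict_Mor (cofree ?GA) (cofree ?GGA) (d ?GA) \<in> Hom EMC (cofree ?GA) (cofree ?GGA)"
    "strict_Mor (cofree ?GA) (cofree ?GGA) (G\<langle>d A\<rangle>\<^sub>1) \<in> Hom EMC (cofree ?GA) (cofree ?GGA)"
    "strict_Mor (cofree ?GA) (cofree ?GGA) (G\<langle>G\<langle>a\<rangle>\<^sub>1\<rangle>\<^sub>1) \<in> Hom EMC (cofree ?GA) (cofree ?GGA)"
    by (rule strict_Mor_Hom; simp)+
  have id: "\<one>\<^bsub>EMC\<^esub> (cofree A) \<in> Hom EMC (cofree A) (cofree A)"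
    by (rule EM.Id1_Hom) (simp add: EM_sel)
  have nat: "d A \<rhd> G\<langle>unit_cell X\<rangle>\<^sub>2 = G\<langle>G\<langle>unit_cell X\<rangle>\<^sub>2\<rangle>\<^sub>2 \<lhd> d A"
    "d ?GGA \<rhd> G\<langle>mult_cell X\<rangle>\<^sub>2 = G\<langle>G\<langle>mult_cell X\<rangle>\<^sub>2\<rangle>\<^sub>2 \<lhd> d A"
    using comult_natural_Cel[of "unit_cell X"] comult_natural_Cel[of "mult_cell X"] X
    by (simp_all add: A_def)
  have X': "mult_cell X \<in> Cells K (G\<langle>a\<rangle>\<^sub>1 \<cdot> a) (d A \<cdot> a)" "unit_cell X \<in> Cells K (\<one> A) (e A \<cdot> a)"
    using X by (simp_all add: Cells_iff A_def a_def)
  then have X'': "G\<langle>mult_cell X\<rangle>\<^sub>2 \<in> Cells K (G\<langle>G\<langle>a\<rangle>\<^sub>1\<rangle>\<^sub>1 \<cdot> G\<langle>a\<rangle>\<^sub>1) (G\<langle>d A\<rangle>\<^sub>1 \<cdot> G\<langle>a\<rangle>\<^sub>1)"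
    "G\<langle>unit_cell X\<rangle>\<^sub>2 \<in> Cells K (\<one> ?GA) (G\<langle>e A\<rangle>\<^sub>1 \<cdot> G\<langle>a\<rangle>\<^sub>1)"
    by (simp_all add: Cells_iff)
  show ?thesis
    unfolding lax_coherence_data_def descent_data_def Let_def A_def[symmetric] a_def[symmetric]
      lax_coherence.simps
    by (intro conjI homs EM_CellsI[OF EM_comp_Hom EM_comp_Hom] EM_CellsI[OF id EM_comp_Hom]
          EM_CellsI[OF EM_comp_Hom id]; (rule homs)?)
      (simp_all add: EM_sel(1) nat X''[unfolded Cells_iff] Cells_iff)
qed

lemma descent_data_sel [simp]:
  "X1 (descent_data X) = cofree (carrier X)"
  "X2 (descent_data X) = cofree (G\<langle>carrier X\<rangle>\<^sub>0)"
  "X3 (descent_data X) = cofree (G\<langle>G\<langle>carrier X\<rangle>\<^sub>0\<rangle>\<^sub>0)"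
  "mor (cd_k (descent_data X)) = G\<langle>act X\<rangle>\<^sub>1"
  "mor (cd_l (descent_data X)) = d (carrier X)"
  "mor (cd_j (descent_data X)) = G\<langle>e (carrier X)\<rangle>\<^sub>1"
  "mor (cd_p (descent_data X)) = d (G\<langle>carrier X\<rangle>\<^sub>0)"
  "mor (cd_q (descent_data X)) = G\<langle>d (carrier X)\<rangle>\<^sub>1"
  "mor (cd_r (descent_data X)) = G\<langle>G\<langle>act X\<rangle>\<^sub>1\<rangle>\<^sub>1"
  "trans (cd_gamma (descent_data X)) = G\<langle>unit_cell X\<rangle>\<^sub>2"
  "trans (cd_delta (descent_data X)) = \<iota> (G\<langle>e (carrier X)\<rangle>\<^sub>1 \<cdot> d (carrier X))"
  "trans (cd_kappa (descent_data X)) = \<iota> (d (G\<langle>carrier X\<rangle>\<^sub>0) \<cdot> d (carrier X))"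
  "trans (cd_lambda (descent_data X)) = G\<langle>mult_cell X\<rangle>\<^sub>2"
  "trans (cd_rho (descent_data X)) = \<iota> (G\<langle>G\<langle>act X\<rangle>\<^sub>1\<rangle>\<^sub>1 \<cdot> d (carrier X))"
  by (simp_all add: descent_data_def Let_def)

definition cone_transpose ::
  "('o, 'm, 'c) coalg \<Rightarrow> ('o, 'm, 'c) coalg \<Rightarrow>
    ('o, 'm, 'c) coalg_mor \<times> ('o, 'm, 'c) coalg_trans \<Rightarrow> ('o, 'm, 'c) coalg_mor" where
  "cone_transpose X Z = (\<lambda>(v, \<psi>).
    Coalg_Mor Z X (e (carrier X) \<cdot> mor v) (e (G\<langle>carrier X\<rangle>\<^sub>0) \<rhd> trans \<psi>))"

lemma cone_transpose_sel [simp]: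
  "mor_dom (cone_transpose X Z (v, \<psi>)) = Z" "mor_cod (cone_transpose X Z (v, \<psi>)) = X"
  "mor (cone_transpose X Z (v, \<psi>)) = e (carrier X) \<cdot> mor v"
  "mor_cell (cone_transpose X Z (v, \<psi>)) = e (G\<langle>carrier X\<rangle>\<^sub>0) \<rhd> trans \<psi>"
  by (simp_all add: cone_transpose_def)

lemma EM_Hom_simps:
  assumes "F \<in> Hom EMC X Y"
  shows "mor F \<in> Mor K" "Dom K (mor F) = carrier X" "Cod K (mor F) = carrier Y"
  using assms by (auto simp: EM_Hom_iff)

lemma EM_Cells_simps:
  assumes "T \<in> Cells EMC F F'"
  shows "trans T \<in> Cel K" "Src K (trans T) = mor F" "Trg K (trans T) = mor F'"
  using assms by (auto simp: EM_Cells_iff Cells_iff[of _ K])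

text \<open>
  Both sides are reduced to conditions on \<open>\<omega> = trans \<psi>\<close> and its transpose \<open>\<phi> = eGA \<rhd> \<omega>\<close>.  Composing the
  first descent equation with \<open>eGGA\<close> turns \<open>dGA \<rhd> \<omega>\<close> into \<open>\<omega> = G\<phi> \<lhd> z\<close>, and \<open>GGa \<rhd> \<omega>\<close>, \<open>GdA \<rhd> \<omega>\<close>, \<open>G\<alpha> \<lhd> w\<close> into
  \<open>Ga \<rhd> \<phi>\<close>, \<open>dA \<rhd> \<phi>\<close>, \<open>\<alpha> \<lhd> f\<close>, which gives the multiplication axiom.  Composing the second with \<open>eA\<close>
  gives the unit axiom.
\<close>

lemma descent_cone_iff_lax_mor:
  assumes X: "is_coalg X" and Z: "is_strict Z"
    and v: "v \<in> Hom EMC Z (cofree (carrier X))"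
    and \<psi>: "\<psi> \<in> Cells EMC (cd_k (descent_data X) \<cdot>\<^bsub>EMC\<^esub> v) (cd_l (descent_data X) \<cdot>\<^bsub>EMC\<^esub> v)"
  shows "(v, \<psi>) \<in> descent_cones EMC (descent_data X) Z \<longleftrightarrow> is_mor (cone_transpose X Z (v, \<psi>))"
proof -
  let ?D = "descent_data X"
  define A a \<alpha> \<alpha>\<^sub>0 where "A = carrier X" and "a = act X" and "\<alpha> = mult_cell X" and "\<alpha>\<^sub>0 = unit_cell X"
  note defs = A_def a_def \<alpha>_def \<alpha>\<^sub>0_def
  define z where "z = act Z"
  define w \<omega> where "w = mor v" and "\<omega> = trans \<psi>"
  define f \<phi> where "f = e A \<cdot> w" and "\<phi> = e (G\<langle>A\<rangle>\<^sub>0) \<rhd> \<omega>"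
  have tX [simp]: "A \<in> Obj K" "a \<in> Mor K" "Dom K a = A" "Cod K a = G\<langle>A\<rangle>\<^sub>0"
    "\<alpha> \<in> Cel K" "Src K \<alpha> = G\<langle>a\<rangle>\<^sub>1 \<cdot> a" "Trg K \<alpha> = d A \<cdot> a"
    "\<alpha>\<^sub>0 \<in> Cel K" "Src K \<alpha>\<^sub>0 = \<one> A" "Trg K \<alpha>\<^sub>0 = e A \<cdot> a"
    using X by (simp_all add: defs)
  have tZ [simp]: "z \<in> Mor K" "Dom K z = carrier Z" "Cod K z = G\<langle>carrier Z\<rangle>\<^sub>0" "carrier Z \<in> Obj K"
    using Z by (simp_all add: z_def)
  have tv [simp]: "w \<in> Mor K" "Dom K w = carrier Z" "Cod K w = G\<langle>A\<rangle>\<^sub>0"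
    using EM_Hom_simps[OF v] by (simp_all add: w_def A_def)
  have t\<psi> [simp]: "\<omega> \<in> Cel K" "Src K \<omega> = G\<langle>a\<rangle>\<^sub>1 \<cdot> w" "Trg K \<omega> = d A \<cdot> w"
    using EM_Cells_simps[OF \<psi>] by (simp_all add: w_def \<omega>_def defs)
  note data = lax_coherence_data_descent_data[OF X, unfolded lax_coherence_data_def Hom_iff Cells_iff]
  have EMv: "v \<in> Mor EMC" "Dom EMC v = Z" "Cod EMC v = cofree A"
    "\<psi> \<in> Cel EMC" "Src EMC \<psi> = cd_k ?D \<cdot>\<^bsub>EMC\<^esub> v" "Trg EMC \<psi> = cd_l ?D \<cdot>\<^bsub>EMC\<^esub> v"
    using v \<psi> by (simp_all add: Hom_iff Cells_iff A_def)
  have fz: "G\<langle>f\<rangle>\<^sub>1 \<cdot> z = w"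
    using mor_into_cofree[OF _ v] by (simp add: f_def z_def w_def flip: A_def)
  have \<phi>z: "G\<langle>\<phi>\<rangle>\<^sub>2 \<lhd> z = \<omega>"
  proof -
    have "cd_k ?D \<cdot>\<^bsub>EMC\<^esub> v \<in> Hom EMC Z (cofree (G\<langle>A\<rangle>\<^sub>0))"
      using data EMv by (simp add: Hom_iff A_def)
    from trans_into_cofree[OF _ \<psi> this] show ?thesis
      by (simp add: \<phi>_def z_def \<omega>_def)
  qed
  have tf [simp]: "f \<in> Mor K" "Dom K f = carrier Z" "Cod K f = A"
    by (simp_all add: f_def)
  have t\<phi> [simp]: "\<phi> \<in> Cel K" "Src K \<phi> = a \<cdot> f" "Trg K \<phi> = G\<langle>f\<rangle>\<^sub>1 \<cdot> z"
    by (simp_all add: \<phi>_def fz) (simp add: f_def)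
  \<comment> \<open>Naturality of \<open>e\<close> moves every \<open>e\<close> next to \<open>\<omega>\<close>, where it produces \<open>\<phi>\<close>.\<close>
  have d\<phi>: "(g \<cdot> e (G\<langle>A\<rangle>\<^sub>0)) \<rhd> \<omega> = g \<rhd> \<phi>" if "g \<in> Mor K" "Dom K g = G\<langle>A\<rangle>\<^sub>0" for g
    using that by (simp add: \<phi>_def)
  have e\<alpha>: "e (G\<langle>G\<langle>A\<rangle>\<^sub>0\<rangle>\<^sub>0) \<rhd> (G\<langle>\<alpha>\<rangle>\<^sub>2 \<lhd> w) = \<alpha> \<lhd> f" "e A \<rhd> (G\<langle>\<alpha>\<^sub>0\<rangle>\<^sub>2 \<lhd> w) = \<alpha>\<^sub>0 \<lhd> f"
    by (simp_all add: counit_natural_whiskered f_def)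
  \<comment> \<open>The target of \<open>G\<phi> \<lhd> z\<close>, computed from the strict law \<open>d Z \<cdot> z = Gz \<cdot> z\<close>.\<close>
  have dw: "G\<langle>G\<langle>f\<rangle>\<^sub>1\<rangle>\<^sub>1 \<cdot> (G\<langle>z\<rangle>\<^sub>1 \<cdot> z) = d A \<cdot> w"
    using Z strict_coalg_simps(5)[OF Z] by (simp add: z_def flip: fz)
  let ?S1 = "(cd_kappa ?D \<lhd>\<^bsub>EMC\<^esub> v) \<bullet>\<^bsub>EMC\<^esub> (cd_p ?D \<rhd>\<^bsub>EMC\<^esub> \<psi>) \<bullet>\<^bsub>EMC\<^esub> (cd_rho ?D \<lhd>\<^bsub>EMC\<^esub> v) \<bullet>\<^bsub>EMC\<^esub> (cd_r ?D \<rhd>\<^bsub>EMC\<^esub> \<psi>)"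
    and ?T1 = "(cd_q ?D \<rhd>\<^bsub>EMC\<^esub> \<psi>) \<bullet>\<^bsub>EMC\<^esub> (cd_lambda ?D \<lhd>\<^bsub>EMC\<^esub> v)"
    and ?S2 = "(cd_delta ?D \<lhd>\<^bsub>EMC\<^esub> v) \<bullet>\<^bsub>EMC\<^esub> (cd_j ?D \<rhd>\<^bsub>EMC\<^esub> \<psi>) \<bullet>\<^bsub>EMC\<^esub> (cd_gamma ?D \<lhd>\<^bsub>EMC\<^esub> v)"
  have "?S1 = ?T1 \<longleftrightarrow> e (G\<langle>G\<langle>A\<rangle>\<^sub>0\<rangle>\<^sub>0) \<rhd> trans ?S1 = e (G\<langle>G\<langle>A\<rangle>\<^sub>0\<rangle>\<^sub>0) \<rhd> trans ?T1"
    by (rule cell_into_cofree_eq_iff[where Z = Z and F = "cd_r ?D \<cdot>\<^bsub>EMC\<^esub> (cd_k ?D \<cdot>\<^bsub>EMC\<^esub> v)"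
          and F' = "cd_q ?D \<cdot>\<^bsub>EMC\<^esub> (cd_l ?D \<cdot>\<^bsub>EMC\<^esub> v)"])
      (use X data EMv in \<open>simp_all add: Hom_iff Cells_iff A_def\<close>)
  also have "\<dots> \<longleftrightarrow> \<omega> \<bullet> (G\<langle>a\<rangle>\<^sub>1 \<rhd> \<phi>) = (d A \<rhd> \<phi>) \<bullet> (\<alpha> \<lhd> f)"
    by (simp add: d\<phi> e\<alpha> flip: w_def \<omega>_def defs)
  finally have 1: "?S1 = ?T1 \<longleftrightarrow> \<omega> \<bullet> (G\<langle>a\<rangle>\<^sub>1 \<rhd> \<phi>) = (d A \<rhd> \<phi>) \<bullet> (\<alpha> \<lhd> f)" .
  have "?S2 = \<iota>\<^bsub>EMC\<^esub> v \<longleftrightarrow> e A \<rhd> trans ?S2 = e A \<rhd> trans (\<iota>\<^bsub>EMC\<^esub> v)"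
    by (rule cell_into_cofree_eq_iff[where Z = Z and F = v and F' = v])
      (use X data EMv in \<open>simp_all add: Hom_iff Cells_iff A_def\<close>)
  also have "\<dots> \<longleftrightarrow> (e A \<rhd> \<phi>) \<bullet> (\<alpha>\<^sub>0 \<lhd> f) = \<iota> f"
    by (simp add: d\<phi> e\<alpha> f_def[symmetric] flip: w_def \<omega>_def defs)
  finally have 2: "?S2 = \<iota>\<^bsub>EMC\<^esub> v \<longleftrightarrow> (e A \<rhd> \<phi>) \<bullet> (\<alpha>\<^sub>0 \<lhd> f) = \<iota> f" .
  have "is_mor (cone_transpose X Z (v, \<psi>)) \<longleftrightarrow>
      (d A \<rhd> \<phi>) \<bullet> (\<alpha> \<lhd> f) = \<omega> \<bullet> (G\<langle>a\<rangle>\<^sub>1 \<rhd> \<phi>) \<and> (e A \<rhd> \<phi>) \<bullet> (\<alpha>\<^sub>0 \<lhd> f) = \<iota> f"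
    unfolding lax_mor_iff cone_transpose_sel defs[symmetric] w_def[symmetric] \<omega>_def[symmetric]
      f_def[symmetric] \<phi>_def[symmetric] z_def[symmetric] \<phi>z
    using X Z strict_coalg_is_coalg[OF Z] by (simp add: dw fz flip: z_def)
  moreover have "(v, \<psi>) \<in> descent_cones EMC ?D Z \<longleftrightarrow> ?S1 = ?T1 \<and> ?S2 = \<iota>\<^bsub>EMC\<^esub> v"
    using v \<psi> by (simp add: descent_cones_def)
  ultimately show ?thesis
    unfolding 1 2 by auto
qed

lemma descent_conesD:
  assumes "(v, \<psi>) \<in> descent_cones EMC (descent_data X) Z"
  shows "v \<in> Hom EMC Z (cofree (carrier X))"
    "\<psi> \<in> Cells EMC (cd_k (descent_data X) \<cdot>\<^bsub>EMC\<^esub> v) (cd_l (descent_data X) \<cdot>\<^bsub>EMC\<^esub> v)"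
  using assms by (auto simp: descent_cones_def)

lemma descent_data_comp_Hom:
  assumes "is_coalg X" "v \<in> Hom EMC Z (cofree (carrier X))"
  shows "cd_k (descent_data X) \<cdot>\<^bsub>EMC\<^esub> v \<in> Hom EMC Z (cofree (G\<langle>carrier X\<rangle>\<^sub>0))"
    "cd_l (descent_data X) \<cdot>\<^bsub>EMC\<^esub> v \<in> Hom EMC Z (cofree (G\<langle>carrier X\<rangle>\<^sub>0))"
  using lax_coherence_data_descent_data[OF assms(1)] EM_comp_Hom[OF assms(2)]
  by (auto simp: lax_coherence_data_def)

proposition bij_cone_transpose:
  assumes X: "is_coalg X" and Z: "is_strict Z"
  shows "bij_betw (cone_transpose X Z) (descent_cones EMC (descent_data X) Z) (Hom Lax Z X)"
proof (rule bij_betwI')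
  let ?D = "descent_data X" and ?A = "carrier X"
  have A: "?A \<in> Obj K" "G\<langle>?A\<rangle>\<^sub>0 \<in> Obj K"
    using X by simp_all
  fix c assume c: "c \<in> descent_cones EMC ?D Z"
  obtain v \<psi> where c_eq: "c = (v, \<psi>)"
    by (cases c)
  note v = descent_conesD[OF c[unfolded c_eq]]
  show "cone_transpose X Z c \<in> Hom Lax Z X"
    using descent_cone_iff_lax_mor[OF X Z v] c by (simp add: c_eq Hom_iff)
  fix c' assume c': "c' \<in> descent_cones EMC ?D Z"
  obtain v' \<psi>' where c'_eq: "c' = (v', \<psi>')"
    by (cases c')
  note v' = descent_conesD[OF c'[unfolded c'_eq]]
  show "cone_transpose X Z c = cone_transpose X Z c' \<longleftrightarrow> c = c'"
  proof
    assume eq: "cone_transpose X Z c = cone_transpose X Z c'"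
    have "e ?A \<cdot> mor v = e ?A \<cdot> mor v'"
      using arg_cong[OF eq, of mor] by (simp add: c_eq c'_eq)
    then have vv': "v = v'"
      using bij_betw_imp_inj_on[OF bij_Hom_cofree[OF A(1) Z]] v(1) v'(1) by (auto dest: inj_onD)
    have "e (G\<langle>?A\<rangle>\<^sub>0) \<rhd> trans \<psi> = e (G\<langle>?A\<rangle>\<^sub>0) \<rhd> trans \<psi>'"
      using arg_cong[OF eq, of mor_cell] by (simp add: c_eq c'_eq)
    then have "\<psi> = \<psi>'"
      using cell_into_cofree_eq_iff[OF A(2) descent_data_comp_Hom[OF X v(1)] v(2)] v'(2) vv' by simp
    then show "c = c'"
      using vv' by (simp add: c_eq c'_eq)
  qed simp
next
  let ?D = "descent_data X" and ?A = "carrier X"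
  have A: "?A \<in> Obj K" "G\<langle>?A\<rangle>\<^sub>0 \<in> Obj K"
    using X by simp_all
  fix F assume F: "F \<in> Hom Lax Z X"
  then have "mor F \<in> Hom K (carrier Z) ?A"
    by (auto simp: Hom_iff)
  then obtain v where v: "v \<in> Hom EMC Z (cofree ?A)" and f: "mor F = e ?A \<cdot> mor v"
    using bij_betw_imp_surj_on[OF bij_Hom_cofree[OF A(1) Z]] by blast
  have "mor_cell F \<in> Cells K (act X \<cdot> mor F) (G\<langle>mor F\<rangle>\<^sub>1 \<cdot> act Z)"
    using F by (auto simp: Hom_iff Cells_iff)
  moreover have "act X \<cdot> mor F = e (G\<langle>?A\<rangle>\<^sub>0) \<cdot> mor (cd_k ?D \<cdot>\<^bsub>EMC\<^esub> v)"
    "G\<langle>mor F\<rangle>\<^sub>1 \<cdot> act Z = e (G\<langle>?A\<rangle>\<^sub>0) \<cdot> mor (cd_l ?D \<cdot>\<^bsub>EMC\<^esub> v)"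
    using X EM_Hom_simps[OF v] mor_into_cofree[OF A(1) v] by (simp_all add: f)
  ultimately obtain \<psi> where \<psi>: "\<psi> \<in> Cells EMC (cd_k ?D \<cdot>\<^bsub>EMC\<^esub> v) (cd_l ?D \<cdot>\<^bsub>EMC\<^esub> v)"
    and \<phi>: "mor_cell F = e (G\<langle>?A\<rangle>\<^sub>0) \<rhd> trans \<psi>"
    using bij_betw_imp_surj_on[OF bij_Cells_cofree[OF A(2) descent_data_comp_Hom[OF X v]]] by auto
  have F_eq: "F = cone_transpose X Z (v, \<psi>)"
    using F f \<phi> by (auto simp: Hom_iff intro!: coalg_mor.expand)
  then have "(v, \<psi>) \<in> descent_cones EMC ?D Z"
    using descent_cone_iff_lax_mor[OF X Z v \<psi>] F by (simp add: Hom_iff)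
  then show "\<exists>c \<in> descent_cones EMC ?D Z. F = cone_transpose X Z c"
    using F_eq by blast
qed

text \<open>
  The condition \<open>(l \<rhd> T) \<bullet> \<psi> = \<psi>' \<bullet> (k \<rhd> T)\<close> on a cell of cones transposes to the square of a
  \<open>G\<close>-transformation: composing with \<open>eGA\<close> turns \<open>l \<rhd> T = dA \<rhd> T\<close> into \<open>T = G\<rho> \<lhd> z\<close> and
  \<open>k \<rhd> T = Ga \<rhd> T\<close> into \<open>a \<rhd> \<rho>\<close>, where \<open>\<rho> = eA \<rhd> T\<close>.
\<close>

proposition bij_cone_cell_transpose:
  assumes X: "is_coalg X" and Z: "is_strict Z"
    and c: "c \<in> descent_cones EMC (descent_data X) Z" and c': "c' \<in> descent_cones EMC (descent_data X) Z"
  shows "bij_betw (\<lambda>T. Coalg_Trans (cone_transpose X Z c) (cone_transpose X Z c') (e (carrier X) \<rhd> trans T))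
    (inserter_cone_cells EMC (cd_k (descent_data X)) (cd_l (descent_data X)) c c')
    (Cells Lax (cone_transpose X Z c) (cone_transpose X Z c'))"
proof -
  let ?D = "descent_data X" and ?A = "carrier X" and ?F = "cone_transpose X Z c" and ?F' = "cone_transpose X Z c'"
  have A: "?A \<in> Obj K" "G\<langle>?A\<rangle>\<^sub>0 \<in> Obj K"
    using X by simp_all
  obtain v \<psi> v' \<psi>' where c_eq: "c = (v, \<psi>)" "c' = (v', \<psi>')"
    by (cases c; cases c')
  note v = descent_conesD[OF c[unfolded c_eq]] descent_conesD[OF c'[unfolded c_eq]]
  note EMv = v[unfolded Hom_iff Cells_iff]
  note data = lax_coherence_data_descent_data[OF X, unfolded lax_coherence_data_def Hom_iff Cells_iff]
  define P where "P \<rho> \<longleftrightarrow> (G\<langle>\<rho>\<rangle>\<^sub>2 \<lhd> act Z) \<bullet> mor_cell ?F = mor_cell ?F' \<bullet> (act X \<rhd> \<rho>)" for \<rho>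
  have P: "(cd_l ?D \<rhd>\<^bsub>EMC\<^esub> T) \<bullet>\<^bsub>EMC\<^esub> \<psi> = \<psi>' \<bullet>\<^bsub>EMC\<^esub> (cd_k ?D \<rhd>\<^bsub>EMC\<^esub> T) \<longleftrightarrow> P (e ?A \<rhd> trans T)"
    if T: "T \<in> Cells EMC v v'" for T
  proof -
    note Tv = EM_Hom_simps[OF v(1)] EM_Hom_simps[OF v(3)] EM_Cells_simps[OF T]
      EM_Cells_simps[OF v(2)] EM_Cells_simps[OF v(4)]
    have "(cd_l ?D \<rhd>\<^bsub>EMC\<^esub> T) \<bullet>\<^bsub>EMC\<^esub> \<psi> = \<psi>' \<bullet>\<^bsub>EMC\<^esub> (cd_k ?D \<rhd>\<^bsub>EMC\<^esub> T) \<longleftrightarrow>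
       e (G\<langle>?A\<rangle>\<^sub>0) \<rhd> trans ((cd_l ?D \<rhd>\<^bsub>EMC\<^esub> T) \<bullet>\<^bsub>EMC\<^esub> \<psi>)
        = e (G\<langle>?A\<rangle>\<^sub>0) \<rhd> trans (\<psi>' \<bullet>\<^bsub>EMC\<^esub> (cd_k ?D \<rhd>\<^bsub>EMC\<^esub> T))"
      by (rule cell_into_cofree_eq_iff[OF A(2) descent_data_comp_Hom(1)[OF X v(1)]
            descent_data_comp_Hom(2)[OF X v(3)]])
        (use data EMv T in \<open>auto simp: Cells_iff\<close>)
    also have "\<dots> \<longleftrightarrow> trans T \<bullet> (e (G\<langle>?A\<rangle>\<^sub>0) \<rhd> trans \<psi>)
        = (e (G\<langle>?A\<rangle>\<^sub>0) \<rhd> trans \<psi>') \<bullet> (act X \<rhd> (e ?A \<rhd> trans T))"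
      using X A Tv by simp
    also have "\<dots> \<longleftrightarrow> P (e ?A \<rhd> trans T)"
      by (simp only: P_def c_eq cone_transpose_sel trans_into_cofree[OF A(1) T v(1)])
    finally show ?thesis .
  qed
  have "bij_betw (\<lambda>T. e ?A \<rhd> trans T) {T \<in> Cells EMC v v'. (cd_l ?D \<rhd>\<^bsub>EMC\<^esub> T) \<bullet>\<^bsub>EMC\<^esub> \<psi> = \<psi>' \<bullet>\<^bsub>EMC\<^esub> (cd_k ?D \<rhd>\<^bsub>EMC\<^esub> T)}
      {\<rho> \<in> Cells K (e ?A \<cdot> mor v) (e ?A \<cdot> mor v'). P \<rho>}"
    by (rule bij_betw_restrict[OF bij_Cells_cofree[OF A(1) v(1,3)]]) (rule P)
  moreover have "bij_betw (Coalg_Trans ?F ?F') {\<rho> \<in> Cells K (e ?A \<cdot> mor v) (e ?A \<cdot> mor v'). P \<rho>} (Cells Lax ?F ?F')"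
  proof (rule bij_betw_byWitness[where f' = trans])
    have "is_mor ?F" "is_mor ?F'"
      using descent_cone_iff_lax_mor[OF X Z v(1,2)] descent_cone_iff_lax_mor[OF X Z v(3,4)] c c'
      by (auto simp: c_eq)
    then have Lax_iff: "T \<in> Cells Lax ?F ?F' \<longleftrightarrow> trans_src T = ?F \<and> trans_trg T = ?F' \<and>
        trans T \<in> Cells K (e ?A \<cdot> mor v) (e ?A \<cdot> mor v') \<and> P (trans T)" for T
      unfolding Cells_iff Lax_simps G_trans_iff P_def by (auto simp: c_eq)
    show "Coalg_Trans ?F ?F' ` {\<rho> \<in> Cells K (e ?A \<cdot> mor v) (e ?A \<cdot> mor v'). P \<rho>} \<subseteq> Cells Lax ?F ?F'"
      "trans ` Cells Lax ?F ?F' \<subseteq> {\<rho> \<in> Cells K (e ?A \<cdot> mor v) (e ?A \<cdot> mor v'). P \<rho>}"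
      "\<forall>T \<in> Cells Lax ?F ?F'. Coalg_Trans ?F ?F' (trans T) = T"
      by (auto simp: Lax_iff intro!: coalg_trans.expand)
  qed simp
  ultimately show ?thesis
    by (auto dest: bij_betw_trans simp: comp_def inserter_cone_cells_def c_eq)
qed

text \<open>
  Restricting a cone along a strict morphism \<open>u\<close> corresponds to composing the lax morphism with \<open>u\<close>:
  the structure cell of \<open>u\<close> is an identity and drops out of the composite.
\<close>

lemma cone_transpose_natural:
  assumes X: "is_coalg X" and c: "(v, \<psi>) \<in> descent_cones EMC (descent_data X) L" and u: "u \<in> Hom EMC Z L"
  shows "cone_transpose X L (v, \<psi>) \<cdot>\<^bsub>Lax\<^esub> u
    = cone_transpose X Z (v \<cdot>\<^bsub>EMC\<^esub> u, \<psi> \<lhd>\<^bsub>EMC\<^esub> u)"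
proof -
  note v = descent_conesD[OF c]
  note t = EM_Hom_simps[OF v(1)] EM_Hom_simps[OF u] EM_Cells_simps[OF v(2)]
  have u': "is_strict_mor u" "mor_dom u = Z" "mor_cod u = L"
    using u by (auto simp: EM_Hom_iff)
  have L: "is_strict L"
    using u' by auto
  have "G\<langle>e (carrier X) \<cdot> mor v\<rangle>\<^sub>1 \<cdot> act L = mor v"
    using X by (intro mor_into_cofree v) simp
  from comp1_eq_under[OF this, of "mor u"]
  have "G\<langle>e (carrier X)\<rangle>\<^sub>1 \<cdot> (G\<langle>mor v\<rangle>\<^sub>1 \<cdot> (act L \<cdot> mor u)) = mor v \<cdot> mor u"
    using X L t by simp
  then show ?thesis
    using X L t u' by (intro coalg_mor.expand) simp
qed

lemma EM_inclusion_sel: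
  "EM_inclusion\<langle>X\<rangle>\<^sub>0 = X" "EM_inclusion\<langle>F\<rangle>\<^sub>1 = F" "EM_inclusion\<langle>T\<rangle>\<^sub>2 = T"
  by (simp_all add: EM_inclusion_def id_fun_def)

text \<open>
  The counit at \<open>X\<close> is the transpose of the universal cone, and composition with it is the
  composite of the isomorphism given by the descent object with transposition.
\<close>

theorem has_right_adjoint_EM_inclusion:
  assumes "has_lax_descent_objects EMC"
  shows "has_right_adjoint EMC Lax EM_inclusion"
proof -
  have "\<exists>L v \<psi>. is_coalg X \<longrightarrow> is_lax_descent EMC (descent_data X) L v \<psi>" for X
    using assms lax_coherence_data_descent_data[of X] unfolding has_lax_descent_objects_def by blast
  then obtain L v \<psi> where descent: "\<And>X. is_coalg X \<Longrightarrow> is_lax_descent EMC (descent_data X) (L X) (v X) (\<psi> X)"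
    by metis
  define \<epsilon> where "\<epsilon> X = cone_transpose X (L X) (v X, \<psi> X)" for X
  have L: "is_strict (L X)" and cone: "(v X, \<psi> X) \<in> descent_cones EMC (descent_data X) (L X)"
    if "is_coalg X" for X
    using descent[OF that] by (auto simp: is_lax_descent_def EM_sel(1))
  interpret couniversal_arrows EMC Lax EM_inclusion L \<epsilon>
  proof (intro couniversal_arrows.intro couniversal_arrows_axioms.intro two_functor_EM_inclusion)
    fix X assume "X \<in> Obj Lax"
    then have X: "is_coalg X"
      by simp
    show "L X \<in> Obj EMC"
      using L[OF X] by (simp add: EM_sel(1))
    show "\<epsilon> X \<in> Hom Lax (EM_inclusion\<langle>L X\<rangle>\<^sub>0) X"
      using bij_betw_apply[OF bij_cone_transpose[OF X L[OF X]] cone[OF X]]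
      by (simp add: \<epsilon>_def EM_inclusion_sel)
    fix Z assume Z': "Z \<in> Obj EMC"
    then have Z: "is_strict Z"
      by (simp add: EM_sel(1))
    have eps: "\<epsilon> X \<cdot>\<^bsub>Lax\<^esub> u = cone_transpose X Z (v X \<cdot>\<^bsub>EMC\<^esub> u, \<psi> X \<lhd>\<^bsub>EMC\<^esub> u)" if "u \<in> Hom EMC Z (L X)" for u
      unfolding \<epsilon>_def using cone_transpose_natural[OF X cone[OF X] that] .
    have bij: "bij_betw (\<lambda>u. (v X \<cdot>\<^bsub>EMC\<^esub> u, \<psi> X \<lhd>\<^bsub>EMC\<^esub> u)) (Hom EMC Z (L X)) (descent_cones EMC (descent_data X) Z)"
      using descent[OF X] Z' by (simp add: is_lax_descent_def)
    from bij_betw_trans[OF bij bij_cone_transpose[OF X Z]]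
    show "bij_betw (\<lambda>u. \<epsilon> X \<cdot>\<^bsub>Lax\<^esub> EM_inclusion\<langle>u\<rangle>\<^sub>1) (Hom EMC Z (L X)) (Hom Lax (EM_inclusion\<langle>Z\<rangle>\<^sub>0) X)"
      unfolding EM_inclusion_sel by (simp add: comp_def eps cong: bij_betw_cong del: Lax_simps)
    fix u u' assume u: "u \<in> Hom EMC Z (L X)" and u': "u' \<in> Hom EMC Z (L X)"
    let ?c = "\<lambda>u. (v X \<cdot>\<^bsub>EMC\<^esub> u, \<psi> X \<lhd>\<^bsub>EMC\<^esub> u)"
    have "bij_betw (\<lambda>\<tau>. v X \<rhd>\<^bsub>EMC\<^esub> \<tau>) (Cells EMC u u')
          (inserter_cone_cells EMC (cd_k (descent_data X)) (cd_l (descent_data X)) (?c u) (?c u'))"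
      using descent[OF X] Z' u u' by (simp add: is_lax_descent_def)
    from bij_betw_trans[OF this bij_cone_cell_transpose[OF X Z bij_betw_apply[OF bij u] bij_betw_apply[OF bij u']]]
    have "bij_betw (\<lambda>\<tau>. Coalg_Trans (\<epsilon> X \<cdot>\<^bsub>Lax\<^esub> u) (\<epsilon> X \<cdot>\<^bsub>Lax\<^esub> u') (e (carrier X) \<rhd> (mor (v X) \<rhd> trans \<tau>)))
        (Cells EMC u u') (Cells Lax (\<epsilon> X \<cdot>\<^bsub>Lax\<^esub> u) (\<epsilon> X \<cdot>\<^bsub>Lax\<^esub> u'))"
      by (simp add: comp_def eps u u' del: Lax_simps)
    moreover have "Coalg_Trans (\<epsilon> X \<cdot>\<^bsub>Lax\<^esub> u) (\<epsilon> X \<cdot>\<^bsub>Lax\<^esub> u') (e (carrier X) \<rhd> (mor (v X) \<rhd> trans \<tau>))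
        = \<epsilon> X \<rhd>\<^bsub>Lax\<^esub> \<tau>" if \<tau>: "\<tau> \<in> Cells EMC u u'" for \<tau>
    proof -
      have "mor (\<epsilon> X) = e (carrier X) \<cdot> mor (v X)"
        by (simp add: \<epsilon>_def)
      moreover have "trans_src \<tau> = u" "trans_trg \<tau> = u'"
        using \<tau> by (simp_all add: EM_Cells_iff)
      ultimately show ?thesis
        using X EM_Hom_simps[OF descent_conesD(1)[OF cone[OF X]]] EM_Hom_simps[OF u] EM_Cells_simps[OF \<tau>]
        by (simp add: whisker_left_def[of Lax] whisker_left_def[of K, symmetric])
    qed
    ultimately show "bij_betw (\<lambda>\<tau>. \<epsilon> X \<rhd>\<^bsub>Lax\<^esub> EM_inclusion\<langle>\<tau>\<rangle>\<^sub>2) (Cells EMC u u')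
        (Cells Lax (\<epsilon> X \<cdot>\<^bsub>Lax\<^esub> EM_inclusion\<langle>u\<rangle>\<^sub>1) (\<epsilon> X \<cdot>\<^bsub>Lax\<^esub> EM_inclusion\<langle>u'\<rangle>\<^sub>1))"
      unfolding EM_inclusion_sel by (simp cong: bij_betw_cong del: Lax_simps)
  qed
  show ?thesis
    by (rule has_right_adjoint)
qed

end

theorem theorem8p5:
  fixes K :: "('o, 'm, 'c) two_cat"
    and G :: "('o, 'm, 'c, 'o, 'm, 'c) two_fun"
    and d e :: "'o \<Rightarrow> 'm"
  assumes "two_comonad K G d e"
  shows "(has_lax_descent_objects (EM K G d e) \<longrightarrow>
            has_right_adjoint (EM K G d e) (Lax_Coalg K G d e) EM_inclusion) \<and>
         (has_inserters (EM K G d e) \<and> has_equifiers (EM K G d e) \<longrightarrow>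
            has_lax_descent_objects (EM K G d e) \<and>
            has_right_adjoint (EM K G d e) (Lax_Coalg K G d e) EM_inclusion)"
proof -
  interpret two_comonad K G d e
    by (rule assms)
  show ?thesis
    using has_right_adjoint_EM_inclusion EM.has_lax_descent_objects_if_inserters_equifiers by blast
qed

end
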